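(* Let $1\le m<d$, $n=d-m$, let $A\in\mathbb R^{d\times m}$ have full column rank, let $B\in\mathscr B_A$, and let $\Sigma_\star\in\mathscr P_n$ be the hidden coordinate of the canonical controller, i.e. $\Phi_A(B,\Sigma_\star)=s_A(B)$. Let $\Sigma_0\in\mathscr P_n$ be arbitrary and put $$D_0=d_{\mathrm{AI}}(R_0,\mathcal Q_{\Sigma_0}),\qquad L_0=\psi(D_0/\sqrt2),\qquad q_0=1-L_0^{-1}.$$ (If $D_0=0$ the initial controller is already canonical.) Let $$\Sigma_{k+1}=\Sigma_k^{1/2}\exp\!\left(L_0^{-1}W_B(\Sigma_k)\right)\Sigma_k^{1/2},\qquad k\ge0.$$ Then $\det\Sigma_k=1$ for all $k$ and $$f_B(\Sigma_{k+1})\le f_B(\Sigma_k)-\frac1{2L_0}\|W_B(\Sigma_k)\|_F^2,$$ $$f_B(\Sigma_k)-f_B(\Sigma_\star)\le\frac{D_0^2}{2}q_0^k,$$ $$d_{\mathrm{AI}}(\Sigma_k,\Sigma_\star)=d_{\mathrm{AI}}(\Phi_A(B,\Sigma_k),s_A(B))\le D_0q_0^{k/2},$$ $$\|W_B(\Sigma_k)\|_F\le\sqrt{L_0}\,D_0\,q_0^{k/2}.$$ The observable residual gives the posterior certificates $$d_{\mathrm{AI}}(\Phi_A(B,\Sigma_k),s_A(B))\le\|W_B(\Sigma_k)\|_F,\qquad 0\le f_B(\Sigma_k)-f_B(\Sigma_\star)\le\frac12\|W_B(\Sigma_k)\|_F^2,$$ which are sharp (the constants $1$ and $\tfrac12$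 cannot be decreased uniformly over the family of such problems). For $D_0>0$ put $\chi_0=-\log q_0=-\log(1-L_0^{-1})$. Then for tolerances $\varepsilon_f,\varepsilon_x,\varepsilon_r>0$, the bounds $f_B(\Sigma_k)-f_B(\Sigma_\star)\le\varepsilon_f$, $d_{\mathrm{AI}}(\Phi_A(B,\Sigma_k),s_A(B))\le\varepsilon_x$, and $\|W_B(\Sigma_k)\|_F\le\varepsilon_r$ are guaranteed, respectively, for every integer $$k\ge\frac1{\chi_0}\left[\log\frac{D_0^2}{2\varepsilon_f}\right]_+,\qquad k\ge\frac2{\chi_0}\left[\log\frac{D_0}{\varepsilon_x}\right]_+,\qquad k\ge\frac2{\chi_0}\left[\log\frac{\sqrt{L_0}D_0}{\varepsilon_r}\right]_+ .$$
   Context: $[t]_+=\max\{t,0\}$; $\psi(s)=s\coth s$ for $s>0$ and $\psi(0)=1$; $0^0=1$. $\mathbb S_{++}^d$ denotes real symmetric positive definite matrices with affine-invariant metric $\langle X,Y\rangle_P=\operatorname{tr}(P^{-1}XP^{-1}Y)$ and distance $d_{\mathrm{AI}}(P,P')=\|\log(P^{-1/2}P'P^{-1/2})\|_F$; $\mathscr P_d=\{P\in\mathbb S_{++}^d:\det P=1\}$. $\mathscr B_A=\{B\in\mathbb R^{d\times m}:A^\top B\in\mathbb S_{++}^m\}$. Fix $A=UC$ with $U^\top U=I_m$, $C$ invertible, and $Q=[U,V]\in O(d)$. For $B\in\mathscr B_A$ let $M=C^{-\top}A^\top BC^{-1}$, $N=V^\top BC^{-1}$, $T=NM^{-1}$,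 $L=\begin{pmatrix}I_m&0\\ T&I_n\end{pmatrix}$, $\rho=(\det M)^{-1/n}$, and $$\Phi_A(B,\Sigma)=QL\begin{pmatrix}M&0\\0&\rho\Sigma\end{pmatrix}L^\top Q^\top,\qquad\Sigma\in\mathscr P_n;$$ $\Sigma\mapsto\Phi_A(B,\Sigma)$ is a bijection from $\mathscr P_n$ onto the fiber $\{P\in\mathscr P_d:PA=B\}$. The canonical controller $s_A(B)$ is the unique minimizer of $d_{\mathrm{AI}}(I,P)$ over this fiber. Put $R_0=L^{-1}L^{-\top}$, $\mathcal Q_\Sigma=\operatorname{diag}(M,\rho\Sigma)$, $f_B(\Sigma)=\tfrac12d_{\mathrm{AI}}(R_0,\mathcal Q_\Sigma)^2$, $\mathcal R(\Sigma)=\log(\mathcal Q_\Sigma^{-1/2}R_0\mathcal Q_\Sigma^{-1/2})$, with $\mathcal R_{22}(\Sigma)$ its lower-right $n\times n$ block, and $W_B(\Sigma)=\mathcal R_{22}(\Sigma)^\circ$, where $X^\circ=X-\frac{\operatorname{tr}X}{n}I_n$. *)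

theory Defs
  imports "HOL-Analysis.Analysis"
begin

text \<open>
  Real \<open>d \<times> m\<close> matrices are elements of \<open>real^'m^'d\<close>. The norm of this type is the
  Euclidean norm of all entries, i.e. the Frobenius norm. The splitting \<open>d = m + n\<close> is
  carried by the index type \<open>'m + 'n\<close>, with \<open>Inl\<close> for the first block.
\<close>

definition psi :: "real \<Rightarrow> real" where
  "psi s = (if s = 0 then 1 else s * (cosh s / sinh s))"

definition spd :: "real^'a^'a \<Rightarrow> bool" where
  "spd P \<longleftrightarrow> transpose P = P \<and> (\<forall>x. x \<noteq> 0 \<longrightarrow> x \<bullet> (P *v x) > 0)"

definition SPD1 :: "(real^'a^'a) set" where
  "SPD1 = {P. spd P \<and> det P = 1}"

definition mat_exp :: "real^'a^'a \<Rightarrow> real^'a^'a" where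
  "mat_exp X = (\<Sum>k. (1 / fact k) *\<^sub>R (((**) X ^^ k) (mat 1)))"

text \<open>The next two are only meaningful on positive definite arguments.\<close>

definition mat_log :: "real^'a^'a \<Rightarrow> real^'a^'a" where
  "mat_log P = (THE S. transpose S = S \<and> mat_exp S = P)"

definition mat_sqrt :: "real^'a^'a \<Rightarrow> real^'a^'a" where
  "mat_sqrt P = (THE S. spd S \<and> S ** S = P)"

definition inv_sqrt :: "real^'a^'a \<Rightarrow> real^'a^'a" where
  "inv_sqrt P = matrix_inv (mat_sqrt P)"

definition ai_dist :: "real^'a^'a \<Rightarrow> real^'a^'a \<Rightarrow> real" where
  "ai_dist P P' = norm (mat_log (inv_sqrt P ** P' ** inv_sqrt P))"

definition block_mat ::
  "real^'m^'m \<Rightarrow> real^'n^'m \<Rightarrow> real^'m^'n \<Rightarrow> real^'n^'n \<Rightarrow> real^('m + 'n)^('m + 'n)" where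
  "block_mat X Y Z W = (\<chi> i j. case i of
      Inl a \<Rightarrow> (case j of Inl b \<Rightarrow> X $ a $ b | Inr b \<Rightarrow> Y $ a $ b)
    | Inr a \<Rightarrow> (case j of Inl b \<Rightarrow> Z $ a $ b | Inr b \<Rightarrow> W $ a $ b))"

definition append_cols :: "real^'m^'d \<Rightarrow> real^'n^'d \<Rightarrow> real^('m + 'n)^'d" where
  "append_cols U V = (\<chi> i j. case j of Inl b \<Rightarrow> U $ i $ b | Inr b \<Rightarrow> V $ i $ b)"

definition lower_right :: "real^('m::finite + 'n::finite)^('m + 'n) \<Rightarrow> real^'n^'n" where
  "lower_right X = (\<chi> i j. X $ Inr i $ Inr j)"

definition traceless :: "real^'n^'n \<Rightarrow> real^'n^'n" where
  "traceless X = X - (trace X / real CARD('n)) *\<^sub>R mat 1"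

definition admissible :: "real^'m^'d \<Rightarrow> (real^'m^'d) set" where
  "admissible A = {B. spd (transpose A ** B)}"

definition fiber :: "real^'m^'d \<Rightarrow> real^'m^'d \<Rightarrow> (real^'d^'d) set" where
  "fiber A B = {P \<in> SPD1. P ** A = B}"

definition canonical_controller :: "real^'m^'d \<Rightarrow> real^'m^'d \<Rightarrow> real^'d^'d" where
  "canonical_controller A B = (THE P. is_arg_min (ai_dist (mat 1)) (\<lambda>P. P \<in> fiber A B) P)"

text \<open>
  The data \<open>A = U C\<close>, \<open>Q = [U, V] \<in> O(d)\<close>, \<open>B \<in> admissible A\<close>. Both identities for \<open>Q\<close>
  are required because its row and column index types differ.
\<close>

definition problem_data ::
  "real^'m^'d \<Rightarrow> real^'m^'d \<Rightarrow> real^'m^'m \<Rightarrow> real^'n^'d \<Rightarrow> real^'m^'d \<Rightarrow> bool" where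
  "problem_data A U C V B \<longleftrightarrow>
     rank A = CARD('m) \<and> A = U ** C \<and> transpose U ** U = mat 1 \<and> invertible C \<and>
     transpose (append_cols U V) ** append_cols U V = mat 1 \<and>
     append_cols U V ** transpose (append_cols U V) = mat 1 \<and>
     B \<in> admissible A"

definition blk_M :: "real^'m^'d \<Rightarrow> real^'m^'m \<Rightarrow> real^'m^'d \<Rightarrow> real^'m^'m" where
  "blk_M A C B = transpose (matrix_inv C) ** transpose A ** B ** matrix_inv C"

definition blk_N :: "real^'m^'m \<Rightarrow> real^'n^'d \<Rightarrow> real^'m^'d \<Rightarrow> real^'m^'n" where
  "blk_N C V B = transpose V ** B ** matrix_inv C"

definition blk_T ::
  "real^'m^'d \<Rightarrow> real^'m^'m \<Rightarrow> real^'n^'d \<Rightarrow> real^'m^'d \<Rightarrow> real^'m^'n" where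
  "blk_T A C V B = blk_N C V B ** matrix_inv (blk_M A C B)"

definition blk_L ::
  "real^'m^'d \<Rightarrow> real^'m^'m \<Rightarrow> real^'n^'d \<Rightarrow> real^'m^'d \<Rightarrow> real^('m + 'n)^('m + 'n)" where
  "blk_L A C V B = block_mat (mat 1) 0 (blk_T A C V B) (mat 1)"

definition Qcal ::
  "real^'m^'d \<Rightarrow> real^'m^'m \<Rightarrow> real^'m^'d \<Rightarrow> real^'n^'n \<Rightarrow> real^('m + 'n)^('m + 'n)" where
  "Qcal A C B S = (let M = blk_M A C B; \<rho> = det M powr (- 1 / real CARD('n))
                   in block_mat M 0 0 (\<rho> *\<^sub>R S))"

definition Phi ::
  "real^'m^'d \<Rightarrow> real^'m^'d \<Rightarrow> real^'m^'m \<Rightarrow> real^'n^'d \<Rightarrow> real^'m^'d \<Rightarrow> real^'n^'n \<Rightarrow> real^'d^'d"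
  where
  "Phi A U C V B S = (let Q = append_cols U V; L = blk_L A C V B
                      in Q ** L ** Qcal A C B S ** transpose L ** transpose Q)"

definition R0 ::
  "real^'m^'d \<Rightarrow> real^'m^'m \<Rightarrow> real^'n^'d \<Rightarrow> real^'m^'d \<Rightarrow> real^('m + 'n)^('m + 'n)" where
  "R0 A C V B = matrix_inv (blk_L A C V B) ** matrix_inv (transpose (blk_L A C V B))"

definition cost ::
  "real^'m^'d \<Rightarrow> real^'m^'m \<Rightarrow> real^'n^'d \<Rightarrow> real^'m^'d \<Rightarrow> real^'n^'n \<Rightarrow> real" where
  "cost A C V B S = 1 / 2 * (ai_dist (R0 A C V B) (Qcal A C B S))\<^sup>2"

definition Rcal ::
  "real^'m^'d \<Rightarrow> real^'m^'m \<Rightarrow> real^'n^'d \<Rightarrow> real^'m^'d \<Rightarrow> real^'n^'n \<Rightarrow> real^('m + 'n)^('m + 'n)"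
  where
  "Rcal A C V B S =
     mat_log (inv_sqrt (Qcal A C B S) ** R0 A C V B ** inv_sqrt (Qcal A C B S))"

definition residual ::
  "real^'m^'d \<Rightarrow> real^'m^'m \<Rightarrow> real^'n^'d \<Rightarrow> real^'m^'d \<Rightarrow> real^'n^'n \<Rightarrow> real^'n^'n" where
  "residual A C V B S = traceless (lower_right (Rcal A C V B S))"

definition init_dist ::
  "real^'m^'d \<Rightarrow> real^'m^'m \<Rightarrow> real^'n^'d \<Rightarrow> real^'m^'d \<Rightarrow> real^'n^'n \<Rightarrow> real" where
  "init_dist A C V B S0 = ai_dist (R0 A C V B) (Qcal A C B S0)"

definition step_const ::
  "real^'m^'d \<Rightarrow> real^'m^'m \<Rightarrow> real^'n^'d \<Rightarrow> real^'m^'d \<Rightarrow> real^'n^'n \<Rightarrow> real" where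
  "step_const A C V B S0 = psi (init_dist A C V B S0 / sqrt 2)"

primrec iterate ::
  "real^'m^'d \<Rightarrow> real^'m^'m \<Rightarrow> real^'n^'d \<Rightarrow> real^'m^'d \<Rightarrow> real^'n^'n \<Rightarrow> nat \<Rightarrow> real^'n^'n" where
  "iterate A C V B S0 0 = S0"
| "iterate A C V B S0 (Suc k) =
     mat_sqrt (iterate A C V B S0 k) **
     mat_exp (inverse (step_const A C V B S0) *\<^sub>R residual A C V B (iterate A C V B S0 k)) **
     mat_sqrt (iterate A C V B S0 k)"

end

theory Submission
  imports Defs
begin

text \<open>
  The cost is half a squared distance in a Hadamard manifold, restricted to a totally geodesic
  submanifold, and the iteration is Riemannian gradient descent with step \<open>1 / L0\<close>. Everything
  rests on two-sided bounds of the second derivative of \<open>g t = d(R, \<gamma> t)\<^sup>2 / 2\<close> along a geodesic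
  \<open>\<gamma>\<close> with velocity \<open>Y\<close>, where \<open>d\<close> is the affine-invariant distance:
  \<open>\<bar>Y\<bar>\<^sup>2 \<le> g'' \<le> \<psi>(d / \<surd>2) \<bar>Y\<bar>\<^sup>2\<close>.

  Up to congruence, \<open>g t = \<bar>log R\<^sub>t\<bar>\<^sup>2 / 2\<close> with \<open>R\<^sub>t = exp(tY/2) R exp(tY/2)\<close>, and
  \<open>g' t = \<langle>log R\<^sub>t, Y\<rangle>\<close>. For \<open>log R\<^sub>t\<close> with eigenvalues \<open>l\<^sub>i\<close>, the second derivative is
  \<open>\<Sum> \<psi>((l\<^sub>i - l\<^sub>j) / 2) y\<^sub>i\<^sub>j\<^sup>2\<close>, where \<open>y\<close> is \<open>Y\<close> in an eigenbasis. Since \<open>\<psi> \<ge> 1\<close> and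
  \<open>\<bar>l\<^sub>i - l\<^sub>j\<bar> \<le> \<surd>2 \<bar>log R\<^sub>t\<bar>\<close>, both bounds follow. The matrix logarithm is never differentiated.
  Instead the increment \<open>log R\<^sub>t - log R\<close> is written in a mixed pair of bases, an eigenbasis of \<open>R\<close>
  on the left and one of \<open>R\<^sub>t\<close> on the right (\<open>curve_mixed\<close>). There it is an exact entrywise divided
  difference, whatever the multiplicities, and it yields first-order expansions with an error
  \<open>O(t\<^sup>2)\<close> that is uniform on bounded sets (\<open>curve_step\<close>). Summing over fine subdivisions
  (\<open>increments_le\<close>) turns these into the derivative of \<open>g\<close> and into bounds on the increments
  of \<open>g'\<close>.

  The lower bound gives strong convexity (\<open>curve_strongly_convex\<close>). The upper bound holds only as
  long as the distance does not exceed its initial value; convexity keeps the path inside this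
  sublevel set up to the first zero of \<open>g'\<close>, and that zero cannot come before time \<open>1 / L0\<close>
  (\<open>curve_descent\<close>).

  In block form the factorization by \<open>L\<close> is a congruence that identifies the fiber isometrically
  with the matrices \<open>diag(M, \<rho>\<Sigma>)\<close>, \<open>det \<Sigma> = 1\<close>. A minimizer exists by compactness of balls, its
  residual vanishes because a descent step cannot improve it, and strong convexity makes it unique
  and gives quadratic growth. Strong convexity from the iterate to the minimizer bounds the gap
  in the cost by half the squared residual; with the descent inequality this gives the linear
  rate, and with quadratic growth the distance certificate. For \<open>T = 0\<close>, \<open>M = I\<close> the residual
  is \<open>- log \<Sigma>\<close>, and both certificates are equalities.
\<close>

section \<open>Matrices given by an eigenbasis\<close>

definition diagm :: "('a \<Rightarrow> real) \<Rightarrow> real^'a^'a" where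
  "diagm f = (\<chi> i j. if i = j then f i else 0)"

text \<open>
  The two index types may differ, so that the same notion covers a change between \<open>'m + 'n\<close> and
  \<open>'d\<close>.
\<close>

definition frame :: "real^'b^'a \<Rightarrow> bool" where
  "frame U \<longleftrightarrow> transpose U ** U = mat 1 \<and> U ** transpose U = mat 1"

definition eigform :: "real^'b^'a \<Rightarrow> ('b \<Rightarrow> real) \<Rightarrow> real^'a^'a" where
  "eigform U f = U ** diagm f ** transpose U"

lemma diagm_mult: "diagm f ** diagm g = diagm (\<lambda>i. f i * g i)" for f :: "'a::finite \<Rightarrow> real"
  by (simp add: diagm_def matrix_matrix_mult_def vec_eq_iff if_distrib[of "\<lambda>x. x * _"] sum.delta cong: if_cong)

lemma transpose_diagm [simp]: "transpose (diagm f) = diagm f"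
  by (auto simp: diagm_def transpose_def vec_eq_iff)

lemma diagm_one: "diagm (\<lambda>_. 1) = mat 1"
  by (auto simp: diagm_def mat_def vec_eq_iff)

lemma diagm_vector_nth: "(diagm f *v x) $ i = f i * x $ i"
  by (simp add: diagm_def matrix_vector_mult_def if_distrib[of "\<lambda>x. x * _"] sum.delta cong: if_cong)

lemma mult_diagm_nth: "(A ** diagm f) $ i $ j = A $ i $ j * f j" for A :: "real^'b^'a"
  by (simp add: diagm_def matrix_matrix_mult_def if_distrib[of "\<lambda>x. _ * x"] sum.delta cong: if_cong)

lemma diagm_mult_nth: "(diagm f ** A) $ i $ j = f i * A $ i $ j" for A :: "real^'b^'a"
  by (simp add: diagm_def matrix_matrix_mult_def if_distrib[of "\<lambda>x. x * _"] sum.delta cong: if_cong)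

lemma matrix_mult_nth: "(A ** B) $ i $ j = (\<Sum>k\<in>UNIV. A $ i $ k * B $ k $ j)"
  by (simp add: matrix_matrix_mult_def)

lemma matrix_diff_ldistrib: "A ** (B - C) = A ** B - A ** C" for A :: "real^'b^'a"
  by (simp add: vec_eq_iff matrix_mult_nth algebra_simps sum_subtractf)

lemma matrix_diff_rdistrib: "(A - B) ** C = A ** C - B ** C" for A :: "real^'b^'a"
  by (simp add: vec_eq_iff matrix_mult_nth algebra_simps sum_subtractf)

lemma matrix_add_rdistrib: "(A + B) ** C = A ** C + B ** C" for A :: "real^'b^'a"
  by (simp add: vec_eq_iff matrix_mult_nth algebra_simps sum.distrib)

lemma matrix_scale_left: "(c *\<^sub>R A) ** B = c *\<^sub>R (A ** B)" for A :: "real^'b^'a"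
  by (simp add: scalar_matrix_assoc)

lemma matrix_scale_right: "A ** (c *\<^sub>R B) = c *\<^sub>R (A ** B)" for A :: "real^'b^'a"
  by (simp add: matrix_scalar_ac scalar_matrix_assoc)

lemma eigform_nth: "eigform U f $ i $ j = (\<Sum>k\<in>UNIV. f k * (U $ i $ k * U $ j $ k))"
  unfolding eigform_def matrix_mult_nth[of "U ** diagm f"] mult_diagm_nth by (simp add: transpose_def mult_ac)

lemma frame_cancel:
  assumes "frame U"
  shows "transpose U ** U = mat 1" "U ** transpose U = mat 1"
    "A ** transpose U ** U = A" "B ** U ** transpose U = B"
  using assms by (simp_all add: frame_def flip: matrix_mul_assoc)

lemma frame_square:
  fixes U :: "real^'a^'a" assumes "transpose U ** U = mat 1" shows "frame U"
  using assms unfolding frame_def by (meson matrix_left_right_inverse)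

lemma frame_mat_1 [simp]: "frame (mat 1)" by (simp add: frame_def)

lemma frame_transpose [simp]: "frame (transpose U) = frame U"
  by (auto simp: frame_def)

lemma frame_mult: "frame U \<Longrightarrow> frame V \<Longrightarrow> frame (U ** V)"
  by (simp add: frame_def[of "U ** V"] matrix_transpose_mul matrix_mul_assoc frame_cancel)

lemma transpose_eigform [simp]: "transpose (eigform U f) = eigform U f"
  by (simp add: eigform_def matrix_transpose_mul matrix_mul_assoc)

lemma eigform_mult: "frame U \<Longrightarrow> eigform U f ** eigform U g = eigform U (\<lambda>i. f i * g i)"
  by (simp add: eigform_def matrix_mul_assoc frame_cancel flip: diagm_mult)

lemma eigform_conj: "V ** eigform U f ** transpose V = eigform (V ** U) f"
  by (simp add: eigform_def matrix_mul_assoc matrix_transpose_mul)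

lemma eigform_one: "frame U \<Longrightarrow> eigform U (\<lambda>_. 1) = mat 1"
  by (simp add: eigform_def diagm_one frame_cancel)

lemma eigform_scale: "c *\<^sub>R eigform U f = eigform U (\<lambda>i. c * f i)"
  by (simp add: vec_eq_iff eigform_nth algebra_simps sum_distrib_left)

lemma eigform_diff: "eigform U f - eigform U g = eigform U (\<lambda>i. f i - g i)"
  by (simp add: vec_eq_iff eigform_nth algebra_simps sum_subtractf)

lemma eigform_zero [simp]: "eigform U (\<lambda>_. 0) = 0"
  by (simp add: vec_eq_iff eigform_nth)

lemma eigform_minus: "- eigform U f = eigform U (\<lambda>i. - f i)"
  by (simp add: vec_eq_iff eigform_nth sum_negf)

lemma inner_matrix: "A \<bullet> B = (\<Sum>i\<in>UNIV. \<Sum>j\<in>UNIV. A $ i $ j * B $ i $ j)" for A B :: "real^'b^'a"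
  by (simp add: inner_vec_def)

lemma norm_matrix_sq: "(norm A)\<^sup>2 = (\<Sum>i\<in>UNIV. \<Sum>j\<in>UNIV. (A $ i $ j)\<^sup>2)" for A :: "real^'b^'a"
  unfolding power2_norm_eq_inner inner_matrix by (simp add: power2_eq_square)

lemma entry_le_norm: "\<bar>A $ i $ j\<bar> \<le> norm A" for A :: "real^'b^'a"
proof -
  have "\<bar>A $ i $ j\<bar> \<le> norm (A $ i)" by (rule component_le_norm_cart)
  also have "\<dots> \<le> norm A" by (rule Finite_Cartesian_Product.norm_nth_le)
  finally show ?thesis .
qed

lemma inner_matrix_trace: "A \<bullet> B = trace (transpose A ** B)" for A B :: "real^'b^'a"
  unfolding inner_matrix trace_def matrix_mult_nth
  by (subst sum.swap) (simp add: transpose_def)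

lemma inner_mult_left: "(A ** B) \<bullet> C = B \<bullet> (transpose A ** C)" for A :: "real^'b^'a"
  by (simp add: inner_matrix_trace matrix_transpose_mul matrix_mul_assoc)

lemma inner_mult_right: "(A ** B) \<bullet> C = A \<bullet> (C ** transpose B)" for A :: "real^'b^'a"
  unfolding inner_matrix_trace matrix_transpose_mul
  by (metis matrix_mul_assoc trace_mul_sym)

text \<open>
  Multiplying by frames on both sides, possibly different ones, is an isometry. This is what makes
  mixed bases usable.
\<close>

lemma inner_frame:
  assumes "frame U" "frame V"
  shows "(transpose U ** A ** V) \<bullet> (transpose U ** B ** V) = A \<bullet> B"
proof -
  have "(transpose U ** A ** V) \<bullet> (transpose U ** B ** V) = (transpose U ** A) \<bullet> (transpose U ** B ** V ** transpose V)"
    by (rule inner_mult_right)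
  also have "\<dots> = A \<bullet> (U ** (transpose U ** B))"
    using assms by (simp only: frame_cancel inner_mult_left transpose_transpose)
  finally show ?thesis using assms by (simp add: matrix_mul_assoc frame_cancel)
qed

lemma norm_frame:
  assumes "frame U" "frame V"
  shows "norm (transpose U ** A ** V) = norm A"
  using inner_frame[OF assms, of A A] by (simp add: norm_eq_sqrt_inner)

lemma norm_eigform_sq:
  assumes "frame U" shows "(norm (eigform U f))\<^sup>2 = (\<Sum>i\<in>UNIV. (f i)\<^sup>2)"
proof -
  have "norm (eigform U f) = norm (diagm f)"
    using norm_frame[of "transpose U" "transpose U" "diagm f"] assms by (simp add: eigform_def)
  moreover have "(norm (diagm f))\<^sup>2 = (\<Sum>i\<in>UNIV. (f i)\<^sup>2)"
    unfolding norm_matrix_sq by (simp add: diagm_def if_distrib[of "\<lambda>x. x^2"] sum.delta cong: if_cong)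
  ultimately show ?thesis by simp
qed

lemma trace_eigform: assumes "frame U" shows "trace (eigform U f) = (\<Sum>i\<in>UNIV. f i)"
proof -
  have "trace (eigform U f) = trace (diagm f ** transpose U ** U)"
    by (metis eigform_def matrix_mul_assoc trace_mul_sym)
  also have "\<dots> = (\<Sum>i\<in>UNIV. f i)" using assms by (simp add: frame_cancel) (simp add: trace_def diagm_def)
  finally show ?thesis .
qed

text \<open>
  With an eigenbasis of the one matrix on the left and of the other one on the right, both
  matrices become the same overlap matrix with rescaled rows or columns. The difference of two
  functions of the matrices is then an entrywise divided difference.
\<close>

lemma eigform_mixed:
  assumes "frame U" "frame V"
  shows "(transpose U ** eigform U f ** V) $ i $ j = f i * (transpose U ** V) $ i $ j"
    "(transpose U ** eigform V g ** V) $ i $ j = (transpose U ** V) $ i $ j * g j"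
  using assms unfolding eigform_def
  by (simp_all add: matrix_mul_assoc frame_cancel mult_diagm_nth)
     (simp add: diagm_mult_nth flip: matrix_mul_assoc)

section \<open>The spectral theorem\<close>

text \<open>
  A maximizer \<open>u\<close> of the quadratic form on the unit sphere of \<open>W\<close>, with value \<open>l\<close>: the form
  \<open>l \<bar>x\<bar>\<^sup>2 - x \<bullet> Sx\<close> is nonnegative on \<open>W\<close> and vanishes at \<open>u\<close>, so its derivative
  \<open>l u - S u\<close> there is zero.
\<close>

lemma symmetric_max_eigenvector:
  fixes S :: "real^'a^'a"
  assumes sym: "transpose S = S" and sub: "subspace W" and inv: "\<And>x. x \<in> W \<Longrightarrow> S *v x \<in> W"
    and nz: "w \<in> W" "w \<noteq> 0"
  obtains u l where "u \<in> W" "norm u = 1" "S *v u = l *\<^sub>R u"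
proof -
  have sa: "(S *v x) \<bullet> y = x \<bullet> (S *v y)" for x y
    by (metis dot_lmul_matrix sym transpose_matrix_vector)
  let ?K = "W \<inter> sphere 0 1"
  have "compact ?K" using closed_subspace[OF sub] by (simp add: closed_Int_compact)
  moreover have "inverse (norm w) *\<^sub>R w \<in> ?K" using nz sub by (simp add: subspace_scale)
  then have "?K \<noteq> {}" by blast
  moreover have "continuous_on ?K (\<lambda>x. x \<bullet> (S *v x))"
    by (intro continuous_intros)
  ultimately have "\<exists>u\<in>?K. \<forall>y\<in>?K. y \<bullet> (S *v y) \<le> u \<bullet> (S *v u)"
    by (rule continuous_attains_sup)
  then obtain u where u: "u \<in> ?K" and mx: "\<And>y. y \<in> ?K \<Longrightarrow> y \<bullet> (S *v y) \<le> u \<bullet> (S *v u)"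
    by blast
  define l where "l = u \<bullet> (S *v u)"
  have uu: "u \<bullet> u = 1" using u by (simp add: dot_square_norm)
  have q: "0 \<le> l * (x \<bullet> x) - x \<bullet> (S *v x)" if "x \<in> W" for x
  proof (cases "x = 0")
    case False
    let ?y = "inverse (norm x) *\<^sub>R x"
    have "?y \<in> ?K" using that False sub by (simp add: subspace_scale)
    from mx[OF this] have "inverse (norm x) * inverse (norm x) * (x \<bullet> (S *v x)) \<le> l"
      by (simp add: l_def matrix_vector_mult_scaleR mult.assoc)
    then have "(norm x)\<^sup>2 * (inverse (norm x) * inverse (norm x) * (x \<bullet> (S *v x))) \<le> (norm x)\<^sup>2 * l"
      by (intro mult_left_mono) auto
    then show ?thesis using False
      by (simp add: power2_eq_square field_simps) (simp add: power2_norm_eq_inner[symmetric] power2_eq_square field_simps)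
  qed simp
  define r where "r = l *\<^sub>R u - S *v u"
  have rW: "r \<in> W" using u inv[of u] sub by (simp add: r_def subspace_diff subspace_scale)
  let ?c = "l * (r \<bullet> r) - r \<bullet> (S *v r)"
  have key: "0 \<le> 2 * t * (r \<bullet> r) + t\<^sup>2 * ?c" for t
  proof -
    have "u + t *\<^sub>R r \<in> W" using u rW sub by (simp add: subspace_add subspace_scale)
    from q[OF this] have "0 \<le> l * ((u + t *\<^sub>R r) \<bullet> (u + t *\<^sub>R r)) - (u + t *\<^sub>R r) \<bullet> (S *v (u + t *\<^sub>R r))" .
    also have "\<dots> = l * (u \<bullet> u) - l + 2 * t * (l * (u \<bullet> r) - r \<bullet> (S *v u)) + t\<^sup>2 * ?c"
      using sa[of u r] by (simp add: l_def algebra_simps matrix_vector_right_distrib matrix_vector_mult_scaleR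
          inner_add_left inner_add_right power2_eq_square inner_commute)
    also have "l * (u \<bullet> r) - r \<bullet> (S *v u) = r \<bullet> r"
    proof -
      have "r \<bullet> r = r \<bullet> (l *\<^sub>R u - S *v u)" by (simp only: flip: r_def)
      then show ?thesis by (simp add: inner_diff_right inner_commute)
    qed
    finally show ?thesis using uu by simp
  qed
  have "r \<bullet> r = 0"
  proof (rule ccontr)
    assume "r \<bullet> r \<noteq> 0" then have p: "r \<bullet> r > 0" by simp
    have c: "?c \<ge> 0" using q[OF rW] .
    \<comment> \<open>a step small enough that the linear term of \<open>key\<close> dominates; the 1 guards against \<open>?c = 0\<close>\<close>
    define t where "t = - (r \<bullet> r) / (?c + 1)"
    have "t < 0" using p c by (simp add: t_def field_simps)
    moreover have "2 * (r \<bullet> r) + t * ?c > 0"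
    proof -
      have "t * (?c + 1) = - (r \<bullet> r)" using c by (simp add: t_def)
      then have "t * ?c = - (r \<bullet> r) - t" by (simp add: algebra_simps)
      then show ?thesis using p \<open>t < 0\<close> by linarith
    qed
    ultimately have "t * (2 * (r \<bullet> r) + t * ?c) < 0" by (rule mult_neg_pos)
    then show False using key[of t] by (simp add: algebra_simps power2_eq_square)
  qed
  then have "S *v u = l *\<^sub>R u" by (simp add: r_def)
  then show ?thesis using that u by auto
qed

text \<open>
  An orthonormal set of eigenvectors of greatest cardinality is a basis: its orthogonal complement
  is invariant and would otherwise contain a further eigenvector.
\<close>

lemma spectral_theorem:
  fixes S :: "real^'a^'a"
  assumes sym: "transpose S = S"
  obtains U :: "real^'a^'a" and f where "frame U" "S = eigform U f"
proof -
  have sa: "(S *v x) \<bullet> y = x \<bullet> (S *v y)" for x y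
    by (metis dot_lmul_matrix sym transpose_matrix_vector)
  define good where "good B \<longleftrightarrow> pairwise orthogonal B \<and> (\<forall>u\<in>B. norm u = 1 \<and> (\<exists>l. S *v u = l *\<^sub>R u))"
    for B :: "(real^'a) set"
  have ind: "independent B" if "good B" for B
    using that by (intro pairwise_orthogonal_independent) (auto simp: good_def)
  have fin: "finite B \<and> card B \<le> CARD('a)" if "good B" for B
    using independent_bound[OF ind[OF that]] by simp
  have "good {}" by (simp add: good_def)
  then obtain B where B: "good B" and mx: "\<And>B'. good B' \<Longrightarrow> card B' \<le> card B"
    using ex_has_greatest_nat[of good "{}" card "Suc CARD('a)"] fin less_Suc_eq_le by metis
  define W where "W = {x. \<forall>b\<in>B. b \<bullet> x = 0}"
  have W0: "x = 0" if xW: "x \<in> W" for x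
  proof (rule ccontr)
    assume "x \<noteq> 0"
    have sub: "subspace W"
      using subspace_orthogonal_to_vectors[of B] by (simp add: W_def orthogonal_def)
    have inv: "S *v y \<in> W" if "y \<in> W" for y
    proof -
      have "b \<bullet> (S *v y) = 0" if "b \<in> B" for b
      proof -
        have "\<exists>l. S *v b = l *\<^sub>R b" using B that by (simp add: good_def)
        then obtain l where "S *v b = l *\<^sub>R b" ..
        then show ?thesis using \<open>y \<in> W\<close> that sa[of b y] by (simp add: W_def)
      qed
      then show ?thesis by (simp add: W_def)
    qed
    obtain u l where u: "u \<in> W" "norm u = 1" "S *v u = l *\<^sub>R u"
      by (rule symmetric_max_eigenvector[OF sym sub inv xW \<open>x \<noteq> 0\<close>])
    have "u \<notin> B"
    proof
      assume "u \<in> B"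
      then have "u \<bullet> u = 0" using u by (auto simp: W_def)
      then show False using u by simp
    qed
    moreover have "good (insert u B)"
      using B u by (auto simp: good_def pairwise_insert orthogonal_def W_def inner_commute)
    ultimately show False using mx[of "insert u B"] fin[OF B] by simp
  qed
  have "span B = UNIV"
  proof -
    have "x \<in> span B" for x
    proof -
      obtain y z where yz: "y \<in> span B" "\<And>w. w \<in> span B \<Longrightarrow> orthogonal z w" "x = y + z"
        using orthogonal_subspace_decomp_exists by blast
      have "z \<in> W" using yz(2) by (auto simp: W_def orthogonal_def inner_commute span_base)
      then have "z = 0" by (rule W0)
      then show ?thesis using yz(1,3) by simp
    qed
    then show ?thesis by auto
  qed
  then have "card B = CARD('a)"
    using dim_eq_card_independent[OF ind[OF B]] dim_span[of B] by simp
  then obtain h where h: "bij_betw h (UNIV :: 'a set) B"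
    using finite_same_card_bij[of "UNIV :: 'a set" B] fin[OF B] by auto
  have hB: "h i \<in> B" for i using h by (auto simp: bij_betw_def)
  have "\<forall>i. \<exists>l. S *v h i = l *\<^sub>R h i"
    using B hB by (simp add: good_def)
  then obtain f where f: "\<And>i. S *v h i = f i *\<^sub>R h i"
    by (auto dest!: choice)
  have ortho: "h i \<bullet> h j = (if i = j then 1 else 0)" for i j
  proof (cases "i = j")
    case True
    then show ?thesis using B hB[of j] by (auto simp: good_def dot_square_norm)
  next
    case False
    then have "h i \<noteq> h j" using h by (auto simp: bij_betw_def inj_def)
    then show ?thesis using B hB False by (auto simp: good_def pairwise_def orthogonal_def)
  qed
  define U :: "real^'a^'a" where "U = (\<chi> i j. h j $ i)"
  have "transpose U ** U = mat 1"
    by (simp add: vec_eq_iff matrix_mult_nth transpose_def U_def mat_def ortho[symmetric] inner_vec_def)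
  then have fr: "frame U" by (simp add: frame_square)
  have "S ** U = U ** diagm f"
  proof -
    have "(S ** U) $ i $ j = (U ** diagm f) $ i $ j" for i j
      using arg_cong[OF f[of j], of "\<lambda>x. x $ i"]
      unfolding mult_diagm_nth matrix_mult_nth[of S U] by (simp add: matrix_vector_mult_def U_def mult.commute)
    then show ?thesis by (simp add: vec_eq_iff)
  qed
  then have "S = eigform U f" unfolding eigform_def using frame_cancel(4)[OF fr, of S] by simp
  then show ?thesis using that fr by blast
qed

section \<open>Exponential, logarithm and square root\<close>

text \<open>
  The functional calculus does not depend on the chosen eigenbasis: in the mixed basis, an overlap
  between different eigenvalues vanishes.
\<close>

lemma eigform_cong_fun:
  fixes U :: "real^'b^'a" and V :: "real^'c^'a"
  assumes "frame U" "frame V" and eq: "eigform U f = eigform V g"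
  shows "eigform U (\<lambda>i. h (f i)) = eigform V (\<lambda>i. h (g i))"
proof -
  let ?w = "transpose U ** V"
  have e: "(f i - g j) * ?w $ i $ j = 0" for i j
    using eigform_mixed(1)[OF assms(1,2), of f i j] eigform_mixed(2)[OF assms(1,2), of g i j] eq
    by (auto simp add: algebra_simps)
  have "transpose U ** eigform U (\<lambda>i. h (f i)) ** V = transpose U ** eigform V (\<lambda>i. h (g i)) ** V"
  proof -
    have "(h (f i) - h (g j)) * ?w $ i $ j = 0" for i j using e[of i j] by auto
    then show ?thesis unfolding vec_eq_iff eigform_mixed[OF assms(1,2)] by (simp add: algebra_simps)
  qed
  then have "U ** (transpose U ** eigform U (\<lambda>i. h (f i)) ** V) ** transpose V
     = U ** (transpose U ** eigform V (\<lambda>i. h (g i)) ** V) ** transpose V" by simp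
  then show ?thesis using assms by (simp add: matrix_mul_assoc frame_cancel)
qed

lemma mat_exp_eigform:
  fixes U :: "real^'b^'a"
  assumes "frame U" shows "mat_exp (eigform U f) = eigform U (\<lambda>i. exp (f i))"
proof -
  have pow: "((**) (eigform U f) ^^ k) (mat 1) = eigform U (\<lambda>i. f i ^ k)" for k
    by (induction k) (simp_all add: eigform_one eigform_mult assms)
  have "(\<lambda>k. (1 / fact k) *\<^sub>R (((**) (eigform U f) ^^ k) (mat 1))) sums eigform U (\<lambda>i. exp (f i))"
  proof -
    have "(\<lambda>k. ((1 / fact k) *\<^sub>R (((**) (eigform U f) ^^ k) (mat 1))) $ i $ j) sums (eigform U (\<lambda>i. exp (f i)) $ i $ j)" for i j
      unfolding pow eigform_scale eigform_nth
      using exp_converges[where 'a=real] by (intro sums_sum sums_mult2) (simp add: divide_inverse mult.commute)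
    then show ?thesis unfolding sums_def by (intro vec_tendstoI) simp
  qed
  then show ?thesis unfolding mat_exp_def by (simp add: sums_iff)
qed

lemma mat_exp_0 [simp]: "mat_exp (0 :: real^'a^'a) = mat 1"
  using mat_exp_eigform[of "mat 1 :: real^'a^'a" "\<lambda>_. 0"] by (simp add: eigform_one)

lemma mat_log_unique:
  fixes S P :: "real^'a^'a"
  assumes "transpose S = S" "mat_exp S = P" shows "mat_log P = S"
proof -
  have "S = S'" if S: "transpose S = S" "mat_exp S = P" and S': "transpose S' = S'" "mat_exp S' = P" for S S'
  proof -
    obtain U :: "real^'a^'a" and f where U: "frame U" "S = eigform U f" by (rule spectral_theorem[OF S(1)])
    obtain V :: "real^'a^'a" and g where V: "frame V" "S' = eigform V g" by (rule spectral_theorem[OF S'(1)])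
    have "eigform U (\<lambda>i. exp (f i)) = eigform V (\<lambda>i. exp (g i))"
      using S(2) S'(2) U V by (simp add: mat_exp_eigform)
    from eigform_cong_fun[OF U(1) V(1) this, of ln] show ?thesis using U V by simp
  qed
  note uniq = this
  show ?thesis unfolding mat_log_def
  proof (rule the_equality, intro conjI)
    fix T assume "transpose T = T \<and> mat_exp T = P"
    then show "T = S" by (elim conjE) (rule uniq[OF _ _ assms])
  qed (simp_all add: assms)
qed

lemma mat_log_exp: "transpose S = S \<Longrightarrow> mat_log (mat_exp S) = S"
  by (rule mat_log_unique) auto

lemma mat_log_eigform:
  fixes U :: "real^'b^'a"
  assumes "frame U" "\<And>i. f i > 0" shows "mat_log (eigform U f) = eigform U (\<lambda>i. ln (f i))"
  using assms by (intro mat_log_unique) (auto simp: mat_exp_eigform)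

lemma inner_eigform: 
  fixes U :: "real^'b^'a"
  shows "x \<bullet> (eigform U f *v x) = (\<Sum>k\<in>UNIV. f k * ((transpose U *v x) $ k)\<^sup>2)"
proof -
  have "x \<bullet> (eigform U f *v x) = (transpose U *v x) \<bullet> (diagm f *v (transpose U *v x))"
    unfolding eigform_def by (metis dot_lmul_matrix matrix_vector_mul_assoc transpose_matrix_vector)
  also have "\<dots> = (\<Sum>k\<in>UNIV. f k * ((transpose U *v x) $ k)\<^sup>2)"
    by (simp add: inner_vec_def diagm_vector_nth power2_eq_square mult_ac del: transpose_matrix_vector)
  finally show ?thesis .
qed

lemma spd_eigform: 
  assumes "frame U" "\<And>i. f i > 0" shows "spd (eigform U f)"
  unfolding spd_def
proof (intro conjI allI impI)
  fix x :: "real^'b" assume "x \<noteq> 0"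
  have "transpose U *v x \<noteq> 0"
  proof
    assume "transpose U *v x = 0"
    then have "U *v (transpose U *v x) = 0" by simp
    then show False using \<open>x \<noteq> 0\<close> frame_cancel(2)[OF assms(1)]
      by (simp only: matrix_vector_mul_assoc matrix_vector_mul_lid)
  qed
  then obtain k where "(transpose U *v x) $ k \<noteq> 0" by (auto simp: vec_eq_iff)
  then show "x \<bullet> (eigform U f *v x) > 0" unfolding inner_eigform
    using assms(2) by (intro sum_pos2[of _ k]) (auto intro!: mult_nonneg_nonneg less_imp_le[of 0 "f _"] simp del: transpose_matrix_vector)
qed simp

lemma spd_spectral:
  fixes P :: "real^'a^'a"
  assumes "spd P" obtains U :: "real^'a^'a" and f where "frame U" "P = eigform U f" "\<forall>i. f i > 0"
proof -
  have "transpose P = P" using assms by (simp add: spd_def)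
  then obtain U :: "real^'a^'a" and f where U: "frame U" "P = eigform U f" by (rule spectral_theorem)
  have "f k > 0" for k
  proof -
    let ?x = "U *v axis k 1"
    have tx: "transpose U *v ?x = axis k 1" using frame_cancel(1)[OF U(1)]
      by (simp only: matrix_vector_mul_assoc matrix_vector_mul_lid)
    then have "?x \<noteq> 0" by (metis axis_eq_0_iff matrix_vector_mult_0_right zero_neq_one)
    then have "0 < ?x \<bullet> (eigform U f *v ?x)" using assms U unfolding spd_def by blast
    also have "\<dots> = f k" unfolding inner_eigform tx
      by (simp add: axis_def if_distrib[of "\<lambda>x. x^2"] if_distrib[of "\<lambda>x. _ * x"] sum.delta cong: if_cong)
    finally show ?thesis .
  qed
  then show ?thesis using that U by blast
qed

lemma spd_exp:
  fixes S :: "real^'a^'a"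
  assumes "transpose S = S" shows "spd (mat_exp S)"
proof -
  obtain U :: "real^'a^'a" and f where U: "frame U" "S = eigform U f" by (rule spectral_theorem[OF assms])
  then show ?thesis by (simp add: mat_exp_eigform spd_eigform)
qed

lemma sym_mat_exp: "transpose S = S \<Longrightarrow> transpose (mat_exp S) = mat_exp S"
  using spd_exp spd_def by blast

lemma spd_log:
  fixes P :: "real^'a^'a"
  assumes "spd P" shows "transpose (mat_log P) = mat_log P" "mat_exp (mat_log P) = P"
proof -
  obtain U :: "real^'a^'a" and f where U: "frame U" "P = eigform U f" "\<forall>i. f i > 0" by (rule spd_spectral[OF assms])
  then show "transpose (mat_log P) = mat_log P" "mat_exp (mat_log P) = P"
    by (simp_all add: mat_log_eigform mat_exp_eigform)
qed

lemma mat_sqrt_unique: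
  fixes S P :: "real^'a^'a"
  assumes "spd S" "S ** S = P" shows "mat_sqrt P = S"
proof -
  have "S = S'" if S: "spd S" "S ** S = P" and S': "spd S'" "S' ** S' = P" for S S'
  proof -
    obtain U :: "real^'a^'a" and f where U: "frame U" "S = eigform U f" "\<forall>i. f i > 0" by (rule spd_spectral[OF S(1)])
    obtain V :: "real^'a^'a" and g where V: "frame V" "S' = eigform V g" "\<forall>i. g i > 0" by (rule spd_spectral[OF S'(1)])
    have "eigform U (\<lambda>i. f i * f i) = eigform V (\<lambda>i. g i * g i)"
      using S S' U V by (simp add: eigform_mult)
    from eigform_cong_fun[OF U(1) V(1) this, of sqrt] show ?thesis using U V by (simp add: less_imp_le)
  qed
  note uniq = this
  show ?thesis unfolding mat_sqrt_def
  proof (rule the_equality, intro conjI)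
    fix T assume "spd T \<and> T ** T = P"
    then show "T = S" by (elim conjE) (rule uniq[OF _ _ assms])
  qed (simp_all add: assms)
qed

lemma mat_sqrt_eigform:
  assumes "frame U" "\<And>i. f i > 0" shows "mat_sqrt (eigform U f) = eigform U (\<lambda>i. sqrt (f i))"
  using assms by (intro mat_sqrt_unique spd_eigform) (auto simp: eigform_mult less_imp_le)

lemma spd_mat_sqrt:
  fixes P :: "real^'a^'a"
  assumes "spd P" shows "spd (mat_sqrt P)" "mat_sqrt P ** mat_sqrt P = P"
proof -
  obtain U :: "real^'a^'a" and f where U: "frame U" "P = eigform U f" "\<forall>i. f i > 0" by (rule spd_spectral[OF assms])
  then show "spd (mat_sqrt P)" "mat_sqrt P ** mat_sqrt P = P"
    by (simp_all add: mat_sqrt_eigform spd_eigform eigform_mult less_imp_le)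
qed

lemma matrix_inv_eqI:
  fixes A :: "real^'b^'a" assumes "A ** B = mat 1" "B ** A = mat 1" shows "matrix_inv A = B"
proof -
  have "A ** matrix_inv A = mat 1 \<and> matrix_inv A ** A = mat 1"
    unfolding matrix_inv_def by (rule someI[of _ B]) (simp add: assms)
  then show ?thesis using assms by (metis matrix_mul_assoc matrix_mul_lid matrix_mul_rid)
qed

lemma spd_inverse:
  fixes P :: "real^'a^'a"
  assumes "spd P" shows "P ** matrix_inv P = mat 1" "matrix_inv P ** P = mat 1" "spd (matrix_inv P)"
proof -
  obtain U :: "real^'a^'a" and f where U: "frame U" "P = eigform U f" "\<forall>i. f i > 0" by (rule spd_spectral[OF assms])
  let ?Q = "eigform U (\<lambda>i. inverse (f i))"
  have f0: "f i \<noteq> 0" for i using U(3) by (simp add: less_imp_neq[symmetric])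
  have 1: "P ** ?Q = mat 1" "?Q ** P = mat 1" using U f0 by (simp_all add: eigform_mult eigform_one)
  then have "matrix_inv P = ?Q" by (rule matrix_inv_eqI)
  then show "P ** matrix_inv P = mat 1" "matrix_inv P ** P = mat 1" "spd (matrix_inv P)"
    using 1 U by (auto intro: spd_eigform)
qed

lemma spd_mat_1: "spd (mat 1 :: real^'a^'a)"
  by (simp add: spd_def)

lemma spd_congruence:
  fixes G :: "real^'b^'a" and P :: "real^'b^'b"
  assumes "spd P" and H: "G ** H = mat 1"
  shows "spd (G ** P ** transpose G)"
  unfolding spd_def
proof (intro conjI allI impI)
  show "transpose (G ** P ** transpose G) = G ** P ** transpose G"
    using assms by (simp add: spd_def matrix_transpose_mul matrix_mul_assoc)
  fix x :: "real^'a" assume "x \<noteq> 0"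
  have "transpose G *v x \<noteq> 0"
  proof
    assume "transpose G *v x = 0"
    then have "transpose H *v (transpose G *v x) = 0" by (metis matrix_vector_mult_0_right)
    moreover have "transpose H ** transpose G = mat 1" using H by (metis matrix_transpose_mul transpose_mat)
    ultimately show False using \<open>x \<noteq> 0\<close> by (simp only: matrix_vector_mul_assoc matrix_vector_mul_lid)
  qed
  then have "0 < (transpose G *v x) \<bullet> (P *v (transpose G *v x))" using assms by (auto simp: spd_def)
  also have "\<dots> = x \<bullet> ((G ** P ** transpose G) *v x)"
    by (metis dot_lmul_matrix matrix_vector_mul_assoc transpose_matrix_vector)
  finally show "0 < x \<bullet> ((G ** P ** transpose G) *v x)" .
qed

section \<open>The affine-invariant distance\<close>

lemma inv_sqrt_spd:
  fixes P :: "real^'a^'a"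
  assumes "spd P"
  shows "spd (inv_sqrt P)" "mat_sqrt P ** inv_sqrt P = mat 1" "inv_sqrt P ** mat_sqrt P = mat 1"
    "inv_sqrt P ** P ** inv_sqrt P = mat 1" "transpose (inv_sqrt P) = inv_sqrt P" "transpose (mat_sqrt P) = mat_sqrt P"
proof -
  note s = spd_mat_sqrt[OF assms]
  show i: "spd (inv_sqrt P)" "mat_sqrt P ** inv_sqrt P = mat 1" "inv_sqrt P ** mat_sqrt P = mat 1"
    using spd_inverse[OF s(1)] by (simp_all add: inv_sqrt_def)
  have "inv_sqrt P ** (mat_sqrt P ** mat_sqrt P) ** inv_sqrt P = (inv_sqrt P ** mat_sqrt P) ** (mat_sqrt P ** inv_sqrt P)"
    by (simp only: matrix_mul_assoc)
  then show "inv_sqrt P ** P ** inv_sqrt P = mat 1" using i s by simp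
  show "transpose (inv_sqrt P) = inv_sqrt P" "transpose (mat_sqrt P) = mat_sqrt P" using i(1) s(1) by (auto simp: spd_def)
qed

lemma norm_eigform_cong: "frame U \<Longrightarrow> frame V \<Longrightarrow> norm (eigform U f) = norm (eigform V f)"
  using norm_eigform_sq[of U f] norm_eigform_sq[of V f] by (metis norm_ge_zero power2_eq_iff_nonneg)

lemma mat_log_conj:
  fixes V :: "real^'b^'a" and Z :: "real^'b^'b"
  assumes "frame V" "spd Z"
  shows "mat_log (V ** Z ** transpose V) = V ** mat_log Z ** transpose V"
    and "norm (mat_log (V ** Z ** transpose V)) = norm (mat_log Z)"
proof -
  obtain U :: "real^'b^'b" and f where U: "frame U" "Z = eigform U f" "\<forall>i. f i > 0" by (rule spd_spectral[OF assms(2)])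
  have fr: "frame (V ** U)" using assms U by (simp add: frame_mult)
  show "mat_log (V ** Z ** transpose V) = V ** mat_log Z ** transpose V"
    "norm (mat_log (V ** Z ** transpose V)) = norm (mat_log Z)"
    using U assms fr norm_eigform_cong[OF fr U(1)] by (simp_all add: eigform_conj mat_log_eigform)
qed

text \<open>
  The square root in the definition of the distance can be replaced by any factor \<open>G\<close> of
  \<open>P = G G\<^sup>T\<close>, since \<open>P\<^sup>-\<^sup>1\<^sup>/\<^sup>2 G\<close> is orthogonal. Congruence invariance and symmetry are special choices
  of \<open>G\<close>.
\<close>

lemma ai_dist_congruence:
  fixes G :: "real^'b^'a" and H :: "real^'a^'b" and Z :: "real^'b^'b"
  assumes GH: "G ** H = mat 1" and HG: "H ** G = mat 1" and Z: "spd Z"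
  shows "ai_dist (G ** transpose G) (G ** Z ** transpose G) = norm (mat_log Z)"
proof -
  let ?P = "G ** transpose G"
  from spd_congruence[OF spd_mat_1 GH] have P: "spd ?P" by simp
  note s = inv_sqrt_spd[OF P]
  let ?O = "inv_sqrt ?P ** G"
  have 1: "?O ** transpose ?O = mat 1" using s by (simp add: matrix_transpose_mul matrix_mul_assoc)
  have "H ** mat_sqrt ?P ** ?O = H ** (mat_sqrt ?P ** inv_sqrt ?P) ** G" by (simp only: matrix_mul_assoc)
  then have 2: "H ** mat_sqrt ?P ** ?O = mat 1" using s HG by simp
  have "H ** mat_sqrt ?P = H ** mat_sqrt ?P ** (?O ** transpose ?O)" using 1 by simp
  also have "\<dots> = (H ** mat_sqrt ?P ** ?O) ** transpose ?O" by (simp only: matrix_mul_assoc)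
  finally have "H ** mat_sqrt ?P = transpose ?O" using 2 by simp
  then have fr: "frame ?O" using 1 2 by (simp add: frame_def)
  have "inv_sqrt ?P ** (G ** Z ** transpose G) ** inv_sqrt ?P = ?O ** Z ** transpose ?O"
    using s by (simp add: matrix_transpose_mul matrix_mul_assoc)
  then show ?thesis using mat_log_conj(2)[OF fr Z] by (simp add: ai_dist_def)
qed

text \<open>
  Every pair of positive definite matrices has the form required by \<open>ai_dist_congruence\<close>, with
  \<open>G\<close> the square root of the first.
\<close>

lemma spd_pair:
  fixes P P' :: "real^'a^'a"
  assumes "spd P" "spd P'"
  defines "Z \<equiv> inv_sqrt P ** P' ** inv_sqrt P"
  shows "spd Z" "mat_sqrt P ** Z ** mat_sqrt P = P'"
proof -
  note s = inv_sqrt_spd[OF assms(1)]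
  show "spd Z" using spd_congruence[OF assms(2) s(3)] s(5) by (simp add: Z_def)
  have "mat_sqrt P ** Z ** mat_sqrt P = (mat_sqrt P ** inv_sqrt P) ** P' ** (inv_sqrt P ** mat_sqrt P)"
    by (simp only: matrix_mul_assoc Z_def)
  then show "mat_sqrt P ** Z ** mat_sqrt P = P'" using s by simp
qed

lemma ai_dist_invariant:
  fixes G :: "real^'b^'a" and H :: "real^'a^'b" and P P' :: "real^'b^'b"
  assumes GH: "G ** H = mat 1" and HG: "H ** G = mat 1" and P: "spd P" "spd P'"
  shows "ai_dist (G ** P ** transpose G) (G ** P' ** transpose G) = ai_dist P P'"
proof -
  note s = inv_sqrt_spd[OF P(1)]
  let ?Z = "inv_sqrt P ** P' ** inv_sqrt P"
  let ?G = "G ** mat_sqrt P" and ?H = "inv_sqrt P ** H"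
  have "?G ** ?H = G ** (mat_sqrt P ** inv_sqrt P) ** H" "?H ** ?G = inv_sqrt P ** (H ** G) ** mat_sqrt P"
    by (simp_all only: matrix_mul_assoc)
  then have inv: "?G ** ?H = mat 1" "?H ** ?G = mat 1" using s GH HG by simp_all
  have "?G ** transpose ?G = G ** (mat_sqrt P ** mat_sqrt P) ** transpose G"
    "?G ** ?Z ** transpose ?G = G ** (mat_sqrt P ** ?Z ** mat_sqrt P) ** transpose G"
    using s(6) by (simp_all only: matrix_mul_assoc matrix_transpose_mul)
  then have "G ** P ** transpose G = ?G ** transpose ?G" "G ** P' ** transpose G = ?G ** ?Z ** transpose ?G"
    using spd_mat_sqrt(2)[OF P(1)] spd_pair(2)[OF P] by simp_all
  then show ?thesis using ai_dist_congruence[OF inv spd_pair(1)[OF P]] by (simp add: ai_dist_def[of P])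
qed

lemma ai_dist_nonneg: "0 \<le> ai_dist P P'" by (simp add: ai_dist_def)

lemma ai_dist_commute:
  fixes P P' :: "real^'a^'a"
  assumes P: "spd P" "spd P'" shows "ai_dist P P' = ai_dist P' P"
proof -
  note s = inv_sqrt_spd[OF P(1)]
  define Z where "Z = inv_sqrt P ** P' ** inv_sqrt P"
  have Z: "spd Z" "mat_sqrt P ** Z ** mat_sqrt P = P'" using spd_pair[OF P] by (simp_all add: Z_def)
  obtain U :: "real^'a^'a" and f where U: "frame U" "Z = eigform U f" "\<forall>i. f i > 0" by (rule spd_spectral[OF Z(1)])
  have f0: "f i \<noteq> 0" for i using U(3) by (simp add: less_imp_neq[symmetric])
  let ?R = "eigform U (\<lambda>i. sqrt (f i))" and ?R' = "eigform U (\<lambda>i. 1 / sqrt (f i))"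
  let ?Zi = "eigform U (\<lambda>i. 1 / f i)"
  have R: "?R ** ?R' = mat 1" "?R' ** ?R = mat 1" "?R ** ?R = Z" "?R ** ?Zi ** ?R = mat 1"
    using U f0 by (simp_all add: eigform_mult eigform_one less_imp_le)
  let ?G = "mat_sqrt P ** ?R" and ?H = "?R' ** inv_sqrt P"
  have "?G ** ?H = mat_sqrt P ** (?R ** ?R') ** inv_sqrt P" "?H ** ?G = ?R' ** (inv_sqrt P ** mat_sqrt P) ** ?R"
    by (simp_all only: matrix_mul_assoc)
  then have inv: "?G ** ?H = mat 1" "?H ** ?G = mat 1" using s R by simp_all
  have "?G ** transpose ?G = mat_sqrt P ** (?R ** ?R) ** mat_sqrt P"
    "?G ** ?Zi ** transpose ?G = mat_sqrt P ** (?R ** ?Zi ** ?R) ** mat_sqrt P"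
    using s(6) by (simp_all only: matrix_mul_assoc matrix_transpose_mul transpose_eigform)
  then have "P' = ?G ** transpose ?G" "P = ?G ** ?Zi ** transpose ?G"
    using Z(2) R spd_mat_sqrt(2)[OF P(1)] by simp_all
  moreover have "spd ?Zi" using U by (intro spd_eigform) auto
  ultimately have "ai_dist P' P = norm (mat_log ?Zi)" using ai_dist_congruence[OF inv] by metis
  also have "mat_log ?Zi = - mat_log Z"
    using U by (simp add: mat_log_eigform eigform_minus ln_div less_imp_neq[symmetric])
  finally show ?thesis by (simp add: ai_dist_def[of P] Z_def)
qed

lemma ai_dist_eq_0:
  fixes P P' :: "real^'a^'a"
  assumes P: "spd P" "spd P'" shows "ai_dist P P' = 0 \<longleftrightarrow> P = P'"
proof
  assume "ai_dist P P' = 0"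
  then have "mat_log (inv_sqrt P ** P' ** inv_sqrt P) = 0" by (simp add: ai_dist_def)
  then have "mat_exp 0 = inv_sqrt P ** P' ** inv_sqrt P" using spd_log(2)[OF spd_pair(1)[OF P]] by simp
  then show "P = P'" using spd_pair(2)[OF P] spd_mat_sqrt(2)[OF P(1)] by (metis mat_exp_0 matrix_mul_rid)
next
  assume "P = P'"
  moreover have "mat_log (mat 1 :: real^'a^'a) = 0"
    using mat_log_eigform[of "mat 1" "\<lambda>_. 1"] by (simp add: eigform_one)
  ultimately show "ai_dist P P' = 0" using inv_sqrt_spd(4)[OF P(1)] by (simp add: ai_dist_def)
qed

section \<open>Determinants\<close>

text \<open>
  A bijection between the index types turns the rectangular frame into an orthogonal matrix, whose
  determinant squares to one.
\<close>

lemma det_eigform: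
  fixes U :: "real^'b^'a"
  assumes fr: "frame U" and card: "CARD('a) = CARD('b)"
  shows "det (eigform U f) = (\<Prod>i\<in>UNIV. f i)"
proof -
  obtain h where h: "bij_betw h (UNIV :: 'a set) (UNIV :: 'b set)"
    using finite_same_card_bij[of "UNIV :: 'a set" "UNIV :: 'b set"] card by auto
  define W :: "real^'a^'a" where "W = (\<chi> i j. U $ i $ h j)"
  have re: "(\<Sum>k\<in>UNIV. g (h k)) = (\<Sum>k\<in>UNIV. g k)" for g :: "'b \<Rightarrow> real"
    by (rule sum.reindex_bij_betw[OF h])
  have e: "eigform W (\<lambda>i. g (h i)) = eigform U g" for g
    using re[of "\<lambda>k. g k * (U $ i $ k * U $ j $ k)" for i j] by (simp add: vec_eq_iff eigform_nth W_def)
  have "W ** transpose W = mat 1"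
    using e[of "\<lambda>_. 1"] eigform_one[OF fr] by (simp add: eigform_def diagm_one)
  then have dW: "det W * det W = 1" by (metis det_I det_mul det_transpose)
  have "det (eigform U f) = det W * det (diagm (\<lambda>i. f (h i))) * det W"
    unfolding e[symmetric] by (simp add: eigform_def det_mul)
  also have "\<dots> = det (diagm (\<lambda>i. f (h i)))" using dW by (simp add: mult.commute mult.left_commute)
  also have "\<dots> = (\<Prod>i\<in>UNIV. f (h i))" by (subst det_diagonal) (simp_all add: diagm_def)
  also have "\<dots> = (\<Prod>i\<in>UNIV. f i)" by (rule prod.reindex_bij_betw[OF h])
  finally show ?thesis .
qed

lemma det_frame_conj:
  fixes Q :: "real^'b^'a" and X :: "real^'b^'b"
  assumes "frame Q" "CARD('a) = CARD('b)" "transpose X = X"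
  shows "det (Q ** X ** transpose Q) = det X"
proof -
  obtain U :: "real^'b^'b" and f where U: "frame U" "X = eigform U f" by (rule spectral_theorem[OF assms(3)])
  then show ?thesis using assms by (simp add: eigform_conj det_eigform frame_mult)
qed

lemma det_mat_exp:
  fixes S :: "real^'a^'a" assumes "transpose S = S" shows "det (mat_exp S) = exp (trace S)"
proof -
  obtain U :: "real^'a^'a" and f where U: "frame U" "S = eigform U f" by (rule spectral_theorem[OF assms])
  then show ?thesis by (simp add: mat_exp_eigform det_eigform trace_eigform exp_sum)
qed

lemma det_spd_pos: fixes P :: "real^'a^'a" assumes "spd P" shows "det P > 0"
  using det_mat_exp[OF spd_log(1)[OF assms]] spd_log(2)[OF assms] by simp

lemma trace_mat_log: fixes P :: "real^'a^'a" assumes "spd P" shows "trace (mat_log P) = ln (det P)"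
  using det_mat_exp[OF spd_log(1)[OF assms]] spd_log(2)[OF assms] by simp

section \<open>Lipschitz continuity of the exponential\<close>

lemma norm_eigform_diff_le:
  fixes U V :: "real^'a^'a"
  assumes fr: "frame U" "frame V" and le: "\<And>i j. \<bar>h (f i) - h (g j)\<bar> \<le> c * \<bar>f i - g j\<bar>" and c: "c \<ge> 0"
  shows "norm (eigform U (\<lambda>i. h (f i)) - eigform V (\<lambda>i. h (g i))) \<le> c * norm (eigform U f - eigform V g)"
proof -
  let ?w = "transpose U ** V"
  have n: "(norm (eigform U p - eigform V q))\<^sup>2 = (\<Sum>i\<in>UNIV. \<Sum>j\<in>UNIV. ((p i - q j) * ?w $ i $ j)\<^sup>2)" for p q
  proof -
    have "(norm (eigform U p - eigform V q))\<^sup>2 = (norm (transpose U ** (eigform U p - eigform V q) ** V))\<^sup>2"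
      by (simp add: norm_frame fr)
    also have "\<dots> = (\<Sum>i\<in>UNIV. \<Sum>j\<in>UNIV. ((p i - q j) * ?w $ i $ j)\<^sup>2)"
      unfolding norm_matrix_sq matrix_diff_ldistrib matrix_diff_rdistrib vector_minus_component eigform_mixed[OF fr]
      by (simp add: algebra_simps)
    finally show ?thesis .
  qed
  have "(norm (eigform U (\<lambda>i. h (f i)) - eigform V (\<lambda>i. h (g i))))\<^sup>2 \<le> (\<Sum>i\<in>UNIV. \<Sum>j\<in>UNIV. c\<^sup>2 * ((f i - g j) * ?w $ i $ j)\<^sup>2)"
    unfolding n
  proof (intro sum_mono)
    fix i j
    have "(h (f i) - h (g j))\<^sup>2 \<le> (c * \<bar>f i - g j\<bar>)\<^sup>2"
      using le[of i j] by (metis abs_ge_zero power2_abs power_mono)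
    then have "(h (f i) - h (g j))\<^sup>2 * (?w $ i $ j)\<^sup>2 \<le> (c * \<bar>f i - g j\<bar>)\<^sup>2 * (?w $ i $ j)\<^sup>2"
      by (intro mult_right_mono) auto
    then show "((h (f i) - h (g j)) * ?w $ i $ j)\<^sup>2 \<le> c\<^sup>2 * ((f i - g j) * ?w $ i $ j)\<^sup>2"
      by (simp add: power_mult_distrib)
  qed
  also have "\<dots> = (c * norm (eigform U f - eigform V g))\<^sup>2"
    by (simp add: power_mult_distrib[of c] n sum_distrib_left)
  finally show ?thesis using c by (simp add: power2_le_iff_abs_le)
qed

lemma eigenvalue_le_norm: "frame U \<Longrightarrow> \<bar>f i\<bar> \<le> norm (eigform U f)"
  using abs_le_square_iff[of "f i" "norm (eigform U f)"] member_le_sum[of i UNIV "\<lambda>i. (f i)\<^sup>2"]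
  by (simp add: norm_eigform_sq)

lemma exp_diff_le:
  fixes a b D :: real
  assumes "\<bar>a\<bar> \<le> D" "\<bar>b\<bar> \<le> D" shows "\<bar>exp a - exp b\<bar> \<le> exp D * \<bar>a - b\<bar>"
proof -
  have *: "exp y - exp x \<le> exp D * (y - x)" if "x \<le> y" "y \<le> D" for x y :: real
  proof -
    have "1 + (x - y) \<le> exp (x - y)" by (rule exp_ge_add_one_self)
    then have "exp y * (1 + (x - y)) \<le> exp y * exp (x - y)" by (intro mult_left_mono) auto
    then have "exp y - exp x \<le> exp y * (y - x)" by (simp add: algebra_simps flip: exp_add)
    also have "\<dots> \<le> exp D * (y - x)" using that by (intro mult_right_mono) auto
    finally show ?thesis .
  qed
  show ?thesis using *[of a b] *[of b a] assms by (cases "a \<le> b") auto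
qed

lemma norm_mat_exp_diff_le:
  fixes S T :: "real^'a^'a"
  assumes "transpose S = S" "transpose T = T" "norm S \<le> D" "norm T \<le> D"
  shows "norm (mat_exp S - mat_exp T) \<le> exp D * norm (S - T)"
proof -
  obtain U :: "real^'a^'a" and f where U: "frame U" "S = eigform U f" by (rule spectral_theorem[OF assms(1)])
  obtain V :: "real^'a^'a" and g where V: "frame V" "T = eigform V g" by (rule spectral_theorem[OF assms(2)])
  have "\<bar>exp (f i) - exp (g j)\<bar> \<le> exp D * \<bar>f i - g j\<bar>" for i j
    using eigenvalue_le_norm[OF U(1), of f i] eigenvalue_le_norm[OF V(1), of g j] U V assms
    by (intro exp_diff_le) auto
  from norm_eigform_diff_le[OF U(1) V(1) this] show ?thesis using U V by (simp add: mat_exp_eigform)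
qed

section \<open>The function \<open>s coth s\<close>\<close>

text \<open>
  The divided difference of the logarithm at \<open>e\<^sup>a\<close> and \<open>e\<^sup>b\<close>, multiplied by \<open>e\<^sup>a\<close>, is
  \<open>theta (a - b)\<close>. The even part of \<open>theta\<close> at \<open>u\<close> is \<open>psi (u / 2)\<close>.
\<close>

definition theta :: "real \<Rightarrow> real" where
  "theta u = (if u = 0 then 1 else u / (1 - exp (- u)))"

lemma theta_eq: "theta u * (1 - exp (- u)) = u"
  by (simp add: theta_def)

lemma theta_bound: "\<bar>theta u - 1\<bar> \<le> \<bar>u\<bar>"
proof (cases "u = 0")
  case False
  let ?e = "exp (- u)"
  have e1: "(1 + u) * ?e \<le> 1"
  proof -
    have "(1 + u) * ?e \<le> exp u * ?e" by (intro mult_right_mono) auto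
    then show ?thesis by (simp add: exp_minus)
  qed
  have e2: "1 - u \<le> ?e" using exp_ge_add_one_self[of "-u"] by simp
  have e: "(theta u - 1) * (1 - ?e) = u - 1 + ?e" using theta_eq[of u] by (simp add: algebra_simps)
  show ?thesis
  proof (cases "u > 0")
    case True
    then have p: "1 - ?e > 0" by simp
    have "0 \<le> (theta u - 1) * (1 - ?e)" "(theta u - 1) * (1 - ?e) \<le> u * (1 - ?e)"
      unfolding e using e1 e2 by (simp_all add: algebra_simps)
    then show ?thesis using p True by (simp add: zero_le_mult_iff)
  next
    case False
    then have u: "u < 0" using \<open>u \<noteq> 0\<close> by simp
    then have p: "?e - 1 > 0" by simp
    have "0 \<le> (1 - theta u) * (?e - 1)" "(1 - theta u) * (?e - 1) \<le> (- u) * (?e - 1)"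
      using e e1 e2 by (simp_all add: algebra_simps)
    then have "0 \<le> 1 - theta u" "1 - theta u \<le> - u" using p by (simp add: zero_le_mult_iff, metis mult_le_cancel_right_pos)
    then show ?thesis using u by simp
  qed
qed (simp add: theta_def)

lemma theta_nonneg: "0 \<le> theta u"
  by (auto simp: theta_def zero_le_divide_iff not_less)

lemma psi_theta: "2 * psi s = theta (2 * s) + theta (- 2 * s)"
proof (cases "s = 0")
  case False
  define x where "x = exp s"
  have x: "x > 0" "x \<noteq> 1" using False by (simp_all add: x_def)
  have x2: "x\<^sup>2 \<noteq> 1" using x by (simp add: power2_eq_1_iff)
  have "cosh s / sinh s = (exp s + exp (- s)) / (exp s - exp (- s))"
  proof -
    have half: "(a / 2) / (b / 2) = a / b" for a b :: real by simp
    show ?thesis unfolding cosh_field_def sinh_field_def half ..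
  qed
  then have e: "exp (2 * s) = x\<^sup>2" "exp (- (2 * s)) = 1 / x\<^sup>2" "cosh s / sinh s = (x + 1 / x) / (x - 1 / x)"
    using exp_add[of s s] by (simp_all add: x_def exp_minus inverse_eq_divide power2_eq_square)
  have d: "x - 1 / x \<noteq> 0" "1 - 1 / x\<^sup>2 \<noteq> 0" "1 - x\<^sup>2 \<noteq> 0" using x x2 by (simp_all add: field_simps power2_eq_square)
  \<comment> \<open>in terms of \<open>x = exp s\<close> both sides are rational\<close>
  have "theta (2 * s) + theta (- 2 * s) = 2 * s / (1 - 1 / x\<^sup>2) - 2 * s / (1 - x\<^sup>2)"
    using False e by (simp add: theta_def)
  also have "\<dots> = 2 * (s * ((x + 1 / x) / (x - 1 / x)))"
    using d x by (simp add: divide_simps) (simp add: algebra_simps power2_eq_square)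
  also have "\<dots> = 2 * psi s" using False unfolding psi_def e(3) by simp
  finally show ?thesis by simp
qed (simp add: theta_def psi_def)

lemma psi_minus [simp]: "psi (- s) = psi s"
  using psi_theta[of s] psi_theta[of "- s"] by simp

lemma psi_abs: "psi \<bar>s\<bar> = psi s"
  by (simp add: abs_if)

lemma sinh_gt: "0 < s \<Longrightarrow> s < sinh s" for s :: real
proof -
  assume s: "0 < s"
  have "(\<lambda>x. sinh x - x) 0 < (\<lambda>x. sinh x - x) s"
    using s
  proof (rule DERIV_pos_imp_increasing_open)
    fix x :: real assume "0 < x" "x < s"
    then have "cosh x - 1 > 0" using cosh_real_nonneg_less_iff[of 0 x] by simp
    then show "\<exists>y. ((\<lambda>x. sinh x - x) has_real_derivative y) (at x) \<and> 0 < y"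
      by (intro exI[of _ "cosh x - 1"] conjI) (auto intro!: derivative_eq_intros)
  qed (auto intro!: continuous_intros)
  then show ?thesis by simp
qed

lemma psi_mono: assumes "0 \<le> a" "a \<le> b" shows "psi a \<le> psi b"
proof (cases "a = 0")
  case True
  show ?thesis
  proof (cases "b = 0")
    case False
    then have b: "b > 0" using assms by simp
    have "(\<lambda>x. x * cosh x - sinh x) 0 \<le> (\<lambda>x. x * cosh x - sinh x) b"
    proof (rule DERIV_nonneg_imp_nondecreasing[where f = "\<lambda>x. x * cosh x - sinh x"])
      fix x :: real assume "0 \<le> x"
      then show "\<exists>y. ((\<lambda>x. x * cosh x - sinh x) has_real_derivative y) (at x) \<and> 0 \<le> y"
        by (intro exI[of _ "x * sinh x"] conjI) (auto intro!: derivative_eq_intros)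
    qed (use b in simp)
    then show ?thesis using b True by (simp add: psi_def divide_simps)
  qed (simp add: True)
next
  case False
  have "(\<lambda>s. s * (cosh s / sinh s)) a \<le> (\<lambda>s. s * (cosh s / sinh s)) b"
    using assms(2)
  proof (rule DERIV_nonneg_imp_nondecreasing)
    fix x assume "a \<le> x"
    then have x: "x > 0" using False assms by simp
    have "x * 1 \<le> sinh x * cosh x" using sinh_gt[OF x] cosh_real_ge_1[of x] x by (intro mult_mono) auto
    moreover have p: "sinh x * sinh x - cosh x * cosh x = - 1"
      using hyperbolic_pythagoras[of x] by (simp add: power2_eq_square)
    ultimately have "0 \<le> sinh x * cosh x + x * (sinh x * sinh x - cosh x * cosh x)" unfolding p by simp
    then show "\<exists>y. ((\<lambda>s. s * (cosh s / sinh s)) has_real_derivative y) (at x) \<and> 0 \<le> y"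
      using x by (intro exI[of _ "(sinh x * cosh x + x * (sinh x * sinh x - cosh x * cosh x)) / (sinh x * sinh x)"] conjI)
        (auto intro!: derivative_eq_intros simp: field_simps)
  qed
  then show ?thesis using False assms by (simp add: psi_def)
qed

lemma psi_ge_1: "1 \<le> psi s"
  using psi_mono[of 0 "\<bar>s\<bar>"] by (simp add: psi_abs) (simp add: psi_def)

lemma psi_gt_1: assumes "0 < s" shows "1 < psi s"
proof -
  have "(\<lambda>x. x * cosh x - sinh x) 0 < (\<lambda>x. x * cosh x - sinh x) s"
    using assms
  proof (rule DERIV_pos_imp_increasing_open)
    fix x :: real assume "0 < x"
    then show "\<exists>y. ((\<lambda>x. x * cosh x - sinh x) has_real_derivative y) (at x) \<and> 0 < y"
      by (intro exI[of _ "x * sinh x"] conjI) (auto intro!: derivative_eq_intros)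
  qed (auto intro!: continuous_intros)
  then show ?thesis using assms by (simp add: psi_def divide_simps)
qed

lemma isCont_psi: "isCont psi s"
proof (cases "s = 0")
  case True
  have b: "\<bar>psi x - psi 0\<bar> \<le> 2 * \<bar>x\<bar>" for x
    using psi_theta[of x] theta_bound[of "2 * x"] theta_bound[of "- 2 * x"] by (simp add: psi_def[of 0])
  have t: "((\<lambda>x::real. 2 * \<bar>x\<bar>) \<longlongrightarrow> 0) (at 0)"
    by (rule tendsto_eq_intros refl | simp)+
  have "((\<lambda>x. psi x - psi 0) \<longlongrightarrow> 0) (at 0)"
    by (rule Lim_null_comparison[OF always_eventually t]) (simp add: b)
  then have "(psi \<longlongrightarrow> psi 0) (at 0)" by (simp add: Lim_null[of psi])
  then show ?thesis using True by (simp add: isCont_def)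
next
  case False
  have "\<forall>\<^sub>F x in nhds s. x \<noteq> 0" using False by (rule t1_space_nhds)
  then have "\<forall>\<^sub>F x in nhds s. psi x = x * (cosh x / sinh x)" by eventually_elim (simp add: psi_def)
  moreover have "isCont (\<lambda>x. x * (cosh x / sinh x)) s" using False by (intro continuous_intros) auto
  ultimately show ?thesis by (simp add: isCont_cong)
qed

lemma theta_le: "theta u \<le> 1 + \<bar>u\<bar>"
  using theta_bound[of u] by linarith

lemma theta_exp: "theta u * exp (- u) = theta (- u)"
proof -
  have "theta u * exp (- u) * (1 - exp u) = - u"
    using theta_eq[of u] by (simp add: algebra_simps flip: exp_add)
  also have "\<dots> = theta (- u) * (1 - exp u)" using theta_eq[of "- u"] by simp
  finally have "(theta u * exp (- u)) * (1 - exp u) = theta (- u) * (1 - exp u)" .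
  moreover have "1 - exp u \<noteq> 0" if "u \<noteq> 0" using that by simp
  ultimately show ?thesis by (cases "u = 0") (auto simp: theta_def[of 0] mult_right_cancel)
qed

section \<open>Variation of the logarithm along a geodesic\<close>

text \<open>
  The entrywise form of the first-order expansions: \<open>l\<close>, \<open>m\<close> are eigenvalues of \<open>log R\<close> and
  \<open>log R\<^sub>t\<close>, \<open>w\<close> and \<open>y\<close> the corresponding entries of the overlap matrix and of \<open>Y\<close>, and \<open>a\<close>, \<open>b\<close>
  approximate \<open>t y / 2\<close>. In the second estimate the factors \<open>theta\<close> are replaced by 1 at the price
  of \<open>\<bar>m - l\<bar>\<close>; this is harmless because \<open>(m - l) w\<close> itself is of order \<open>t\<close>, even when
  \<open>m - l\<close> is not small.
\<close>

lemma entry_estimate: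
  fixes l m w a b y t B N c :: real
  assumes eq: "(m - l) * w = theta (m - l) * a + theta (l - m) * b"
    and a: "\<bar>a - t * y / 2\<bar> \<le> c * t\<^sup>2" and b: "\<bar>b - t * y / 2\<bar> \<le> c * t\<^sup>2"
    and y: "\<bar>y\<bar> \<le> N" and l: "\<bar>l\<bar> \<le> B" and m: "\<bar>m\<bar> \<le> B" and w: "\<bar>w\<bar> \<le> 1" and t: "\<bar>t\<bar> \<le> 1" and c: "0 \<le> c"
  defines "\<Theta> \<equiv> 1 + 2 * B" and "k \<equiv> c + N / 2"
  shows "\<bar>(m - l) * w * y - t * psi ((m - l) / 2) * y\<^sup>2\<bar> \<le> 2 * \<Theta> * c * N * t\<^sup>2"
    and "\<bar>w\<^sup>2 * (m\<^sup>2 - l\<^sup>2) / 2 - t * (l * w * y)\<bar> \<le> (2 * (\<Theta> * k)\<^sup>2 + 4 * B * \<Theta> * k\<^sup>2 + 2 * B * c) * t\<^sup>2"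
proof -
  have B0: "0 \<le> B" and N0: "0 \<le> N" using l y by linarith+
  have ml: "\<bar>m - l\<bar> \<le> 2 * B" "\<bar>l - m\<bar> \<le> 2 * B" using l m by linarith+
  have th: "\<bar>theta (m - l)\<bar> \<le> \<Theta>" "\<bar>theta (l - m)\<bar> \<le> \<Theta>"
    using theta_le[of "m - l"] theta_le[of "l - m"] ml theta_nonneg by (simp_all add: \<Theta>_def)
  have T0: "0 \<le> \<Theta>" and k0: "0 \<le> k" using B0 N0 c by (simp_all add: \<Theta>_def k_def)
  have psi: "2 * psi ((m - l) / 2) = theta (m - l) + theta (l - m)"
  proof -
    have "2 * ((m - l) / 2) = m - l" "- 2 * ((m - l) / 2) = l - m" by simp_all
    then show ?thesis by (simp only: psi_theta)
  qed
  have m1: "\<bar>theta (m - l) * (a - t * y / 2)\<bar> \<le> \<Theta> * (c * t\<^sup>2)"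
    "\<bar>theta (l - m) * (b - t * y / 2)\<bar> \<le> \<Theta> * (c * t\<^sup>2)"
    unfolding abs_mult using th a b T0 by (intro mult_mono; simp)+
  have "(m - l) * w - t * psi ((m - l) / 2) * y = theta (m - l) * (a - t * y / 2) + theta (l - m) * (b - t * y / 2)"
  proof -
    have "t * psi ((m - l) / 2) * y = t * y / 2 * (theta (m - l) + theta (l - m))"
      unfolding psi[symmetric] by simp
    then show ?thesis unfolding eq by (simp add: algebra_simps)
  qed
  then have "\<bar>(m - l) * w - t * psi ((m - l) / 2) * y\<bar> \<le> 2 * (\<Theta> * (c * t\<^sup>2))"
    using m1 by linarith
  then have "\<bar>(m - l) * w - t * psi ((m - l) / 2) * y\<bar> * \<bar>y\<bar> \<le> 2 * (\<Theta> * (c * t\<^sup>2)) * N"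
    using y T0 c by (intro mult_mono) auto
  then show "\<bar>(m - l) * w * y - t * psi ((m - l) / 2) * y\<^sup>2\<bar> \<le> 2 * \<Theta> * c * N * t\<^sup>2"
    by (simp add: algebra_simps power2_eq_square flip: abs_mult)
  have t2: "t\<^sup>2 \<le> \<bar>t\<bar>" using t by (simp add: power2_eq_square abs_if mult_left_le mult_le_one mult_left_le_one_le split: if_splits)
      (use mult_left_mono_neg[of "-1" t t] in simp)
  have ty: "\<bar>t * y / 2\<bar> \<le> N / 2 * \<bar>t\<bar>"
    using mult_left_mono[OF y, of "\<bar>t\<bar>"] by (simp add: abs_mult mult.commute)
  have ct: "c * t\<^sup>2 \<le> c * \<bar>t\<bar>" using t2 c by (rule mult_left_mono)
  have ab: "\<bar>a\<bar> \<le> k * \<bar>t\<bar>" "\<bar>b\<bar> \<le> k * \<bar>t\<bar>"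
    unfolding k_def distrib_right using a b ty ct by linarith+
  define d where "d = (m - l) * w"
  have d: "\<bar>d\<bar> \<le> 2 * (\<Theta> * (k * \<bar>t\<bar>))"
  proof -
    have "\<bar>theta (m - l) * a\<bar> \<le> \<Theta> * (k * \<bar>t\<bar>)" "\<bar>theta (l - m) * b\<bar> \<le> \<Theta> * (k * \<bar>t\<bar>)"
      unfolding abs_mult[of "theta _"] using th ab T0 by (intro mult_mono; simp)+
    then show ?thesis unfolding d_def eq by linarith
  qed
  have d2: "d\<^sup>2 \<le> 4 * ((\<Theta> * k)\<^sup>2 * t\<^sup>2)"
  proof -
    have "\<bar>d\<bar>\<^sup>2 \<le> (2 * (\<Theta> * (k * \<bar>t\<bar>)))\<^sup>2" using d by (intro power_mono) auto
    then show ?thesis by (simp add: power_mult_distrib mult.assoc)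
  qed
  have s: "\<bar>l * w * ((theta u - 1) * z)\<bar> \<le> 2 * B * \<Theta> * k\<^sup>2 * t\<^sup>2"
    if "\<bar>u\<bar> = \<bar>m - l\<bar>" "\<bar>z\<bar> \<le> k * \<bar>t\<bar>" for u z
  proof -
    have "\<bar>l * w * ((theta u - 1) * z)\<bar> = \<bar>l\<bar> * \<bar>w\<bar> * (\<bar>theta u - 1\<bar> * \<bar>z\<bar>)" by (simp add: abs_mult)
    also have "\<dots> \<le> \<bar>l\<bar> * \<bar>w\<bar> * (\<bar>m - l\<bar> * \<bar>z\<bar>)"
      using theta_bound[of u] that by (intro mult_left_mono mult_right_mono) auto
    also have "\<dots> = \<bar>l\<bar> * (\<bar>d\<bar> * \<bar>z\<bar>)" by (simp add: d_def abs_mult)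
    also have "\<dots> \<le> B * (2 * (\<Theta> * (k * \<bar>t\<bar>)) * (k * \<bar>t\<bar>))"
      using l d that T0 k0 B0 by (intro mult_mono) auto
    also have "\<dots> = 2 * B * \<Theta> * k\<^sup>2 * t\<^sup>2" by (simp add: power2_eq_square)
    finally show ?thesis .
  qed
  have r: "\<bar>l * w * (a + b - t * y)\<bar> \<le> B * 1 * (2 * (c * t\<^sup>2))"
    unfolding abs_mult using l w a b B0 by (intro mult_mono) (auto intro: mult_mono simp: abs_le_iff)
  have "w\<^sup>2 * (m\<^sup>2 - l\<^sup>2) / 2 = l * w * d + d\<^sup>2 / 2"
    by (simp add: d_def power2_eq_square field_simps)
  moreover have "l * w * d = l * w * ((theta (m - l) - 1) * a) + l * w * ((theta (l - m) - 1) * b) + l * w * (a + b)"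
    unfolding d_def eq by (simp add: algebra_simps)
  ultimately have e: "w\<^sup>2 * (m\<^sup>2 - l\<^sup>2) / 2 - t * (l * w * y) = l * w * ((theta (m - l) - 1) * a)
      + l * w * ((theta (l - m) - 1) * b) + l * w * (a + b - t * y) + d\<^sup>2 / 2"
    by (simp add: algebra_simps)
  have "\<bar>w\<^sup>2 * (m\<^sup>2 - l\<^sup>2) / 2 - t * (l * w * y)\<bar> \<le> 2 * B * \<Theta> * k\<^sup>2 * t\<^sup>2 + 2 * B * \<Theta> * k\<^sup>2 * t\<^sup>2 + B * 1 * (2 * (c * t\<^sup>2)) + 2 * ((\<Theta> * k)\<^sup>2 * t\<^sup>2)"
    unfolding e using s[of "m - l" a, OF refl ab(1)] s[of "l - m" b, OF abs_minus_commute ab(2)] r d2 zero_le_power2[of d]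
    by linarith
  then show "\<bar>w\<^sup>2 * (m\<^sup>2 - l\<^sup>2) / 2 - t * (l * w * y)\<bar> \<le> (2 * (\<Theta> * k)\<^sup>2 + 4 * B * \<Theta> * k\<^sup>2 + 2 * B * c) * t\<^sup>2"
    by (simp add: algebra_simps)
qed

text \<open>
  The point that moves along the geodesic is kept at the identity: the congruence by \<open>exp (t Y / 2)\<close>
  moves the reference point \<open>R\<close> instead, and the velocity stays constant.
\<close>

definition curve :: "real^'a^'a \<Rightarrow> real^'a^'a \<Rightarrow> real \<Rightarrow> real^'a^'a" where
  "curve R Y t = mat_exp ((t / 2) *\<^sub>R Y) ** R ** mat_exp ((t / 2) *\<^sub>R Y)"

lemma mat_exp_line:
  fixes Y :: "real^'a^'a"
  assumes "transpose Y = Y"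
  shows "mat_exp (s *\<^sub>R Y) ** mat_exp (t *\<^sub>R Y) = mat_exp ((s + t) *\<^sub>R Y)"
proof -
  obtain W :: "real^'a^'a" and x where W: "frame W" "Y = eigform W x" by (rule spectral_theorem[OF assms])
  have "mat_exp (s *\<^sub>R Y) = eigform W (\<lambda>i. exp (s * x i))" for s
    using W by (simp add: eigform_scale mat_exp_eigform)
  then show ?thesis
    using W by (simp_all add: eigform_mult exp_add distrib_right eigform_one)
qed

lemma mat_exp_inverse:
  fixes X :: "real^'a^'a"
  assumes "transpose X = X"
  shows "mat_exp X ** mat_exp (- X) = mat 1" "mat_exp (- X) ** mat_exp X = mat 1"
  using mat_exp_line[OF assms, of 1 "-1"] mat_exp_line[OF assms, of "-1" 1] by simp_all

lemma curve_0 [simp]: "curve R Y 0 = R" for Y :: "real^'a^'a"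
  by (simp add: curve_def)

lemma curve_add:
  fixes Y :: "real^'a^'a"
  assumes "transpose Y = Y" shows "curve (curve R Y s) Y t = curve R Y (s + t)"
proof -
  have "curve (curve R Y s) Y t = (mat_exp ((t / 2) *\<^sub>R Y) ** mat_exp ((s / 2) *\<^sub>R Y)) ** R ** (mat_exp ((s / 2) *\<^sub>R Y) ** mat_exp ((t / 2) *\<^sub>R Y))"
    by (simp only: curve_def matrix_mul_assoc)
  then show ?thesis unfolding mat_exp_line[OF assms] by (simp add: curve_def add.commute add_divide_distrib)
qed

lemma spd_curve:
  fixes Y :: "real^'a^'a"
  assumes "transpose Y = Y" "spd R" shows "spd (curve R Y t)"
proof -
  have s: "transpose ((t / 2) *\<^sub>R Y) = (t / 2) *\<^sub>R Y" using assms by (simp add: transpose_scalar)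
  show ?thesis
    using spd_congruence[OF assms(2) mat_exp_inverse(1)[OF s]] sym_mat_exp[OF s] by (simp add: curve_def)
qed

lemma norm_eigform_mono:
  assumes "frame U" "\<And>i. \<bar>f i\<bar> \<le> c * \<bar>g i\<bar>" "c \<ge> 0"
  shows "norm (eigform U f) \<le> c * norm (eigform U g)"
proof (rule power2_le_imp_le)
  have "(f i)\<^sup>2 \<le> c\<^sup>2 * (g i)\<^sup>2" for i
    using power_mono[OF assms(2)[of i], of 2] by (simp add: power_mult_distrib)
  then show "(norm (eigform U f))\<^sup>2 \<le> (c * norm (eigform U g))\<^sup>2"
    by (simp add: power_mult_distrib norm_eigform_sq assms(1) sum_distrib_left sum_mono)
qed (use assms in simp)

lemma exp_remainder: "\<bar>exp v - 1 - v\<bar> \<le> v\<^sup>2 * exp \<bar>v\<bar>" for v :: real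
proof -
  have 0: "0 \<le> exp v - 1 - v" using exp_ge_add_one_self[of v] by linarith
  have "exp v * (1 - v) \<le> exp v * exp (- v)"
    using exp_ge_add_one_self[of "- v"] by (intro mult_left_mono) auto
  then have "exp v - 1 - v \<le> v * (exp v - 1)" by (simp add: algebra_simps flip: exp_add)
  also have "\<dots> \<le> \<bar>v\<bar> * \<bar>exp v - exp 0\<bar>" by (simp flip: abs_mult)
  also have "\<dots> \<le> \<bar>v\<bar> * (exp \<bar>v\<bar> * \<bar>v - 0\<bar>)" by (intro mult_left_mono exp_diff_le) auto
  finally show ?thesis using 0 by (simp add: power2_eq_square mult_ac)
qed

lemma mat_exp_remainder:
  fixes Y :: "real^'a^'a"
  assumes "transpose Y = Y" "\<bar>s\<bar> \<le> 1"
  shows "norm (mat_exp (s *\<^sub>R Y) - mat 1 - s *\<^sub>R Y) \<le> ((norm Y)\<^sup>2 * exp (norm Y)) * s\<^sup>2"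
proof -
  obtain W :: "real^'a^'a" and x where W: "frame W" "Y = eigform W x" by (rule spectral_theorem[OF assms(1)])
  let ?N = "norm Y"
  have "mat_exp (s *\<^sub>R Y) - mat 1 - s *\<^sub>R Y = eigform W (\<lambda>i. exp (s * x i) - 1 - s * x i)"
    unfolding W(2) eigform_scale eigform_one[OF W(1), symmetric] mat_exp_eigform[OF W(1)] eigform_diff ..
  moreover have "norm (eigform W (\<lambda>i. exp (s * x i) - 1 - s * x i)) \<le> (s\<^sup>2 * ?N * exp ?N) * norm (eigform W x)"
  proof (rule norm_eigform_mono[OF W(1)])
    fix i
    have x: "\<bar>x i\<bar> \<le> ?N" using eigenvalue_le_norm[OF W(1)] W(2) by simp
    have sx: "\<bar>s * x i\<bar> \<le> ?N" using mult_mono[OF assms(2) x] by (simp add: abs_mult)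
    have "\<bar>exp (s * x i) - 1 - s * x i\<bar> \<le> (s * x i)\<^sup>2 * exp \<bar>s * x i\<bar>" by (rule exp_remainder)
    also have "\<dots> \<le> (s\<^sup>2 * (?N * \<bar>x i\<bar>)) * exp ?N"
    proof (rule mult_mono)
      have "\<bar>x i\<bar> * \<bar>x i\<bar> \<le> ?N * \<bar>x i\<bar>" using x by (intro mult_right_mono) auto
      then show "(s * x i)\<^sup>2 \<le> s\<^sup>2 * (?N * \<bar>x i\<bar>)"
        by (simp add: power_mult_distrib power2_eq_square[of "x i"] mult_left_mono)
    qed (use sx in auto)
    finally show "\<bar>exp (s * x i) - 1 - s * x i\<bar> \<le> s\<^sup>2 * ?N * exp ?N * \<bar>x i\<bar>" by (simp add: mult_ac)
  qed simp
  ultimately show ?thesis using W by (simp add: power2_eq_square mult_ac)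
qed

text \<open>
  With \<open>E = exp (t Y / 2)\<close>, the increment is \<open>R\<^sub>t - R = (1 - E\<^sup>-\<^sup>1) R\<^sub>t + R (E - 1)\<close>. The eigenbasis of
  \<open>R\<^sub>t\<close> diagonalizes the first term on the right, that of \<open>R\<close> the second one on the left. Passing
  from \<open>R\<close> to \<open>log R\<close> multiplies the entries by divided differences of the logarithm.
\<close>

lemma curve_mixed:
  fixes U V Y R :: "real^'a^'a"
  assumes Y: "transpose Y = Y" and fr: "frame U" "frame V" and R: "R = eigform U (\<lambda>i. exp (l i))"
    and Rt: "curve R Y t = eigform V (\<lambda>i. exp (m i))"
  defines "a \<equiv> transpose U ** (mat 1 - mat_exp ((- t / 2) *\<^sub>R Y)) ** V"
    and "b \<equiv> transpose U ** (mat_exp ((t / 2) *\<^sub>R Y) - mat 1) ** V"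
  shows "(m j - l i) * (transpose U ** V) $ i $ j = theta (m j - l i) * a $ i $ j + theta (l i - m j) * b $ i $ j"
proof -
  let ?E = "mat_exp ((t / 2) *\<^sub>R Y)" and ?F = "mat_exp ((- t / 2) *\<^sub>R Y)" and ?w = "transpose U ** V"
  have FE: "?F ** ?E = mat 1" using mat_exp_line[OF Y, of "- t / 2" "t / 2"] by simp
  have "?F ** curve R Y t = (?F ** ?E) ** R ** ?E" by (simp only: curve_def matrix_mul_assoc)
  then have FR: "?F ** curve R Y t = R ** ?E" using FE by simp
  have "transpose U ** (curve R Y t - R) ** V = transpose U ** ((mat 1 - ?F) ** curve R Y t + R ** (?E - mat 1)) ** V"
    using FR by (simp add: matrix_diff_ldistrib matrix_diff_rdistrib)
  also have "\<dots> = transpose U ** (mat 1 - ?F) ** eigform V (\<lambda>i. exp (m i)) ** V + transpose U ** eigform U (\<lambda>i. exp (l i)) ** (?E - mat 1) ** V"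
    unfolding Rt unfolding R by (simp add: matrix_add_ldistrib matrix_add_rdistrib matrix_mul_assoc)
  also have "transpose U ** (mat 1 - ?F) ** eigform V (\<lambda>i. exp (m i)) ** V = a ** diagm (\<lambda>i. exp (m i))"
    unfolding eigform_def a_def using fr by (simp add: matrix_mul_assoc frame_cancel)
  also have "transpose U ** eigform U (\<lambda>i. exp (l i)) ** (?E - mat 1) ** V = diagm (\<lambda>i. exp (l i)) ** b"
    unfolding eigform_def b_def using fr by (simp add: matrix_mul_assoc frame_cancel)
  finally have "(transpose U ** (curve R Y t - R) ** V) $ i $ j = (a ** diagm (\<lambda>i. exp (m i)) + diagm (\<lambda>i. exp (l i)) ** b) $ i $ j"
    by simp
  moreover have "(transpose U ** (curve R Y t - R) ** V) $ i $ j = ?w $ i $ j * exp (m j) - exp (l i) * ?w $ i $ j"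
    unfolding Rt unfolding R matrix_diff_ldistrib matrix_diff_rdistrib
    by (simp add: eigform_mixed[OF fr])
  ultimately have e: "(exp (m j) - exp (l i)) * ?w $ i $ j = a $ i $ j * exp (m j) + exp (l i) * b $ i $ j"
    by (simp add: mult_diagm_nth diagm_mult_nth algebra_simps)
  define u where "u = m j - l i"
  have "exp (l i) = exp (m j) * exp (- u)" by (simp add: u_def flip: exp_add)
  \<comment> \<open>divide by \<open>exp (m j)\<close>, so that only the difference \<open>u\<close> of the eigenvalues enters\<close>
  from e[unfolded this] have "exp (m j) * ((1 - exp (- u)) * ?w $ i $ j) = exp (m j) * (a $ i $ j + exp (- u) * b $ i $ j)"
    by (simp add: algebra_simps)
  then have "(1 - exp (- u)) * ?w $ i $ j = a $ i $ j + exp (- u) * b $ i $ j" by simp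
  then have "theta u * ((1 - exp (- u)) * ?w $ i $ j) = theta u * (a $ i $ j + exp (- u) * b $ i $ j)" by simp
  then have "(theta u * (1 - exp (- u))) * ?w $ i $ j = theta u * a $ i $ j + (theta u * exp (- u)) * b $ i $ j"
    by (simp add: algebra_simps)
  then show ?thesis unfolding theta_eq theta_exp by (simp add: u_def)
qed

lemma sum_frame_sq: "frame U \<Longrightarrow> (\<Sum>k\<in>UNIV. ((transpose U *v x) $ k)\<^sup>2) = x \<bullet> x"
  using inner_eigform[of x U "\<lambda>_. 1"] by (simp add: eigform_one del: transpose_matrix_vector)

lemma inner_eigform_bounds:
  assumes "frame U"
  shows "(\<And>k. f k \<le> c) \<Longrightarrow> x \<bullet> (eigform U f *v x) \<le> c * (x \<bullet> x)"
    and "(\<And>k. c \<le> f k) \<Longrightarrow> c * (x \<bullet> x) \<le> x \<bullet> (eigform U f *v x)"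
  unfolding inner_eigform sum_frame_sq[OF assms, symmetric] sum_distrib_left
  by (intro sum_mono mult_right_mono; simp)+

text \<open>
  Rayleigh quotients: \<open>v \<bullet> R\<^sub>t v = Ev \<bullet> R (Ev)\<close> for a unit eigenvector \<open>v\<close>, and \<open>\<bar>Ev\<bar>\<^sup>2\<close> lies between
  \<open>exp (- \<bar>t\<bar> \<bar>Y\<bar>)\<close> and \<open>exp (\<bar>t\<bar> \<bar>Y\<bar>)\<close>.
\<close>

lemma curve_eigenvalue_bounds:
  fixes U V Y R :: "real^'a^'a"
  assumes Y: "transpose Y = Y" and fr: "frame U" "frame V" and R: "R = eigform U (\<lambda>i. exp (l i))"
    and Rt: "curve R Y t = eigform V (\<lambda>i. exp (m i))"
  shows "(\<And>i. l i \<le> c) \<Longrightarrow> m j \<le> c + \<bar>t\<bar> * norm Y"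
    and "(\<And>i. c \<le> l i) \<Longrightarrow> c - \<bar>t\<bar> * norm Y \<le> m j"
proof -
  let ?E = "mat_exp ((t / 2) *\<^sub>R Y)"
  let ?v = "V *v axis j 1"
  have v: "transpose V *v ?v = axis j 1" using frame_cancel(1)[OF fr(2)]
    by (simp only: matrix_vector_mul_assoc matrix_vector_mul_lid)
  have vv: "?v \<bullet> ?v = 1" using sum_frame_sq[OF fr(2), of ?v] unfolding v
    by (simp add: axis_def if_distrib[of "\<lambda>x. x^2"] sum.delta cong: if_cong)
  have sE: "transpose ?E = ?E" using Y by (simp add: sym_mat_exp transpose_scalar)
  have E2: "?E ** ?E = mat_exp (t *\<^sub>R Y)" using mat_exp_line[OF Y] by simp
  obtain W :: "real^'a^'a" and x where W: "frame W" "Y = eigform W x" by (rule spectral_theorem[OF Y])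
  have Et: "mat_exp (t *\<^sub>R Y) = eigform W (\<lambda>i. exp (t * x i))" using W by (simp add: eigform_scale mat_exp_eigform)
  have tx: "\<bar>t * x i\<bar> \<le> \<bar>t\<bar> * norm Y" for i
    using eigenvalue_le_norm[OF W(1), of x i] W(2) by (simp add: abs_mult mult_left_mono)
  let ?u = "?E *v ?v"
  have adj: "?u \<bullet> z = ?v \<bullet> (?E *v z)" for z using sE by (metis dot_lmul_matrix transpose_matrix_vector)
  have uu: "?u \<bullet> ?u = ?v \<bullet> (eigform W (\<lambda>i. exp (t * x i)) *v ?v)"
    unfolding adj matrix_vector_mul_assoc[of ?E ?E] E2 Et ..
  have tx': "t * x k \<le> \<bar>t\<bar> * norm Y" "- (\<bar>t\<bar> * norm Y) \<le> t * x k" for k using tx[of k] by linarith+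
  have u1: "?u \<bullet> ?u \<le> exp (\<bar>t\<bar> * norm Y)" "exp (- (\<bar>t\<bar> * norm Y)) \<le> ?u \<bullet> ?u"
    unfolding uu using inner_eigform_bounds[OF W(1), where f = "\<lambda>i. exp (t * x i)" and x = ?v] vv tx' by simp_all
  have "exp (m j) = ?v \<bullet> (curve R Y t *v ?v)" unfolding Rt inner_eigform v
    by (simp add: axis_def if_distrib[of "\<lambda>x. x^2"] if_distrib[of "\<lambda>x. _ * x"] sum.delta cong: if_cong)
  also have "\<dots> = ?u \<bullet> (R *v ?u)" unfolding adj curve_def by (simp add: matrix_vector_mul_assoc matrix_mul_assoc)
  finally have em: "exp (m j) = ?u \<bullet> (eigform U (\<lambda>i. exp (l i)) *v ?u)" unfolding R .
  show "m j \<le> c + \<bar>t\<bar> * norm Y" if "\<And>i. l i \<le> c"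
  proof -
    have "exp (m j) \<le> exp c * (?u \<bullet> ?u)" unfolding em using that by (intro inner_eigform_bounds(1)[OF fr(1)]) simp
    also have "\<dots> \<le> exp c * exp (\<bar>t\<bar> * norm Y)" using u1 by (intro mult_left_mono) auto
    finally show ?thesis by (simp flip: exp_add)
  qed
  show "c - \<bar>t\<bar> * norm Y \<le> m j" if "\<And>i. c \<le> l i"
  proof -
    have "exp c * exp (- (\<bar>t\<bar> * norm Y)) \<le> exp c * (?u \<bullet> ?u)" using u1 by (intro mult_left_mono) auto
    also have "\<dots> \<le> exp (m j)" unfolding em using that by (intro inner_eigform_bounds(2)[OF fr(1)]) simp
    finally show ?thesis by (simp flip: exp_add)
  qed
qed

lemma frame_entry_le: 
  assumes "frame U" shows "\<bar>U $ i $ j\<bar> \<le> 1"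
proof -
  have "(\<Sum>k\<in>UNIV. U $ k $ j * U $ k $ j) = (transpose U ** U) $ j $ j"
    unfolding matrix_mult_nth by (simp add: transpose_def)
  also have "\<dots> = 1" using assms by (simp add: frame_cancel mat_def)
  finally have "(U $ i $ j)\<^sup>2 \<le> 1"
    using member_le_sum[of i UNIV "\<lambda>k. (U $ k $ j)\<^sup>2"] by (simp add: power2_eq_square)
  then show ?thesis by (simp add: abs_square_le_1)
qed

lemma double_sum_bound:
  fixes p :: "'a::finite \<Rightarrow> 'b::finite \<Rightarrow> real"
  assumes "\<And>i j. \<bar>p i j\<bar> \<le> K"
  shows "\<bar>\<Sum>i\<in>UNIV. \<Sum>j\<in>UNIV. p i j\<bar> \<le> real (CARD('a) * CARD('b)) * K"
proof -
  have "norm (\<Sum>j\<in>UNIV. p i j) \<le> real CARD('b) * K" for i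
    using assms by (intro sum_norm_bound) auto
  then have "norm (\<Sum>i\<in>UNIV. \<Sum>j\<in>UNIV. p i j) \<le> real CARD('a) * (real CARD('b) * K)"
    by (rule sum_norm_bound)
  then show ?thesis by (simp add: mult.assoc)
qed

text \<open>
  The source of the factor \<open>\<surd>2\<close> in the smoothness constant: \<open>(x - y)\<^sup>2 \<le> 2 (x\<^sup>2 + y\<^sup>2)\<close>.
\<close>

lemma eigenvalue_gap:
  assumes "frame U" shows "f i - f j \<le> sqrt 2 * norm (eigform U f)"
proof (cases "i = j")
  case False
  have "(f i - f j)\<^sup>2 \<le> 2 * ((f i)\<^sup>2 + (f j)\<^sup>2)"
    using zero_le_power2[of "f i + f j"] by (simp add: power2_eq_square algebra_simps)
  also have "(f i)\<^sup>2 + (f j)\<^sup>2 = (\<Sum>k\<in>{i, j}. (f k)\<^sup>2)" using False by simp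
  also have "\<dots> \<le> (\<Sum>k\<in>UNIV. (f k)\<^sup>2)" by (intro sum_mono2) auto
  finally have "(f i - f j)\<^sup>2 \<le> (sqrt 2 * norm (eigform U f))\<^sup>2"
    by (simp add: power_mult_distrib norm_eigform_sq assms)
  then show ?thesis by (rule power2_le_imp_le) simp
qed simp

text \<open>
  The three first-order expansions at a base point, with one error constant for all base points in
  a ball. The last two together say that the second derivative of half the squared distance is a sum of
  \<open>psi ((m\<^sub>j - l\<^sub>i) / 2) y\<^sub>i\<^sub>j\<^sup>2\<close>, with \<open>1 \<le> psi\<close> on the one hand and the eigenvalue gap on the other.
\<close>

lemma curve_step:
  fixes Y :: "real^'a^'a"
  assumes Y: "transpose Y = Y"
  shows "\<exists>K\<ge>0. \<forall>R t. spd R \<longrightarrow> norm (mat_log R) \<le> B \<longrightarrow> \<bar>t\<bar> \<le> 1 \<longrightarrow>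
    \<bar>(norm (mat_log (curve R Y t)))\<^sup>2 / 2 - (norm (mat_log R))\<^sup>2 / 2 - t * (mat_log R \<bullet> Y)\<bar> \<le> K * t\<^sup>2 \<and>
    (0 \<le> t \<longrightarrow> t * (norm Y)\<^sup>2 - K * t\<^sup>2 \<le> mat_log (curve R Y t) \<bullet> Y - mat_log R \<bullet> Y \<and>
      mat_log (curve R Y t) \<bullet> Y - mat_log R \<bullet> Y
        \<le> t * psi (norm (mat_log R) / sqrt 2 + t * norm Y / 2) * (norm Y)\<^sup>2 + K * t\<^sup>2)"
proof -
  define N where "N = norm Y"
  define B' where "B' = \<bar>B\<bar> + N"
  \<comment> \<open>\<open>c\<close> bounds the remainder of the exponential, \<open>B'\<close> the eigenvalues at both times\<close>
  define c where "c = N\<^sup>2 * exp N"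
  define n2 where "n2 = real (CARD('a) * CARD('a))"
  define T where "T = 1 + 2 * B'"
  define k where "k = c + N / 2"
  define K1 where "K1 = 2 * T * c * N"
  define K2 where "K2 = 2 * (T * k)\<^sup>2 + 4 * B' * T * k\<^sup>2 + 2 * B' * c"
  have N0: "0 \<le> N" and c0: "0 \<le> c" and B0: "0 \<le> B'" by (simp_all add: N_def c_def B'_def)
  have T0: "0 \<le> T" using B0 by (simp add: T_def)
  have K0: "0 \<le> K1" "0 \<le> K2" using N0 c0 B0 T0 by (simp_all add: K1_def K2_def)
  define K where "K = n2 * (K1 + K2)"
  have n2: "0 \<le> n2" by (simp add: n2_def)
  have K: "0 \<le> K" "n2 * K1 \<le> K" "n2 * K2 \<le> K" using K0 n2 by (simp_all add: K_def mult_left_mono)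
  show ?thesis
  proof (intro exI[of _ K] conjI allI impI K)
    fix R :: "real^'a^'a" and t :: real
    assume R: "spd R" and RB: "norm (mat_log R) \<le> B" and t: "\<bar>t\<bar> \<le> 1"
    let ?Rt = "curve R Y t"
    have Rt: "spd ?Rt" using spd_curve[OF Y R] .
    obtain U :: "real^'a^'a" and l where U: "frame U" "mat_log R = eigform U l"
      by (rule spectral_theorem[OF spd_log(1)[OF R]])
    obtain V :: "real^'a^'a" and m where V: "frame V" "mat_log ?Rt = eigform V m"
      by (rule spectral_theorem[OF spd_log(1)[OF Rt]])
    have RU: "R = eigform U (\<lambda>i. exp (l i))" using spd_log(2)[OF R] U by (simp add: mat_exp_eigform)
    have RV: "?Rt = eigform V (\<lambda>i. exp (m i))" using spd_log(2)[OF Rt] V by (simp add: mat_exp_eigform)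
    have lB: "\<bar>l i\<bar> \<le> \<bar>B\<bar>" for i using eigenvalue_le_norm[OF U(1), of l i] U(2) RB by simp
    have tN: "\<bar>t\<bar> * norm Y \<le> N" using t N0 by (simp add: N_def mult_left_le_one_le)
    note ev = curve_eigenvalue_bounds[OF Y U(1) V(1) RU RV]
    have mB: "\<bar>m j\<bar> \<le> B'" for j
    proof -
      have "m j \<le> \<bar>B\<bar> + \<bar>t\<bar> * norm Y" using lB by (intro ev(1)) (simp add: abs_le_iff)
      moreover have "- \<bar>B\<bar> - \<bar>t\<bar> * norm Y \<le> m j" using lB by (intro ev(2)) (simp add: abs_le_iff minus_le_iff)
      ultimately show ?thesis using tN by (simp add: B'_def abs_le_iff)
    qed
    have lB': "\<bar>l i\<bar> \<le> B'" for i using lB[of i] N0 by (simp add: B'_def)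
    define w where "w = transpose U ** V"
    define y where "y = transpose U ** Y ** V"
    define a where "a = transpose U ** (mat 1 - mat_exp ((- t / 2) *\<^sub>R Y)) ** V"
    define b where "b = transpose U ** (mat_exp ((t / 2) *\<^sub>R Y) - mat 1) ** V"
    have w1: "\<bar>w $ i $ j\<bar> \<le> 1" for i j unfolding w_def using U V by (intro frame_entry_le frame_mult) simp_all
    have yN: "\<bar>y $ i $ j\<bar> \<le> N" for i j
      using entry_le_norm[of y i j] norm_frame[OF U(1) V(1), of Y] by (simp add: y_def N_def)
    have rem: "norm (mat_exp (s *\<^sub>R Y) - mat 1 - s *\<^sub>R Y) \<le> c * t\<^sup>2" if "\<bar>s\<bar> = \<bar>t\<bar> / 2" for s
    proof -
      have "s\<^sup>2 \<le> t\<^sup>2" using that by (intro power2_le_iff_abs_le[THEN iffD2, of "\<bar>t\<bar>", simplified]) auto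
      then have "c * s\<^sup>2 \<le> c * t\<^sup>2" using c0 by (rule mult_left_mono)
      then show ?thesis using mat_exp_remainder[OF Y, of s] that t by (simp add: c_def N_def)
    qed
    have ea: "\<bar>a $ i $ j - t * y $ i $ j / 2\<bar> \<le> c * t\<^sup>2" for i j
    proof -
      have "a - (t / 2) *\<^sub>R y = transpose U ** (- (mat_exp ((- t / 2) *\<^sub>R Y) - mat 1 - (- t / 2) *\<^sub>R Y)) ** V"
        unfolding a_def y_def by (simp add: matrix_diff_ldistrib matrix_diff_rdistrib matrix_scale_left matrix_scale_right)
      then have "norm (a - (t / 2) *\<^sub>R y) \<le> c * t\<^sup>2"
        using rem[of "- t / 2"] by (simp only: norm_minus_cancel norm_frame[OF U(1) V(1)])
      then show ?thesis using entry_le_norm[of "a - (t / 2) *\<^sub>R y" i j] by simp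
    qed
    have eb: "\<bar>b $ i $ j - t * y $ i $ j / 2\<bar> \<le> c * t\<^sup>2" for i j
    proof -
      have "b - (t / 2) *\<^sub>R y = transpose U ** (mat_exp ((t / 2) *\<^sub>R Y) - mat 1 - (t / 2) *\<^sub>R Y) ** V"
        unfolding b_def y_def by (simp add: matrix_diff_ldistrib matrix_diff_rdistrib matrix_scale_left matrix_scale_right)
      then have "norm (b - (t / 2) *\<^sub>R y) \<le> c * t\<^sup>2"
        using norm_frame[OF U(1) V(1)] rem[of "t / 2"] by simp
      then show ?thesis using entry_le_norm[of "b - (t / 2) *\<^sub>R y" i j] by simp
    qed
    note est = entry_estimate[OF curve_mixed[OF Y U(1) V(1) RU RV, folded a_def b_def w_def] ea eb yN lB' mB w1 t c0,
        folded T_def k_def, folded K1_def K2_def]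
    have mix: "(transpose U ** mat_log R ** V) $ i $ j = l i * w $ i $ j"
      "(transpose U ** mat_log ?Rt ** V) $ i $ j = w $ i $ j * m j" for i j
      using eigform_mixed[OF U(1) V(1)] U(2) V(2) by (simp_all add: w_def)
    have nl: "(norm (mat_log R))\<^sup>2 = (\<Sum>i\<in>UNIV. \<Sum>j\<in>UNIV. (l i * w $ i $ j)\<^sup>2)"
      and nm: "(norm (mat_log ?Rt))\<^sup>2 = (\<Sum>i\<in>UNIV. \<Sum>j\<in>UNIV. (w $ i $ j * m j)\<^sup>2)"
      and ny: "(norm Y)\<^sup>2 = (\<Sum>i\<in>UNIV. \<Sum>j\<in>UNIV. (y $ i $ j)\<^sup>2)"
      by (simp_all only: norm_frame[OF U(1) V(1), symmetric, of "mat_log R"] norm_frame[OF U(1) V(1), symmetric, of "mat_log ?Rt"]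
          norm_frame[OF U(1) V(1), symmetric, of Y] norm_matrix_sq mix y_def)
    have il: "mat_log R \<bullet> Y = (\<Sum>i\<in>UNIV. \<Sum>j\<in>UNIV. l i * w $ i $ j * y $ i $ j)"
      and im: "mat_log ?Rt \<bullet> Y = (\<Sum>i\<in>UNIV. \<Sum>j\<in>UNIV. w $ i $ j * m j * y $ i $ j)"
    proof -
      have "mat_log R \<bullet> Y = (transpose U ** mat_log R ** V) \<bullet> y" "mat_log ?Rt \<bullet> Y = (transpose U ** mat_log ?Rt ** V) \<bullet> y"
        by (simp_all only: y_def inner_frame[OF U(1) V(1)])
      then show "mat_log R \<bullet> Y = (\<Sum>i\<in>UNIV. \<Sum>j\<in>UNIV. l i * w $ i $ j * y $ i $ j)"
        "mat_log ?Rt \<bullet> Y = (\<Sum>i\<in>UNIV. \<Sum>j\<in>UNIV. w $ i $ j * m j * y $ i $ j)"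
        by (simp_all only: inner_matrix mix)
    qed
    have "(norm (mat_log ?Rt))\<^sup>2 / 2 - (norm (mat_log R))\<^sup>2 / 2 - t * (mat_log R \<bullet> Y)
      = (\<Sum>i\<in>UNIV. \<Sum>j\<in>UNIV. (w $ i $ j)\<^sup>2 * ((m j)\<^sup>2 - (l i)\<^sup>2) / 2 - t * (l i * w $ i $ j * y $ i $ j))"
      unfolding nl nm il by (simp add: sum_subtractf sum_distrib_left sum_divide_distrib power_mult_distrib
          right_diff_distrib diff_divide_distrib mult_ac)
    also have "\<bar>\<dots>\<bar> \<le> n2 * (K2 * t\<^sup>2)" unfolding n2_def by (rule double_sum_bound) (rule est(2))
    also have "\<dots> \<le> K * t\<^sup>2" using mult_right_mono[OF K(3), of "t\<^sup>2"] by (simp add: mult.assoc)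
    finally show "\<bar>(norm (mat_log ?Rt))\<^sup>2 / 2 - (norm (mat_log R))\<^sup>2 / 2 - t * (mat_log R \<bullet> Y)\<bar> \<le> K * t\<^sup>2" .
    define S where "S = (\<Sum>i\<in>UNIV. \<Sum>j\<in>UNIV. psi ((m j - l i) / 2) * (y $ i $ j)\<^sup>2)"
    have "mat_log ?Rt \<bullet> Y - mat_log R \<bullet> Y - t * S
      = (\<Sum>i\<in>UNIV. \<Sum>j\<in>UNIV. (m j - l i) * w $ i $ j * y $ i $ j - t * psi ((m j - l i) / 2) * (y $ i $ j)\<^sup>2)"
      unfolding il im S_def by (simp add: sum.distrib sum_subtractf sum_distrib_left algebra_simps)
    also have "\<bar>\<dots>\<bar> \<le> n2 * (K1 * t\<^sup>2)" unfolding n2_def by (rule double_sum_bound) (rule est(1))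
    also have "\<dots> \<le> K * t\<^sup>2" using mult_right_mono[OF K(2), of "t\<^sup>2"] by (simp add: mult.assoc)
    finally have main: "\<bar>mat_log ?Rt \<bullet> Y - mat_log R \<bullet> Y - t * S\<bar> \<le> K * t\<^sup>2" .
    assume t0: "0 \<le> t"
    have "(norm Y)\<^sup>2 \<le> S" unfolding ny S_def
      using mult_right_mono[OF psi_ge_1, of "(y $ i $ j)\<^sup>2" "(m j - l i) / 2" for i j] by (intro sum_mono) simp
    then have "t * (norm Y)\<^sup>2 \<le> t * S" using t0 by (rule mult_left_mono)
    then show "t * (norm Y)\<^sup>2 - K * t\<^sup>2 \<le> mat_log ?Rt \<bullet> Y - mat_log R \<bullet> Y" using main by linarith
    let ?D = "norm (mat_log R)"
    let ?q = "psi (?D / sqrt 2 + t * norm Y / 2)"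
    have "psi ((m j - l i) / 2) \<le> ?q" for i j
    proof -
      have g: "l p \<le> l i + sqrt 2 * ?D" "l i - sqrt 2 * ?D \<le> l p" for p
        using eigenvalue_gap[OF U(1), of l p i] eigenvalue_gap[OF U(1), of l i p] U(2) by simp_all
      have "m j \<le> l i + sqrt 2 * ?D + \<bar>t\<bar> * norm Y" by (rule ev(1)) (rule g)
      moreover have "l i - sqrt 2 * ?D - \<bar>t\<bar> * norm Y \<le> m j" by (rule ev(2)) (rule g)
      ultimately have "\<bar>(m j - l i) / 2\<bar> \<le> sqrt 2 * ?D / 2 + t * norm Y / 2" using t0 by (simp add: abs_le_iff)
      also have "sqrt 2 * ?D / 2 = ?D / sqrt 2" by (simp add: field_simps)
      finally have "psi \<bar>(m j - l i) / 2\<bar> \<le> ?q" by (intro psi_mono) simp_all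
      then show ?thesis by (simp only: psi_abs)
    qed
    then have "S \<le> ?q * (norm Y)\<^sup>2" unfolding ny S_def sum_distrib_left by (intro sum_mono mult_right_mono) auto
    then have "t * S \<le> t * (?q * (norm Y)\<^sup>2)" using t0 by (rule mult_left_mono)
    then show "mat_log ?Rt \<bullet> Y - mat_log R \<bullet> Y \<le> t * ?q * (norm Y)\<^sup>2 + K * t\<^sup>2"
      using main by (simp add: mult.assoc)
  qed
qed

section \<open>The squared distance along a geodesic\<close>

text \<open>
  Over \<open>n\<close> equal subintervals the errors add up to \<open>(b - a) e ((b - a) / n)\<close>, which vanishes as
  \<open>n\<close> grows.
\<close>

lemma increments_le:
  fixes f e :: "real \<Rightarrow> real"
  assumes ab: "a \<le> b"
    and step: "\<And>u v. a \<le> u \<Longrightarrow> u \<le> v \<Longrightarrow> v \<le> b \<Longrightarrow> v - u \<le> 1 \<Longrightarrow> f v - f u \<le> (v - u) * e (v - u)"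
    and e: "(e \<longlongrightarrow> 0) (at 0)"
  shows "f b \<le> f a"
proof (cases "a = b")
  case False
  then have lt: "a < b" using ab by simp
  define h where "h n = (b - a) / real (Suc n)" for n
  have h_pos: "h n > 0" for n using lt by (simp add: h_def)
  have h0: "h \<longlonglongrightarrow> 0"
    unfolding h_def by (rule LIMSEQ_Suc[OF lim_const_over_n])
  have "filterlim h (at 0) sequentially"
    using h0 h_pos by (simp add: filterlim_at less_imp_neq[symmetric])
  then have eh: "(\<lambda>n. e (h n)) \<longlonglongrightarrow> 0" by (rule filterlim_compose[OF e])
  have "\<forall>\<^sub>F n in sequentially. h n < 1" using h0 by (rule order_tendstoD) simp
  then have "\<forall>\<^sub>F n in sequentially. f b - f a \<le> (b - a) * e (h n)"
  proof eventually_elim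
    case (elim n)
    have nh: "real (Suc n) * h n = b - a" by (simp add: h_def)
    have st: "f (a + real (Suc k) * h n) - f (a + real k * h n) \<le> h n * e (h n)" if "k < Suc n" for k
    proof -
      have "real (Suc k) * h n \<le> real (Suc n) * h n" using that h_pos[of n] by (intro mult_right_mono) auto
      then have "a + real (Suc k) * h n \<le> b" using nh by simp
      moreover have d: "a + real (Suc k) * h n - (a + real k * h n) = h n" by (simp add: algebra_simps)
      moreover have "a \<le> a + real k * h n" using h_pos[of n] by simp
      moreover have "a + real k * h n \<le> a + real (Suc k) * h n" using d h_pos[of n] by linarith
      ultimately show ?thesis using step[of "a + real k * h n" "a + real (Suc k) * h n"] elim by simp
    qed
    have "f b - f a = (\<Sum>k<Suc n. f (a + real (Suc k) * h n) - f (a + real k * h n))"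
      using nh by (subst sum_lessThan_telescope) simp
    also have "\<dots> \<le> (\<Sum>k<Suc n. h n * e (h n))" using st by (intro sum_mono) auto
    also have "\<dots> = (real (Suc n) * h n) * e (h n)" by (simp only: sum_constant card_lessThan mult.assoc)
    finally show ?case unfolding nh .
  qed
  then have "f b - f a \<le> (b - a) * 0"
    by (intro tendsto_lowerbound[OF tendsto_mult[OF tendsto_const eh]]) auto
  then show ?thesis by simp
qed simp

text \<open>
  Only the boundedness on bounded time intervals matters; the factor \<open>CARD('a)\<close> is a crude
  comparison of the Frobenius norm with the largest eigenvalue.
\<close>

lemma norm_log_curve_le:
  fixes Y R :: "real^'a^'a"
  assumes Y: "transpose Y = Y" and R: "spd R"
  shows "norm (mat_log (curve R Y t)) \<le> real CARD('a) * (norm (mat_log R) + \<bar>t\<bar> * norm Y)"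
proof -
  let ?Rt = "curve R Y t" and ?C = "norm (mat_log R) + \<bar>t\<bar> * norm Y"
  have Rt: "spd ?Rt" using spd_curve[OF Y R] .
  obtain U :: "real^'a^'a" and l where U: "frame U" "mat_log R = eigform U l"
    by (rule spectral_theorem[OF spd_log(1)[OF R]])
  obtain V :: "real^'a^'a" and m where V: "frame V" "mat_log ?Rt = eigform V m"
    by (rule spectral_theorem[OF spd_log(1)[OF Rt]])
  have RU: "R = eigform U (\<lambda>i. exp (l i))" using spd_log(2)[OF R] U by (simp add: mat_exp_eigform)
  have RV: "?Rt = eigform V (\<lambda>i. exp (m i))" using spd_log(2)[OF Rt] V by (simp add: mat_exp_eigform)
  have lB: "l i \<le> norm (mat_log R)" "- norm (mat_log R) \<le> l i" for i
    using eigenvalue_le_norm[OF U(1), of l i] U(2) by (simp_all add: abs_le_iff)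
  note ev = curve_eigenvalue_bounds[OF Y U(1) V(1) RU RV]
  have m: "\<bar>m j\<bar> \<le> ?C * \<bar>1\<bar>" for j
    using ev(1)[OF lB(1), of j] ev(2)[OF lB(2), of j] by (simp add: abs_le_iff)
  have "norm (mat_log ?Rt) \<le> ?C * norm (eigform V (\<lambda>_. 1))"
    unfolding V(2) by (rule norm_eigform_mono[OF V(1) m]) simp
  also have "\<dots> \<le> ?C * real CARD('a)"
  proof (intro mult_left_mono)
    show "norm (eigform V (\<lambda>_. 1)) \<le> real CARD('a)"
    proof (rule power2_le_imp_le)
    have "real CARD('a) * 1 \<le> real CARD('a) * real CARD('a)" by (intro mult_left_mono) (simp_all add: Suc_leI)
    then show "(norm (eigform V (\<lambda>_. 1)))\<^sup>2 \<le> (real CARD('a))\<^sup>2"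
      unfolding norm_eigform_sq[OF V(1)] by (simp add: power2_eq_square)
    qed simp
  qed simp
  finally show ?thesis by (simp add: mult.commute)
qed

text \<open>
  Along the curve every point serves as a base point, because \<open>curve\<close> has the flow property.
\<close>

lemma curve_step_uniform:
  fixes Y R :: "real^'a^'a"
  assumes Y: "transpose Y = Y" and R: "spd R"
  defines "g \<equiv> \<lambda>t. (norm (mat_log (curve R Y t)))\<^sup>2 / 2" and "\<phi> \<equiv> \<lambda>t. mat_log (curve R Y t) \<bullet> Y"
  obtains K where "K \<ge> 0"
    "\<And>s h. \<bar>s\<bar> \<le> T \<Longrightarrow> \<bar>h\<bar> \<le> 1 \<Longrightarrow> \<bar>g (s + h) - g s - h * \<phi> s\<bar> \<le> K * h\<^sup>2"
    "\<And>s h. \<bar>s\<bar> \<le> T \<Longrightarrow> 0 \<le> h \<Longrightarrow> h \<le> 1 \<Longrightarrow> h * (norm Y)\<^sup>2 - K * h\<^sup>2 \<le> \<phi> (s + h) - \<phi> s"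
    "\<And>s h. \<bar>s\<bar> \<le> T \<Longrightarrow> 0 \<le> h \<Longrightarrow> h \<le> 1 \<Longrightarrow>
      \<phi> (s + h) - \<phi> s \<le> h * psi (sqrt (2 * g s) / sqrt 2 + h * norm Y / 2) * (norm Y)\<^sup>2 + K * h\<^sup>2"
proof -
  define B where "B = real CARD('a) * (norm (mat_log R) + T * norm Y)"
  obtain K where K: "K \<ge> 0" and st: "\<And>R t. spd R \<Longrightarrow> norm (mat_log R) \<le> B \<Longrightarrow> \<bar>t\<bar> \<le> 1 \<Longrightarrow>
    \<bar>(norm (mat_log (curve R Y t)))\<^sup>2 / 2 - (norm (mat_log R))\<^sup>2 / 2 - t * (mat_log R \<bullet> Y)\<bar> \<le> K * t\<^sup>2 \<and>
    (0 \<le> t \<longrightarrow> t * (norm Y)\<^sup>2 - K * t\<^sup>2 \<le> mat_log (curve R Y t) \<bullet> Y - mat_log R \<bullet> Y \<and>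
      mat_log (curve R Y t) \<bullet> Y - mat_log R \<bullet> Y
        \<le> t * psi (norm (mat_log R) / sqrt 2 + t * norm Y / 2) * (norm Y)\<^sup>2 + K * t\<^sup>2)"
    using curve_step[OF Y, of B] by auto
  have b: "norm (mat_log (curve R Y s)) \<le> B" if "\<bar>s\<bar> \<le> T" for s
  proof -
    have "norm (mat_log (curve R Y s)) \<le> real CARD('a) * (norm (mat_log R) + \<bar>s\<bar> * norm Y)"
      by (rule norm_log_curve_le[OF Y R])
    also have "\<dots> \<le> B" unfolding B_def using that by (intro mult_left_mono add_left_mono mult_right_mono) auto
    finally show ?thesis .
  qed
  have sg: "norm (mat_log (curve R Y s)) = sqrt (2 * g s)" for s by (simp add: g_def)
  note st' = st[OF spd_curve[OF Y R] b, unfolded curve_add[OF Y]]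
  show thesis
    by (rule that[OF K]) (use st' in \<open>simp_all add: g_def \<phi>_def\<close>)
qed

lemma curve_deriv:
  fixes Y R :: "real^'a^'a"
  assumes Y: "transpose Y = Y" and R: "spd R"
  shows "((\<lambda>t. (norm (mat_log (curve R Y t)))\<^sup>2 / 2) has_real_derivative mat_log (curve R Y s) \<bullet> Y) (at s)"
proof -
  obtain K where K: "K \<ge> 0" and st: "\<And>h. \<bar>h\<bar> \<le> 1 \<Longrightarrow> \<bar>(norm (mat_log (curve R Y (s + h))))\<^sup>2 / 2
      - (norm (mat_log (curve R Y s)))\<^sup>2 / 2 - h * (mat_log (curve R Y s) \<bullet> Y)\<bar> \<le> K * h\<^sup>2"
    by (rule curve_step_uniform[OF Y R, of "\<bar>s\<bar>"]) auto
  let ?g = "\<lambda>t. (norm (mat_log (curve R Y t)))\<^sup>2 / 2" and ?p = "mat_log (curve R Y s) \<bullet> Y"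
  have t: "((\<lambda>h. K * \<bar>h\<bar>) \<longlongrightarrow> 0) (at 0)"
    by (rule tendsto_eq_intros refl | simp)+
  have "\<forall>\<^sub>F h in at (0::real). \<bar>h\<bar> < 1 \<and> h \<noteq> 0"
    by (auto simp: eventually_at intro!: exI[of _ 1])
  then have "\<forall>\<^sub>F h in at 0. norm ((?g (s + h) - ?g s) / h - ?p) \<le> K * \<bar>h\<bar>"
  proof eventually_elim
    case (elim h)
    then have "(?g (s + h) - ?g s) / h - ?p = (?g (s + h) - ?g s - h * ?p) / h" by (simp add: field_simps)
    then have "\<bar>(?g (s + h) - ?g s) / h - ?p\<bar> = \<bar>?g (s + h) - ?g s - h * ?p\<bar> / \<bar>h\<bar>" by (simp only: abs_divide)
    also have "\<dots> \<le> K * h\<^sup>2 / \<bar>h\<bar>" using st[of h] elim by (intro divide_right_mono) auto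
    also have "\<dots> = K * \<bar>h\<bar>" using elim by (simp add: power2_eq_square abs_if)
    finally show ?case by simp
  qed
  from Lim_null_comparison[OF this t] show ?thesis
    unfolding DERIV_def by (simp add: Lim_null[of "\<lambda>h. (?g (s + h) - ?g s) / h"])
qed

text \<open>
  Nonpositive curvature: half the squared distance is 1-strongly convex along geodesics.
\<close>

lemma curve_slope_ge:
  fixes Y R :: "real^'a^'a"
  assumes Y: "transpose Y = Y" and R: "spd R" and ab: "a \<le> b"
  shows "(b - a) * (norm Y)\<^sup>2 \<le> mat_log (curve R Y b) \<bullet> Y - mat_log (curve R Y a) \<bullet> Y"
proof -
  let ?\<phi> = "\<lambda>t. mat_log (curve R Y t) \<bullet> Y"
  obtain K where K: "K \<ge> 0" and st: "\<And>s h. \<bar>s\<bar> \<le> \<bar>a\<bar> + \<bar>b\<bar> \<Longrightarrow> 0 \<le> h \<Longrightarrow> h \<le> 1 \<Longrightarrow> h * (norm Y)\<^sup>2 - K * h\<^sup>2 \<le> ?\<phi> (s + h) - ?\<phi> s"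
    by (rule curve_step_uniform[OF Y R, of "\<bar>a\<bar> + \<bar>b\<bar>"]) auto
  have "b * (norm Y)\<^sup>2 - ?\<phi> b \<le> a * (norm Y)\<^sup>2 - ?\<phi> a"
  proof (rule increments_le[OF ab, where e = "\<lambda>h. K * h"])
    show "((\<lambda>h. K * h) \<longlongrightarrow> 0) (at 0)" by (rule tendsto_eq_intros refl | simp)+
    fix u v assume uv: "a \<le> u" "u \<le> v" "v \<le> b" "v - u \<le> 1"
    then have "(v - u) * (norm Y)\<^sup>2 - K * (v - u)\<^sup>2 \<le> ?\<phi> v - ?\<phi> u" using st[of u "v - u"] by simp
    then show "v * (norm Y)\<^sup>2 - ?\<phi> v - (u * (norm Y)\<^sup>2 - ?\<phi> u) \<le> (v - u) * (K * (v - u))"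
      by (simp add: algebra_simps power2_eq_square)
  qed
  then show ?thesis by (simp add: algebra_simps)
qed

text \<open>
  Curvature bounded below: the second derivative of half the squared distance is at most
  \<open>psi (D / \<surd>2)\<close> as long as the distance is at most \<open>D\<close>.
\<close>

lemma curve_slope_le:
  fixes Y R :: "real^'a^'a"
  assumes Y: "transpose Y = Y" and R: "spd R" and ab: "a \<le> b"
    and D: "\<And>t. a \<le> t \<Longrightarrow> t \<le> b \<Longrightarrow> norm (mat_log (curve R Y t)) \<le> D"
  shows "mat_log (curve R Y b) \<bullet> Y - mat_log (curve R Y a) \<bullet> Y \<le> (b - a) * psi (D / sqrt 2) * (norm Y)\<^sup>2"
proof -
  let ?\<phi> = "\<lambda>t. mat_log (curve R Y t) \<bullet> Y" and ?L = "psi (D / sqrt 2)"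
  obtain K where K: "K \<ge> 0" and st: "\<And>s h. \<bar>s\<bar> \<le> \<bar>a\<bar> + \<bar>b\<bar> \<Longrightarrow> 0 \<le> h \<Longrightarrow> h \<le> 1 \<Longrightarrow>
      ?\<phi> (s + h) - ?\<phi> s \<le> h * psi (norm (mat_log (curve R Y s)) / sqrt 2 + h * norm Y / 2) * (norm Y)\<^sup>2 + K * h\<^sup>2"
    by (rule curve_step_uniform[OF Y R, of "\<bar>a\<bar> + \<bar>b\<bar>"]) auto
  let ?e = "\<lambda>h. (psi (D / sqrt 2 + h * norm Y / 2) - ?L) * (norm Y)\<^sup>2 + K * h"
  have "?\<phi> b - b * (?L * (norm Y)\<^sup>2) \<le> ?\<phi> a - a * (?L * (norm Y)\<^sup>2)"
  proof (rule increments_le[OF ab, where e = ?e])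
    have "((\<lambda>h. D / sqrt 2 + h * norm Y / 2) \<longlongrightarrow> D / sqrt 2 + 0 * norm Y / 2) (at 0)"
      by (intro tendsto_intros) simp
    then have "((\<lambda>h. psi (D / sqrt 2 + h * norm Y / 2)) \<longlongrightarrow> ?L) (at 0)"
      using isCont_tendsto_compose[OF isCont_psi] by simp
    then have "(?e \<longlongrightarrow> (?L - ?L) * (norm Y)\<^sup>2 + K * 0) (at 0)" by (intro tendsto_intros)
    then show "(?e \<longlongrightarrow> 0) (at 0)" by simp
    fix u v assume uv: "a \<le> u" "u \<le> v" "v \<le> b" "v - u \<le> 1"
    let ?h = "v - u"
    have "?\<phi> v - ?\<phi> u \<le> ?h * psi (norm (mat_log (curve R Y u)) / sqrt 2 + ?h * norm Y / 2) * (norm Y)\<^sup>2 + K * ?h\<^sup>2"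
      using st[of u ?h] uv by simp
    also have "\<dots> \<le> ?h * psi (D / sqrt 2 + ?h * norm Y / 2) * (norm Y)\<^sup>2 + K * ?h\<^sup>2"
      using uv D[of u] by (intro add_right_mono mult_right_mono mult_left_mono psi_mono add_mono divide_right_mono) auto
    finally have 1: "?\<phi> v - ?\<phi> u \<le> ?h * psi (D / sqrt 2 + ?h * norm Y / 2) * (norm Y)\<^sup>2 + K * ?h\<^sup>2" .
    have "?h * ?e ?h = ?h * psi (D / sqrt 2 + ?h * norm Y / 2) * (norm Y)\<^sup>2 + K * ?h\<^sup>2 - ?h * (?L * (norm Y)\<^sup>2)"
      by (simp add: algebra_simps power2_eq_square)
    then show "?\<phi> v - v * (?L * (norm Y)\<^sup>2) - (?\<phi> u - u * (?L * (norm Y)\<^sup>2)) \<le> ?h * ?e ?h"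
      using 1 by (simp only: left_diff_distrib)
  qed
  then show ?thesis by (simp add: algebra_simps)
qed

lemma curve_slope_continuous:
  fixes Y R :: "real^'a^'a"
  assumes Y: "transpose Y = Y" and R: "spd R"
  shows "isCont (\<lambda>t. mat_log (curve R Y t) \<bullet> Y) s"
proof -
  let ?\<phi> = "\<lambda>t. mat_log (curve R Y t) \<bullet> Y"
  define T where "T = \<bar>s\<bar> + 1"
  define D where "D = real CARD('a) * (norm (mat_log R) + T * norm Y)"
  define C where "C = psi (D / sqrt 2) * (norm Y)\<^sup>2"
  have D: "norm (mat_log (curve R Y t)) \<le> D" if "\<bar>t\<bar> \<le> T" for t
  proof -
    have "norm (mat_log (curve R Y t)) \<le> real CARD('a) * (norm (mat_log R) + \<bar>t\<bar> * norm Y)"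
      by (rule norm_log_curve_le[OF Y R])
    also have "\<dots> \<le> D" unfolding D_def using that by (intro mult_left_mono add_left_mono mult_right_mono) auto
    finally show ?thesis .
  qed
  have le: "0 \<le> ?\<phi> v - ?\<phi> u \<and> ?\<phi> v - ?\<phi> u \<le> C * (v - u)" if "\<bar>u\<bar> \<le> T" "\<bar>v\<bar> \<le> T" "u \<le> v" for u v
  proof
    show "0 \<le> ?\<phi> v - ?\<phi> u" using curve_slope_ge[OF Y R that(3)] that(3) by (smt (verit) mult_nonneg_nonneg zero_le_power2)
    show "?\<phi> v - ?\<phi> u \<le> C * (v - u)"
      using curve_slope_le[OF Y R that(3) D] that by (simp add: C_def mult_ac)
  qed
  have t: "((\<lambda>h. C * \<bar>h - s\<bar>) \<longlongrightarrow> 0) (at s)"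
    by (rule tendsto_eq_intros refl | simp)+
  have "\<forall>\<^sub>F h in at s. dist h s < 1" by (auto simp: eventually_at intro!: exI[of _ 1])
  then have "\<forall>\<^sub>F h in at s. norm (?\<phi> h - ?\<phi> s) \<le> C * \<bar>h - s\<bar>"
  proof eventually_elim
    case (elim h)
    then have "\<bar>h\<bar> \<le> T" "\<bar>s\<bar> \<le> T" by (auto simp: T_def dist_real_def)
    then show ?case using le[of h s] le[of s h] by (cases "h \<le> s") auto
  qed
  from Lim_null_comparison[OF this t] show ?thesis by (simp add: isCont_def Lim_null[of ?\<phi>])
qed

lemma curve_strongly_convex:
  fixes Y R :: "real^'a^'a"
  assumes Y: "transpose Y = Y" and R: "spd R"
  shows "(norm (mat_log R))\<^sup>2 / 2 + mat_log R \<bullet> Y + (norm Y)\<^sup>2 / 2 \<le> (norm (mat_log (curve R Y 1)))\<^sup>2 / 2"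
proof -
  let ?g = "\<lambda>t. (norm (mat_log (curve R Y t)))\<^sup>2 / 2" and ?\<phi> = "\<lambda>t. mat_log (curve R Y t) \<bullet> Y"
  let ?f = "\<lambda>t. ?g t - (t * ?\<phi> 0 + t\<^sup>2 / 2 * (norm Y)\<^sup>2)"
  have "?f 0 \<le> ?f 1"
  proof (rule DERIV_nonneg_imp_nondecreasing[where f = ?f])
    fix x :: real assume x: "0 \<le> x"
    have "((\<lambda>t. t * ?\<phi> 0 + t\<^sup>2 / 2 * (norm Y)\<^sup>2) has_real_derivative ?\<phi> 0 + x * (norm Y)\<^sup>2) (at x)"
      by (auto intro!: derivative_eq_intros)
    from DERIV_diff[OF curve_deriv[OF Y R] this]
    have "(?f has_real_derivative (?\<phi> x - (?\<phi> 0 + x * (norm Y)\<^sup>2))) (at x)" .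
    moreover have "0 \<le> ?\<phi> x - (?\<phi> 0 + x * (norm Y)\<^sup>2)" using curve_slope_ge[OF Y R x] by simp
    ultimately show "\<exists>y. (?f has_real_derivative y) (at x) \<and> 0 \<le> y" by blast
  qed simp
  then show ?thesis by simp
qed

text \<open>
  The bound on the second derivative is available only while the distance does not exceed \<open>D\<close>,
  which is ensured as long as the slope has been nonpositive. If the slope were positive at time \<open>1 / L\<close>, it would
  have a first zero \<open>\<tau> < 1 / L\<close>; but up to \<open>\<tau>\<close> the slope starts at \<open>- \<bar>Y\<bar>\<^sup>2\<close> and grows at a rate
  of at most \<open>L \<bar>Y\<bar>\<^sup>2\<close>.
\<close>

lemma curve_descent:
  fixes Y R :: "real^'a^'a"
  assumes Y: "transpose Y = Y" and R: "spd R" and D: "norm (mat_log R) \<le> D"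
    and grad: "mat_log R \<bullet> Y = - (norm Y)\<^sup>2"
  defines "L \<equiv> psi (D / sqrt 2)"
  shows "(norm (mat_log (curve R Y (1 / L))))\<^sup>2 / 2 \<le> (norm (mat_log R))\<^sup>2 / 2 - (norm Y)\<^sup>2 / (2 * L)"
proof -
  let ?g = "\<lambda>t. (norm (mat_log (curve R Y t)))\<^sup>2 / 2" and ?\<phi> = "\<lambda>t. mat_log (curve R Y t) \<bullet> Y"
  have L: "1 \<le> L" by (simp add: L_def psi_ge_1)
  have p0: "?\<phi> 0 = - (norm Y)\<^sup>2" using grad by simp
  have mono: "?\<phi> u \<le> ?\<phi> v" if "u \<le> v" for u v
    using curve_slope_ge[OF Y R that] that by (smt (verit) mult_nonneg_nonneg zero_le_power2)
  have slope: "?\<phi> t \<le> - (norm Y)\<^sup>2 + t * L * (norm Y)\<^sup>2" if \<tau>: "?\<phi> \<tau> \<le> 0" and t: "0 \<le> t" "t \<le> \<tau>" for t \<tau>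
  proof -
    have "norm (mat_log (curve R Y s)) \<le> D" if s: "0 \<le> s" "s \<le> t" for s
    proof -
      have "?g 0 \<ge> ?g s"
      proof (rule DERIV_nonpos_imp_nonincreasing[where f = ?g, OF s(1)])
        fix x assume "0 \<le> x" "x \<le> s"
        then have "?\<phi> x \<le> 0" using mono[of x \<tau>] \<tau> t s by linarith
        then show "\<exists>y. (?g has_real_derivative y) (at x) \<and> y \<le> 0" using curve_deriv[OF Y R] by blast
      qed
      then have "(norm (mat_log (curve R Y s)))\<^sup>2 \<le> (norm (mat_log R))\<^sup>2" by simp
      then have "norm (mat_log (curve R Y s)) \<le> norm (mat_log R)" by (rule power2_le_imp_le) simp
      then show ?thesis using D by simp
    qed
    from curve_slope_le[OF Y R t(1) this] show ?thesis using grad by (simp add: L_def)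
  qed
  have end_le: "?\<phi> (1 / L) \<le> 0"
  proof (rule ccontr)
    assume neg: "\<not> ?\<phi> (1 / L) \<le> 0"
    have "\<exists>\<tau>\<ge>0. \<tau> \<le> 1 / L \<and> ?\<phi> \<tau> = 0"
      using neg p0 L by (intro IVT) (auto intro!: curve_slope_continuous[OF Y R])
    then obtain \<tau> where \<tau>: "0 \<le> \<tau>" "\<tau> \<le> 1 / L" "?\<phi> \<tau> = 0" by blast
    then have "0 \<le> (\<tau> * L - 1) * (norm Y)\<^sup>2" using slope[of \<tau> \<tau>] by (simp add: algebra_simps)
    moreover have "(norm Y)\<^sup>2 > 0" using neg by (cases "Y = 0") auto
    moreover have "\<tau> \<noteq> 1 / L" using \<tau> neg by auto
    then have "\<tau> * L < 1" using \<tau> L by (simp add: field_simps)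
    ultimately show False by (simp add: zero_le_mult_iff)
  qed
  let ?f = "\<lambda>t. ?g t - (t\<^sup>2 / 2 * L - t) * (norm Y)\<^sup>2"
  have "?f 0 \<ge> ?f (1 / L)"
  proof (rule DERIV_nonpos_imp_nonincreasing[where f = ?f])
    fix x assume x: "0 \<le> x" "x \<le> 1 / L"
    have "((\<lambda>t. (t\<^sup>2 / 2 * L - t) * (norm Y)\<^sup>2) has_real_derivative (x * L - 1) * (norm Y)\<^sup>2) (at x)"
      by (auto intro!: derivative_eq_intros)
    from DERIV_diff[OF curve_deriv[OF Y R] this]
    have "(?f has_real_derivative (?\<phi> x - (x * L - 1) * (norm Y)\<^sup>2)) (at x)" .
    moreover have "?\<phi> x - (x * L - 1) * (norm Y)\<^sup>2 \<le> 0" using slope[OF end_le x] by (simp add: algebra_simps)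
    ultimately show "\<exists>y. (?f has_real_derivative y) (at x) \<and> y \<le> 0" by blast
  qed (use L in simp)
  moreover have "- ((1 / L)\<^sup>2 / 2 * L - 1 / L) * (norm Y)\<^sup>2 = (norm Y)\<^sup>2 / (2 * L)"
    using L by (simp add: field_simps power2_eq_square)
  moreover have "?f 0 = (norm (mat_log R))\<^sup>2 / 2" by simp
  ultimately show ?thesis by linarith
qed

text \<open>
  A geodesic from \<open>P\<close> is \<open>G G\<^sup>T\<close> with \<open>G = P\<^sup>1\<^sup>/\<^sup>2 exp (t X / 2)\<close>, and \<open>R\<close> read in the factor \<open>G\<close> moves
  along a \<open>curve\<close> with the opposite velocity.
\<close>

lemma ai_dist_along_geodesic:
  fixes P R X :: "real^'a^'a"
  assumes P: "spd P" and R: "spd R" and X: "transpose X = X"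
  defines "Z \<equiv> inv_sqrt P ** R ** inv_sqrt P"
  shows "ai_dist R (mat_sqrt P ** mat_exp (t *\<^sub>R X) ** mat_sqrt P) = norm (mat_log (curve Z (- X) t))"
    and "spd (mat_sqrt P ** mat_exp (t *\<^sub>R X) ** mat_sqrt P)"
proof -
  let ?E = "mat_exp ((t / 2) *\<^sub>R X)" and ?F = "mat_exp ((t / 2) *\<^sub>R (- X))"
  note s = inv_sqrt_spd[OF P]
  have Z: "spd Z" "mat_sqrt P ** Z ** mat_sqrt P = R" unfolding Z_def by (rule spd_pair[OF P R])+
  have sE: "transpose ?E = ?E" using X by (simp add: sym_mat_exp transpose_scalar)
  have EF: "?E ** ?F = mat 1" "?F ** ?E = mat 1"
    using mat_exp_line[OF X, of "t / 2" "- (t / 2)"] mat_exp_line[OF X, of "- (t / 2)" "t / 2"] by simp_all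
  have EE: "?E ** ?E = mat_exp (t *\<^sub>R X)" using mat_exp_line[OF X, of "t / 2" "t / 2"] by simp
  let ?G = "mat_sqrt P ** ?E" and ?H = "?F ** inv_sqrt P"
  have "?G ** ?H = mat_sqrt P ** (?E ** ?F) ** inv_sqrt P" "?H ** ?G = ?F ** (inv_sqrt P ** mat_sqrt P) ** ?E"
    by (simp_all only: matrix_mul_assoc)
  then have inv: "?G ** ?H = mat 1" "?H ** ?G = mat 1" using s EF by simp_all
  have tG: "transpose ?G = ?E ** mat_sqrt P" using sE s(6) by (simp add: matrix_transpose_mul)
  have c: "spd (curve Z (- X) t)" by (rule spd_curve[OF _ Z(1)]) (use X in \<open>simp add: vec_eq_iff transpose_def\<close>)
  have "?G ** transpose ?G = mat_sqrt P ** (?E ** ?E) ** mat_sqrt P" unfolding tG by (simp only: matrix_mul_assoc)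
  then have G1: "?G ** transpose ?G = mat_sqrt P ** mat_exp (t *\<^sub>R X) ** mat_sqrt P" by (simp only: EE)
  have "?G ** curve Z (- X) t ** transpose ?G = mat_sqrt P ** (?E ** ?F) ** Z ** (?F ** ?E) ** mat_sqrt P"
    unfolding tG curve_def by (simp only: matrix_mul_assoc)
  then have G2: "?G ** curve Z (- X) t ** transpose ?G = R" using EF Z(2) by simp
  from spd_congruence[OF spd_mat_1 inv(1)] show sp: "spd (mat_sqrt P ** mat_exp (t *\<^sub>R X) ** mat_sqrt P)" by (simp only: G1 matrix_mul_rid)
  show "ai_dist R (mat_sqrt P ** mat_exp (t *\<^sub>R X) ** mat_sqrt P) = norm (mat_log (curve Z (- X) t))"
    unfolding ai_dist_commute[OF R sp] using ai_dist_congruence[OF inv c] unfolding G1 G2 .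
qed

lemma ai_dist_strongly_convex:
  fixes P R X :: "real^'a^'a"
  assumes P: "spd P" and R: "spd R" and X: "transpose X = X"
  shows "(ai_dist R P)\<^sup>2 / 2 - mat_log (inv_sqrt P ** R ** inv_sqrt P) \<bullet> X + (norm X)\<^sup>2 / 2
    \<le> (ai_dist R (mat_sqrt P ** mat_exp X ** mat_sqrt P))\<^sup>2 / 2"
proof -
  have "transpose (- X) = - X" using X by (simp add: vec_eq_iff transpose_def)
  from curve_strongly_convex[OF this spd_pair(1)[OF P R]] show ?thesis
    using ai_dist_along_geodesic(1)[OF P R X, of 1] ai_dist_commute[OF P R] by (simp add: ai_dist_def[of P])
qed

lemma ai_dist_descent:
  fixes P R X :: "real^'a^'a"
  assumes P: "spd P" and R: "spd R" and X: "transpose X = X" and D: "ai_dist R P \<le> D"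
    and grad: "mat_log (inv_sqrt P ** R ** inv_sqrt P) \<bullet> X = (norm X)\<^sup>2"
  defines "L \<equiv> psi (D / sqrt 2)"
  shows "(ai_dist R (mat_sqrt P ** mat_exp ((1 / L) *\<^sub>R X) ** mat_sqrt P))\<^sup>2 / 2
    \<le> (ai_dist R P)\<^sup>2 / 2 - (norm X)\<^sup>2 / (2 * L)"
proof -
  have X': "transpose (- X) = - X" using X by (simp add: vec_eq_iff transpose_def)
  have n: "norm (mat_log (inv_sqrt P ** R ** inv_sqrt P)) = ai_dist R P"
    using ai_dist_commute[OF P R] by (simp add: ai_dist_def[of P])
  show ?thesis
    using curve_descent[OF X' spd_pair(1)[OF P R], of D] D grad unfolding n L_def ai_dist_along_geodesic(1)[OF P R X] by simp
qed

section \<open>Block matrices\<close>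

lemma sum_UNIV_Plus: "(\<Sum>k\<in>(UNIV :: ('m::finite + 'n::finite) set). f k) = (\<Sum>k\<in>UNIV. f (Inl k)) + (\<Sum>k\<in>UNIV. f (Inr k))"
  unfolding UNIV_Plus_UNIV[symmetric] by (subst sum.Plus) simp_all

lemma prod_UNIV_Plus: "(\<Prod>k\<in>(UNIV :: ('m::finite + 'n::finite) set). f k) = (\<Prod>k\<in>UNIV. f (Inl k)) * (\<Prod>k\<in>UNIV. f (Inr k))"
  unfolding UNIV_Plus_UNIV[symmetric] by (subst prod.Plus) simp_all

lemma forall_sum: "(\<forall>i :: 'm + 'n. P i) \<longleftrightarrow> (\<forall>a. P (Inl a)) \<and> (\<forall>b. P (Inr b))"
  by (metis sum.exhaust)

lemma block_mat_nth [simp]: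
  "block_mat X Y Z W $ Inl a $ Inl b = X $ a $ b" "block_mat X Y Z W $ Inl a $ Inr d = Y $ a $ d"
  "block_mat X Y Z W $ Inr c $ Inl b = Z $ c $ b" "block_mat X Y Z W $ Inr c $ Inr d = W $ c $ d"
  by (simp_all add: block_mat_def)

lemma block_mat_mult:
  "block_mat X Y Z W ** block_mat X' Y' Z' W' =
    block_mat (X ** X' + Y ** Z') (X ** Y' + Y ** W') (Z ** X' + W ** Z') (Z ** Y' + W ** W')"
  by (simp add: vec_eq_iff forall_sum matrix_matrix_mult_def sum_UNIV_Plus)

lemma transpose_block_mat: "transpose (block_mat X Y Z W) = block_mat (transpose X) (transpose Z) (transpose Y) (transpose W)"
  by (simp add: vec_eq_iff forall_sum transpose_def)

lemma block_mat_one: "block_mat (mat 1) 0 0 (mat 1) = mat 1"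
  by (simp add: vec_eq_iff forall_sum mat_def)

lemma block_mat_eq_iff: "block_mat X Y Z W = block_mat X' Y' Z' W' \<longleftrightarrow> X = X' \<and> Y = Y' \<and> Z = Z' \<and> W = W'"
  by (auto simp: vec_eq_iff forall_sum)

lemma block_mat_cases:
  fixes P :: "real^('m::finite + 'n::finite)^('m + 'n)"
  obtains X Y Z where "P = block_mat X Y Z (lower_right P)"
proof
  show "P = block_mat (\<chi> a b. P $ Inl a $ Inl b) (\<chi> a b. P $ Inl a $ Inr b) (\<chi> a b. P $ Inr a $ Inl b) (lower_right P)"
    by (simp add: vec_eq_iff forall_sum lower_right_def)
qed

abbreviation bdiag :: "real^'m^'m \<Rightarrow> real^'n^'n \<Rightarrow> real^('m + 'n)^('m + 'n)" where
  "bdiag X W \<equiv> block_mat X 0 0 W"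

lemma transpose_zero [simp]: "transpose (0 :: real^'b^'a) = 0"
  by (simp add: vec_eq_iff transpose_def)

lemma bdiag_mult: "bdiag X W ** bdiag X' W' = bdiag (X ** X') (W ** W')"
  by (simp add: block_mat_mult)

lemma frame_bdiag: "frame U \<Longrightarrow> frame V \<Longrightarrow> frame (bdiag U V)"
  by (simp add: frame_def transpose_block_mat block_mat_mult block_mat_one)

lemma eigform_bdiag: "eigform (bdiag U V) (case_sum f g) = bdiag (eigform U f) (eigform V g)"
proof -
  have "diagm (case_sum f g) = bdiag (diagm f) (diagm g)"
    by (simp add: vec_eq_iff forall_sum diagm_def)
  then show ?thesis by (simp add: eigform_def transpose_block_mat block_mat_mult)
qed

lemma spd_bdiag:
  fixes M :: "real^'m^'m" and W :: "real^'n^'n"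
  assumes "spd M" "spd W" shows "spd (bdiag M W)" "det (bdiag M W) = det M * det W"
proof -
  obtain U :: "real^'m^'m" and f where U: "frame U" "M = eigform U f" "\<forall>i. f i > 0" by (rule spd_spectral[OF assms(1)])
  obtain V :: "real^'n^'n" and g where V: "frame V" "W = eigform V g" "\<forall>i. g i > 0" by (rule spd_spectral[OF assms(2)])
  have e: "bdiag M W = eigform (bdiag U V) (case_sum f g)" using U V by (simp add: eigform_bdiag)
  show "spd (bdiag M W)" unfolding e using U V by (intro spd_eigform frame_bdiag) (auto split: sum.split)
  show "det (bdiag M W) = det M * det W"
    unfolding e unfolding U(2) V(2) det_eigform[OF frame_bdiag[OF U(1) V(1)] refl] det_eigform[OF U(1) refl] det_eigform[OF V(1) refl]
    by (simp add: prod_UNIV_Plus)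
qed

lemma mat_exp_bdiag:
  fixes X :: "real^'m^'m" and W :: "real^'n^'n"
  assumes "transpose X = X" "transpose W = W" shows "mat_exp (bdiag X W) = bdiag (mat_exp X) (mat_exp W)"
proof -
  obtain U :: "real^'m^'m" and f where U: "frame U" "X = eigform U f" by (rule spectral_theorem[OF assms(1)])
  obtain V :: "real^'n^'n" and g where V: "frame V" "W = eigform V g" by (rule spectral_theorem[OF assms(2)])
  have c: "(\<lambda>i. exp (case_sum f g i)) = case_sum (\<lambda>i. exp (f i)) (\<lambda>i. exp (g i))" by (auto split: sum.split)
  show ?thesis unfolding U(2) V(2) mat_exp_eigform[OF U(1)] mat_exp_eigform[OF V(1)]
      eigform_bdiag[symmetric] mat_exp_eigform[OF frame_bdiag[OF U(1) V(1)]] c ..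
qed

lemma mat_log_bdiag:
  fixes X :: "real^'m^'m" and W :: "real^'n^'n"
  assumes "spd X" "spd W" shows "mat_log (bdiag X W) = bdiag (mat_log X) (mat_log W)"
  using spd_log[OF assms(1)] spd_log[OF assms(2)]
  by (intro mat_log_unique) (simp_all add: transpose_block_mat mat_exp_bdiag)

lemma mat_sqrt_bdiag:
  fixes X :: "real^'m^'m" and W :: "real^'n^'n"
  assumes "spd X" "spd W" shows "mat_sqrt (bdiag X W) = bdiag (mat_sqrt X) (mat_sqrt W)"
  using spd_mat_sqrt[OF assms(1)] spd_mat_sqrt[OF assms(2)]
  by (intro mat_sqrt_unique) (simp_all add: spd_bdiag bdiag_mult)

lemma spd_scaleR: "spd W \<Longrightarrow> c > 0 \<Longrightarrow> spd (c *\<^sub>R W)"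
  by (simp add: spd_def transpose_scalar scaleR_matrix_vector_assoc[symmetric])

lemma mat_sqrt_scaleR: assumes "spd W" "c > 0" shows "mat_sqrt (c *\<^sub>R W) = sqrt c *\<^sub>R mat_sqrt W"
  using spd_mat_sqrt[OF assms(1)] assms
  by (intro mat_sqrt_unique) (simp_all add: spd_scaleR matrix_scale_left matrix_scale_right)

lemma inner_bdiag: "A \<bullet> bdiag 0 X = lower_right A \<bullet> X"
  by (simp add: inner_matrix sum_UNIV_Plus lower_right_def)

lemma norm_bdiag: "norm (bdiag (0 :: real^'m^'m) X) = norm X"
proof -
  have "lower_right (bdiag (0 :: real^'m^'m) X) = X" by (simp add: vec_eq_iff lower_right_def)
  then show ?thesis using inner_bdiag[of "bdiag (0 :: real^'m^'m) X" X] by (simp add: norm_eq_sqrt_inner)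
qed

text \<open>
  Conjugation by \<open>diag (1, -1)\<close> turns \<open>L T\<close> into its inverse \<open>L (- T)\<close>, so both have the same
  determinant. This avoids ordering the index types.
\<close>

lemma det_unit_lower_block:
  fixes T :: "real^'m^'n"
  defines "L \<equiv> \<lambda>T :: real^'m^'n. block_mat (mat 1) 0 T (mat 1)"
  shows "det (L T) * det (L T) = 1"
proof -
  let ?J = "bdiag (mat 1 :: real^'m^'m) (- mat 1 :: real^'n^'n)"
  have m: "- mat 1 ** X = - X" "X ** (- mat 1) = - X" for X :: "real^'p^'q"
    by (simp_all add: vec_eq_iff matrix_matrix_mult_def mat_def if_distrib[of "\<lambda>x. - x"] if_distrib[of "\<lambda>x. x * _"] if_distrib[of "\<lambda>x. _ * x"]
      sum.delta sum.delta' cong: if_cong)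
  have "?J ** ?J = mat 1" by (simp add: bdiag_mult m block_mat_one)
  then have J: "det ?J * det ?J = 1" by (simp flip: det_mul)
  have "?J ** L T ** ?J = L (- T)" by (simp add: L_def block_mat_mult m)
  then have "det (L (- T)) = det ?J * det (L T) * det ?J" by (simp flip: det_mul)
  also have "\<dots> = det (L T) * (det ?J * det ?J)" by (simp only: mult_ac)
  finally have "det (L (- T)) = det (L T)" using J by simp
  moreover have "L T ** L (- T) = mat 1" by (simp add: L_def block_mat_mult block_mat_one)
  then have "det (L T) * det (L (- T)) = 1" by (simp flip: det_mul)
  ultimately show ?thesis by simp
qed

lemma det_scaleR: "det (c *\<^sub>R W) = c ^ CARD('a) * det W" for W :: "real^'a^'a"
proof -
  have "c *\<^sub>R W = diagm (\<lambda>_. c) ** W" by (simp add: vec_eq_iff diagm_mult_nth)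
  moreover have "det (diagm (\<lambda>_::'a. c)) = c ^ CARD('a)" by (subst det_diagonal) (simp_all add: diagm_def)
  ultimately show ?thesis by (simp add: det_mul)
qed

definition block_col :: "real^'k^'m \<Rightarrow> real^'k^'n \<Rightarrow> real^'k^('m + 'n)" where
  "block_col X Z = (\<chi> i j. case i of Inl a \<Rightarrow> X $ a $ j | Inr b \<Rightarrow> Z $ b $ j)"

lemma block_mat_mult_col:
  fixes X :: "real^'m^'m" and Y :: "real^'n^'m" and Z :: "real^'m^'n" and W :: "real^'n^'n"
  shows "block_mat X Y Z W ** block_col X' Z' = block_col (X ** X' + Y ** Z') (Z ** X' + W ** Z')"
  by (simp add: vec_eq_iff forall_sum matrix_matrix_mult_def sum_UNIV_Plus block_col_def)

lemma append_cols_mult_col: 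
  fixes U :: "real^'m^'d" and V :: "real^'n^'d"
  shows "append_cols U V ** block_col X Z = U ** X + V ** Z"
  by (simp add: vec_eq_iff matrix_matrix_mult_def sum_UNIV_Plus block_col_def append_cols_def)

lemma transpose_append_cols_mult: 
  fixes U :: "real^'m^'d" and V :: "real^'n^'d"
  shows "transpose (append_cols U V) ** Y = block_col (transpose U ** Y) (transpose V ** Y)"
  by (simp add: vec_eq_iff forall_sum matrix_matrix_mult_def block_col_def append_cols_def transpose_def)

lemma block_col_eq_iff: "block_col X Z = block_col X' Z' \<longleftrightarrow> X = X' \<and> Z = Z'"
  by (auto simp: vec_eq_iff forall_sum block_col_def)

lemma append_cols_gram:
  fixes U :: "real^'m^'d" and V :: "real^'n^'d"
  shows "transpose (append_cols U V) ** append_cols U V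
    = block_mat (transpose U ** U) (transpose U ** V) (transpose V ** U) (transpose V ** V)"
  by (simp add: vec_eq_iff forall_sum matrix_matrix_mult_def append_cols_def transpose_def)

section \<open>Geodesics of unit determinant\<close>

lemma traceless_props:
  fixes X :: "real^'n^'n"
  shows "trace (traceless X) = 0" "transpose X = X \<Longrightarrow> transpose (traceless X) = traceless X"
    "trace Y = 0 \<Longrightarrow> traceless X \<bullet> Y = X \<bullet> Y"
proof -
  show "trace (traceless X) = 0"
    by (simp add: traceless_def trace_def mat_def sum_subtractf)
  show "transpose (traceless X) = traceless X" if "transpose X = X"
    using that by (simp add: traceless_def vec_eq_iff transpose_def mat_def)
  have "(mat 1 :: real^'n^'n) \<bullet> Y = trace Y" by (simp add: inner_matrix_trace)
  then show "traceless X \<bullet> Y = X \<bullet> Y" if "trace Y = 0"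
    using that by (simp add: traceless_def inner_diff_left)
qed

lemma SPD1_geodesic:
  fixes S X :: "real^'n^'n"
  assumes "S \<in> SPD1" "transpose X = X" "trace X = 0"
  shows "mat_sqrt S ** mat_exp X ** mat_sqrt S \<in> SPD1"
proof -
  have S: "spd S" "det S = 1" using assms by (auto simp: SPD1_def)
  note s = inv_sqrt_spd[OF S(1)]
  have "spd (mat_sqrt S ** mat_exp X ** mat_sqrt S)"
    using spd_congruence[OF spd_exp[OF assms(2)] s(2)] s(6) by simp
  moreover have "det (mat_sqrt S) * det (mat_sqrt S) = 1" using spd_mat_sqrt(2)[OF S(1)] S(2) by (simp flip: det_mul)
  then have "det (mat_sqrt S ** mat_exp X ** mat_sqrt S) = 1"
    using det_mat_exp[OF assms(2)] assms(3) by (simp add: det_mul)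
  ultimately show ?thesis by (simp add: SPD1_def)
qed

lemma SPD1_pair:
  fixes S S' :: "real^'n^'n"
  assumes "S \<in> SPD1" "S' \<in> SPD1"
  obtains X where "transpose X = X" "trace X = 0" "S' = mat_sqrt S ** mat_exp X ** mat_sqrt S" "norm X = ai_dist S S'"
proof
  have S: "spd S" "det S = 1" "spd S'" "det S' = 1" using assms by (auto simp: SPD1_def)
  note s = inv_sqrt_spd[OF S(1)]
  let ?Z = "inv_sqrt S ** S' ** inv_sqrt S"
  note Z = spd_pair[OF S(1,3)]
  have "det (inv_sqrt S) * (det S) * det (inv_sqrt S) = 1" using s(4) by (metis det_I det_mul)
  then have "det ?Z = 1" using S by (simp add: det_mul)
  then show "trace (mat_log ?Z) = 0" using trace_mat_log[OF Z(1)] by simp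
  show "transpose (mat_log ?Z) = mat_log ?Z" by (rule spd_log[OF Z(1)])
  show "S' = mat_sqrt S ** mat_exp (mat_log ?Z) ** mat_sqrt S" using Z spd_log(2)[OF Z(1)] by simp
  show "norm (mat_log ?Z) = ai_dist S S'" by (simp add: ai_dist_def)
qed

section \<open>The hidden coordinate of the fiber\<close>

locale controller_problem =
  fixes A U B :: "real^'m^'d" and C :: "real^'m^'m" and V :: "real^'n^'d"
  assumes data: "problem_data A U C V B"
    and card: "CARD('d) = CARD('m) + CARD('n)"
begin

abbreviation "Q \<equiv> append_cols U V"
abbreviation "M \<equiv> blk_M A C B"
abbreviation "L \<equiv> blk_L A C V B"
abbreviation "R \<equiv> R0 A C V B"
abbreviation QQ :: "real^'n^'n \<Rightarrow> real^('m + 'n)^('m + 'n)" where "QQ \<equiv> Qcal A C B"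
abbreviation "PP \<equiv> Phi A U C V B"
abbreviation "f \<equiv> cost A C V B"
abbreviation "res \<equiv> residual A C V B"

definition "rho = det M powr (- 1 / real CARD('n))"
text \<open>
  The matrix \<open>X0 = B C\<^sup>-\<^sup>1\<close> is the image of \<open>U\<close> under every element of the fiber; in the coordinates
  given by \<open>[U, V]\<close> its blocks are \<open>M\<close> and \<open>N\<close>.
\<close>

definition "X0 = B ** matrix_inv C"
definition "Linv = block_mat (mat 1) 0 (- blk_T A C V B) (mat 1)"

lemma frame_Q: "frame Q" using data by (simp add: problem_data_def frame_def)

lemma Cinv: "C ** matrix_inv C = mat 1" "matrix_inv C ** C = mat 1"
proof -
  obtain D where "C ** D = mat 1" "D ** C = mat 1" using data by (auto simp: problem_data_def invertible_def)
  then show "C ** matrix_inv C = mat 1" "matrix_inv C ** C = mat 1" by (simp_all add: matrix_inv_eqI)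
qed

lemma A_eq: "A = U ** C" using data by (simp add: problem_data_def)

lemma gram: "transpose U ** U = mat 1" "transpose U ** V = 0" "transpose V ** U = 0" "transpose V ** V = mat 1"
proof -
  have "block_mat (transpose U ** U) (transpose U ** V) (transpose V ** U) (transpose V ** V) = block_mat (mat 1) 0 0 (mat 1)"
    using frame_Q unfolding frame_def append_cols_gram block_mat_one by simp
  then show "transpose U ** U = mat 1" "transpose U ** V = 0" "transpose V ** U = 0" "transpose V ** V = mat 1"
    by (simp_all add: block_mat_eq_iff)
qed

lemma U_via_A: "transpose (matrix_inv C) ** transpose A = transpose U"
proof -
  have "A ** matrix_inv C = U ** (C ** matrix_inv C)" by (simp only: A_eq matrix_mul_assoc)
  then have "A ** matrix_inv C = U" using Cinv by simp
  then show ?thesis by (metis matrix_transpose_mul)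
qed

lemma M_eq: "M = transpose U ** X0" by (simp add: blk_M_def X0_def U_via_A matrix_mul_assoc)

lemma spd_M: "spd M"
proof -
  have "B \<in> admissible A" using data unfolding problem_data_def by blast
  then have "spd (transpose A ** B)" by (simp add: admissible_def)
  moreover have "transpose (matrix_inv C) ** transpose C = mat 1" using Cinv by (metis matrix_transpose_mul transpose_mat)
  ultimately have "spd (transpose (matrix_inv C) ** (transpose A ** B) ** transpose (transpose (matrix_inv C)))"
    by (rule spd_congruence)
  then show ?thesis by (simp add: blk_M_def matrix_mul_assoc)
qed

lemma M_inv: "matrix_inv M ** M = mat 1" by (rule spd_inverse[OF spd_M])

lemma T_M: "blk_T A C V B ** M = transpose V ** X0"
proof -
  have "blk_T A C V B ** M = blk_N C V B ** (matrix_inv M ** M)" by (simp only: blk_T_def matrix_mul_assoc)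
  then show ?thesis using M_inv by (simp add: blk_N_def X0_def matrix_mul_assoc)
qed

lemma rho: "rho > 0" "rho ^ CARD('n) * det M = 1"
proof -
  have d: "det M > 0" by (rule det_spd_pos[OF spd_M])
  then show "rho > 0" by (simp add: rho_def)
  have "rho ^ CARD('n) = rho powr real CARD('n)" using \<open>rho > 0\<close> by (simp add: powr_realpow)
  also have "\<dots> = det M powr (- 1)" unfolding rho_def powr_powr by simp
  finally show "rho ^ CARD('n) * det M = 1" using d by (simp add: powr_minus)
qed

lemma Qcal_eq: "QQ S = bdiag M (rho *\<^sub>R S)" by (simp add: Qcal_def rho_def Let_def)

lemma spd_Qcal: "spd S \<Longrightarrow> spd (QQ S)"
  unfolding Qcal_eq by (intro spd_bdiag spd_M spd_scaleR rho)

lemma det_Qcal: "spd S \<Longrightarrow> det (QQ S) = det S"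
  unfolding Qcal_eq using rho spd_bdiag(2)[OF spd_M spd_scaleR[of S rho]]
  by (simp add: det_scaleR mult.commute[of "det M"])

lemma L_inv: "L ** Linv = mat 1" "Linv ** L = mat 1"
  by (simp_all add: blk_L_def Linv_def block_mat_mult block_mat_one)

lemma R_eq: "R = Linv ** transpose Linv"
proof -
  have "transpose L ** transpose Linv = mat 1" "transpose Linv ** transpose L = mat 1"
    using L_inv by (metis matrix_transpose_mul transpose_mat)+
  then show ?thesis using L_inv by (simp add: R0_def matrix_inv_eqI)
qed

lemma spd_R: "spd R"
  using spd_congruence[OF spd_mat_1 L_inv(2)] by (simp add: R_eq)

lemma G_inv: "Q ** L ** (Linv ** transpose Q) = mat 1" "Linv ** transpose Q ** (Q ** L) = mat 1"
proof -
  have "Q ** L ** (Linv ** transpose Q) = Q ** (L ** Linv) ** transpose Q"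
    "Linv ** transpose Q ** (Q ** L) = Linv ** (transpose Q ** Q) ** L" by (simp_all only: matrix_mul_assoc)
  then show "Q ** L ** (Linv ** transpose Q) = mat 1" "Linv ** transpose Q ** (Q ** L) = mat 1"
    using L_inv frame_Q by (simp_all add: frame_cancel)
qed

lemma Phi_eq: "PP S = (Q ** L) ** QQ S ** transpose (Q ** L)"
  by (simp add: Phi_def Let_def matrix_transpose_mul matrix_mul_assoc)

lemma spd_Phi: "spd S \<Longrightarrow> spd (PP S)"
  unfolding Phi_eq by (intro spd_congruence[OF _ G_inv(1)] spd_Qcal)

lemma ai_dist_Phi_one: assumes "spd S" shows "ai_dist (mat 1) (PP S) = ai_dist R (QQ S)"
proof -
  have "(Q ** L) ** R ** transpose (Q ** L) = Q ** (L ** Linv) ** transpose (L ** Linv) ** transpose Q"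
    by (simp only: R_eq matrix_mul_assoc matrix_transpose_mul)
  then have "(Q ** L) ** R ** transpose (Q ** L) = mat 1" using L_inv frame_Q by (simp add: frame_cancel)
  then show ?thesis using ai_dist_invariant[OF G_inv spd_R spd_Qcal[OF assms]] by (simp add: Phi_eq)
qed

text \<open>
  The first block is common to both arguments and contributes nothing, and the scaling by \<open>rho\<close>
  is a congruence.
\<close>

lemma ai_dist_Qcal: assumes "spd S" "spd S'" shows "ai_dist (QQ S) (QQ S') = ai_dist S S'"
proof -
  note m = inv_sqrt_spd[OF spd_M] and s = inv_sqrt_spd[OF assms(1)]
  note Z = spd_pair[OF assms]
  let ?Z = "inv_sqrt S ** S' ** inv_sqrt S"
  let ?G = "bdiag (mat_sqrt M) (sqrt rho *\<^sub>R mat_sqrt S)" and ?H = "bdiag (inv_sqrt M) ((1 / sqrt rho) *\<^sub>R inv_sqrt S)"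
  have r: "sqrt rho \<noteq> 0" "sqrt rho * sqrt rho = rho" using rho by simp_all
  have inv: "?G ** ?H = mat 1" "?H ** ?G = mat 1"
    using r m s by (simp_all add: bdiag_mult matrix_scale_left matrix_scale_right block_mat_one)
  have t: "transpose ?G = ?G" using m s by (simp add: transpose_block_mat transpose_scalar)
  have "?G ** ?G = QQ S" "?G ** bdiag (mat 1) ?Z ** ?G = QQ S'"
    using r Z(2) spd_mat_sqrt(2)[OF spd_M] spd_mat_sqrt(2)[OF assms(1)]
    by (simp_all add: Qcal_eq bdiag_mult matrix_scale_left matrix_scale_right)
  moreover have "spd (bdiag (mat 1 :: real^'m^'m) ?Z)" by (intro spd_bdiag spd_mat_1 Z)
  ultimately have "ai_dist (QQ S) (QQ S') = norm (mat_log (bdiag (mat 1 :: real^'m^'m) ?Z))"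
    using ai_dist_congruence[OF inv, of "bdiag (mat 1) ?Z"] t by simp
  also have "mat_log (mat 1 :: real^'m^'m) = 0"
    using mat_log_exp[of "0 :: real^'m^'m"] by simp
  then have "mat_log (bdiag (mat 1 :: real^'m^'m) ?Z) = bdiag 0 (mat_log ?Z)"
    by (simp add: mat_log_bdiag[OF spd_mat_1 Z(1)])
  finally show ?thesis by (simp add: norm_bdiag ai_dist_def)
qed

lemma ai_dist_Phi: "spd S \<Longrightarrow> spd S' \<Longrightarrow> ai_dist (PP S) (PP S') = ai_dist S S'"
  unfolding Phi_eq using ai_dist_invariant[OF G_inv spd_Qcal spd_Qcal] ai_dist_Qcal by simp

lemma det_Phi: assumes "spd S" shows "det (PP S) = det S"
proof -
  have "PP S = Q ** (L ** QQ S ** transpose L) ** transpose Q" by (simp add: Phi_eq matrix_transpose_mul matrix_mul_assoc)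
  moreover have "spd (L ** QQ S ** transpose L)" by (rule spd_congruence[OF spd_Qcal[OF assms] L_inv(1)])
  ultimately have "det (PP S) = det (L ** QQ S ** transpose L)"
    using det_frame_conj[OF frame_Q] card by (simp add: spd_def)
  also have "\<dots> = (det L * det L) * det (QQ S)" by (simp add: det_mul)
  also have "det L * det L = 1" unfolding blk_L_def by (rule det_unit_lower_block)
  finally show ?thesis using det_Qcal[OF assms] by simp
qed

lemma P_A_eq_B_iff: "P ** A = B \<longleftrightarrow> P ** U = X0"
proof
  assume "P ** A = B"
  then have "X0 = P ** U ** (C ** matrix_inv C)" unfolding X0_def A_eq by (metis matrix_mul_assoc)
  then show "P ** U = X0" using Cinv by simp
next
  assume "P ** U = X0"
  then have "P ** A = B ** (matrix_inv C ** C)" unfolding X0_def A_eq by (metis matrix_mul_assoc)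
  then show "P ** A = B" using Cinv by simp
qed

lemma cols:
  "transpose (Q ** L) ** U = block_col (mat 1) 0" "Q ** L ** block_col M 0 = X0"
  "transpose (Linv ** transpose Q) ** block_col (mat 1) 0 = U" "Linv ** transpose Q ** X0 = block_col M 0"
proof -
  have "transpose (Q ** L) ** U = transpose L ** (transpose Q ** U)" by (simp add: matrix_transpose_mul matrix_mul_assoc)
  then show "transpose (Q ** L) ** U = block_col (mat 1) 0"
    by (simp add: transpose_append_cols_mult gram blk_L_def transpose_block_mat block_mat_mult_col)
  have QX: "transpose Q ** X0 = block_col M (transpose V ** X0)" by (simp add: transpose_append_cols_mult M_eq)
  have "Q ** L ** block_col M 0 = Q ** (L ** block_col M 0)" by (simp only: matrix_mul_assoc)
  also have "L ** block_col M 0 = transpose Q ** X0" by (simp add: QX blk_L_def block_mat_mult_col T_M)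
  finally show "Q ** L ** block_col M 0 = X0" using frame_Q by (simp add: matrix_mul_assoc frame_cancel)
  have "transpose (Linv ** transpose Q) ** block_col (mat 1) 0 = Q ** (transpose Linv ** block_col (mat 1) 0)"
    by (simp only: matrix_transpose_mul transpose_transpose matrix_mul_assoc)
  also have "transpose Linv ** block_col (mat 1) 0 = block_col (mat 1) 0"
    by (simp add: Linv_def transpose_block_mat block_mat_mult_col)
  finally show "transpose (Linv ** transpose Q) ** block_col (mat 1) 0 = U" by (simp add: append_cols_mult_col)
  have "Linv ** transpose Q ** X0 = Linv ** (transpose Q ** X0)" by (simp only: matrix_mul_assoc)
  moreover have "- blk_T A C V B ** M = - (transpose V ** X0)"
    unfolding T_M[symmetric] by (simp add: vec_eq_iff matrix_matrix_mult_def sum_negf)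
  ultimately show "Linv ** transpose Q ** X0 = block_col M 0" by (simp add: QX Linv_def block_mat_mult_col)
qed

lemma Phi_in_fiber: assumes "S \<in> SPD1" shows "PP S \<in> fiber A B"
proof -
  have S: "spd S" "det S = 1" using assms by (auto simp: SPD1_def)
  have "PP S ** U = (Q ** L) ** (QQ S ** (transpose (Q ** L) ** U))" by (simp only: Phi_eq matrix_mul_assoc)
  also have "\<dots> = X0" unfolding cols(1) by (simp add: Qcal_eq block_mat_mult_col cols(2))
  finally have "PP S ** A = B" by (simp add: P_A_eq_B_iff)
  then show ?thesis using S spd_Phi det_Phi by (simp add: fiber_def SPD1_def)
qed

text \<open>
  Transported by the inverse of \<open>Q L\<close>, the equation \<open>P U = X0\<close> says that the first block column
  is that of \<open>diag (M, _)\<close>; symmetry clears the other off-diagonal block.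
\<close>

lemma fiber_imp_Phi: assumes "P \<in> fiber A B" obtains S where "S \<in> SPD1" "P = PP S"
proof -
  have P: "spd P" "det P = 1" "P ** U = X0" using assms by (auto simp: fiber_def SPD1_def P_A_eq_B_iff)
  let ?H = "Linv ** transpose Q"
  define P' where "P' = ?H ** P ** transpose ?H"
  have spd': "spd P'" unfolding P'_def by (rule spd_congruence[OF P(1) G_inv(2)])
  obtain X Y Z where e: "P' = block_mat X Y Z (lower_right P')" by (rule block_mat_cases)
  have "P' ** block_col (mat 1) 0 = ?H ** (P ** (transpose ?H ** block_col (mat 1) 0))"
    by (simp only: P'_def matrix_mul_assoc)
  then have "P' ** block_col (mat 1) 0 = block_col M 0" by (simp only: cols P)
  then have "block_mat X Y Z (lower_right P') ** block_col (mat 1) 0 = block_col M 0" using e by simp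
  then have XZ: "X = M" "Z = 0" by (simp_all add: block_mat_mult_col block_col_eq_iff)
  have "transpose P' = P'" using spd' by (simp add: spd_def)
  then have "transpose (block_mat X Y Z (lower_right P')) = block_mat X Y Z (lower_right P')" using e by simp
  then have "transpose Y = 0" using XZ by (simp add: transpose_block_mat block_mat_eq_iff)
  then have "Y = 0" by (metis transpose_transpose transpose_zero)
  then have P'_eq: "P' = bdiag M (lower_right P')" using e XZ by simp
  define S where "S = (1 / rho) *\<^sub>R lower_right P'"
  have spdW: "spd (lower_right P')"
    unfolding spd_def
  proof (intro conjI allI impI)
    show "transpose (lower_right P') = lower_right P'"
      using \<open>transpose P' = P'\<close> by (simp add: vec_eq_iff transpose_def lower_right_def)
    fix x :: "real^'n" assume "x \<noteq> 0"
    define z :: "real^('m + 'n)" where "z = (\<chi> i. case i of Inl a \<Rightarrow> 0 | Inr b \<Rightarrow> x $ b)"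
    have "z \<noteq> 0" using \<open>x \<noteq> 0\<close> by (auto simp: z_def vec_eq_iff forall_sum)
    then have "0 < z \<bullet> (P' *v z)" using spd' by (simp add: spd_def)
    also have "\<dots> = x \<bullet> (lower_right P' *v x)"
      by (simp add: z_def inner_vec_def matrix_vector_mult_def sum_UNIV_Plus lower_right_def)
    finally show "0 < x \<bullet> (lower_right P' *v x)" .
  qed
  have spdS: "spd S" unfolding S_def using spdW rho by (intro spd_scaleR) auto
  have "QQ S = P'" unfolding Qcal_eq S_def using rho(1) P'_eq by simp
  moreover have "(Q ** L) ** P' ** transpose (Q ** L) = (Q ** L ** ?H) ** P ** transpose (Q ** L ** ?H)"
    by (simp only: P'_def matrix_mul_assoc matrix_transpose_mul)
  ultimately have PS: "P = PP S" by (simp add: Phi_eq G_inv)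
  then have "det S = 1" using P det_Phi[OF spdS] by simp
  then show ?thesis using that[of S] spdS PS by (simp add: SPD1_def)
qed

section \<open>The cost and its residual\<close>

lemma cost_eq: "f S = (ai_dist R (QQ S))\<^sup>2 / 2" by (simp add: cost_def)

lemma cost_nonneg: "0 \<le> f S" by (simp add: cost_eq)

lemma residual_props:
  assumes "S \<in> SPD1"
  shows "trace (res S) = 0" "transpose (res S) = res S"
proof -
  have S: "spd S" using assms by (simp add: SPD1_def)
  show "trace (res S) = 0" by (simp add: residual_def traceless_props)
  have "transpose (Rcal A C V B S) = Rcal A C V B S"
    unfolding Rcal_def by (rule spd_log(1)[OF spd_pair(1)[OF spd_Qcal[OF S] spd_R]])
  then have "transpose (lower_right (Rcal A C V B S)) = lower_right (Rcal A C V B S)"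
    by (simp add: vec_eq_iff transpose_def lower_right_def)
  then show "transpose (res S) = res S" by (simp add: residual_def traceless_props)
qed

text \<open>
  The residual is the part of the logarithm that is seen by traceless directions in the second
  block, i.e. by the tangent space of the hidden coordinate.
\<close>

lemma residual_inner: assumes "trace X = 0" shows "Rcal A C V B S \<bullet> bdiag 0 X = res S \<bullet> X"
  using assms by (simp add: inner_bdiag residual_def traceless_props)

lemma Qcal_geodesic:
  assumes "S \<in> SPD1" "transpose X = X"
  shows "QQ (mat_sqrt S ** mat_exp X ** mat_sqrt S) = mat_sqrt (QQ S) ** mat_exp (bdiag 0 X) ** mat_sqrt (QQ S)"
proof -
  have S: "spd S" using assms by (simp add: SPD1_def)
  have r: "sqrt rho * sqrt rho = rho" using rho by simp
  show ?thesis
    using assms(2) spd_mat_sqrt(2)[OF spd_M] r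
    by (simp add: Qcal_eq mat_sqrt_bdiag spd_M spd_scaleR S rho mat_sqrt_scaleR mat_exp_bdiag bdiag_mult
        matrix_scale_left matrix_scale_right)
qed

lemma cost_strongly_convex:
  assumes S: "S \<in> SPD1" and X: "transpose X = X" "trace X = 0"
  shows "f S - res S \<bullet> X + (norm X)\<^sup>2 / 2 \<le> f (mat_sqrt S ** mat_exp X ** mat_sqrt S)"
proof -
  have "spd S" using S by (simp add: SPD1_def)
  have "transpose (bdiag (0 :: real^'m^'m) X) = bdiag 0 X" using X by (simp add: transpose_block_mat)
  from ai_dist_strongly_convex[OF spd_Qcal[OF \<open>spd S\<close>] spd_R this]
  show ?thesis
    by (simp add: cost_eq Qcal_geodesic[OF S X(1)] norm_bdiag flip: Rcal_def) (simp add: residual_inner[OF X(2)])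
qed

lemma cost_descent:
  assumes S: "S \<in> SPD1" and D: "ai_dist R (QQ S) \<le> D"
  defines "c \<equiv> psi (D / sqrt 2)"
  shows "f (mat_sqrt S ** mat_exp ((1 / c) *\<^sub>R res S) ** mat_sqrt S) \<le> f S - 1 / (2 * c) * (norm (res S))\<^sup>2"
    "mat_sqrt S ** mat_exp ((1 / c) *\<^sub>R res S) ** mat_sqrt S \<in> SPD1"
proof -
  have "spd S" using S by (simp add: SPD1_def)
  note p = residual_props[OF S]
  let ?X = "bdiag (0 :: real^'m^'m) (res S)"
  have t: "transpose ?X = ?X" using p by (simp add: transpose_block_mat)
  have g: "mat_log (inv_sqrt (QQ S) ** R ** inv_sqrt (QQ S)) \<bullet> ?X = (norm ?X)\<^sup>2"
    unfolding Rcal_def[symmetric] residual_inner[OF p(1)] norm_bdiag by (simp add: power2_norm_eq_inner)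
  have q: "transpose ((1 / c) *\<^sub>R res S) = (1 / c) *\<^sub>R res S" "trace ((1 / c) *\<^sub>R res S) = 0"
    using p by (simp add: transpose_scalar) (use p in \<open>simp add: trace_def flip: sum_divide_distrib\<close>)
  have s: "(1 / c) *\<^sub>R ?X = bdiag 0 ((1 / c) *\<^sub>R res S)" by (simp add: vec_eq_iff forall_sum)
  show "f (mat_sqrt S ** mat_exp ((1 / c) *\<^sub>R res S) ** mat_sqrt S) \<le> f S - 1 / (2 * c) * (norm (res S))\<^sup>2"
    using ai_dist_descent[OF spd_Qcal[OF \<open>spd S\<close>] spd_R t D g]
    unfolding c_def[symmetric] s norm_bdiag cost_eq Qcal_geodesic[OF S q(1)] by simp
  show "mat_sqrt S ** mat_exp ((1 / c) *\<^sub>R res S) ** mat_sqrt S \<in> SPD1"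
    by (rule SPD1_geodesic[OF S q])
qed

section \<open>The canonical controller\<close>

text \<open>
  In logarithmic coordinates the fiber within a closed ball is compact, and the objective is the
  norm. Determinant one becomes the linear condition that the trace vanishes.
\<close>

lemma exists_minimizer: "\<exists>S\<in>SPD1. \<forall>S'\<in>SPD1. f S \<le> f S'"
proof -
  have one: "(mat 1 :: real^'n^'n) \<in> SPD1" by (simp add: SPD1_def spd_mat_1)
  have ai1: "ai_dist (mat 1) P = norm (mat_log P)" if "spd P" for P :: "real^'d^'d"
    using ai_dist_congruence[of "mat 1" "mat 1" P] that by simp
  have fP: "f S = (norm (mat_log (PP S)))\<^sup>2 / 2" if "S \<in> SPD1" for S
    using that ai_dist_Phi_one[of S] ai1[OF spd_Phi[of S]] by (simp add: SPD1_def cost_eq)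
  define D where "D = norm (mat_log (PP (mat 1)))"
  define K0 where "K0 = {S :: real^'d^'d. transpose S - S = 0} \<inter> {S. trace S = 0} \<inter> cball 0 D"
  define K where "K = K0 \<inter> mat_exp -` {P. P ** A = B}"
  have lin: "linear (\<lambda>S :: real^'d^'d. transpose S - S)" "linear (trace :: real^'d^'d \<Rightarrow> real)" "linear (\<lambda>P :: real^'d^'d. P ** A)"
    by (auto intro!: linearI simp: vec_eq_iff transpose_def trace_def matrix_mult_nth sum.distrib sum_distrib_left algebra_simps)
  have cont: "continuous_on UNIV g" if "linear g" for g :: "real^'d^'d \<Rightarrow> 'z :: real_normed_vector"
    using that by (simp add: linear_continuous_on linear_conv_bounded_linear)
  have "closed {S :: real^'d^'d. transpose S - S = 0}" "closed {S :: real^'d^'d. trace S = 0}" "closed {P. P ** A = B}"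
    by (intro closed_Collect_eq cont lin continuous_on_const)+
  note cl = this
  then have cK0: "closed K0" unfolding K0_def by (intro closed_Int) auto
  have K0D: "S \<in> K0 \<Longrightarrow> transpose S = S \<and> norm S \<le> D \<and> trace S = 0" for S
    by (auto simp: K0_def)
  have "(exp D)-lipschitz_on K0 mat_exp"
  proof (rule lipschitz_onI)
    fix S T assume "S \<in> K0" "T \<in> K0"
    then show "dist (mat_exp S) (mat_exp T) \<le> exp D * dist S T"
      unfolding dist_norm using K0D[of S] K0D[of T] by (intro norm_mat_exp_diff_le) blast+
  qed simp
  then have "continuous_on K0 mat_exp" by (rule lipschitz_on_continuous_on)
  then have "closed K" unfolding K_def using cK0 cl by (intro continuous_closed_preimage)
  moreover have "bounded K" by (rule bounded_subset[of "cball 0 D"]) (auto simp: K_def K0_def)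
  ultimately have "compact K" by (simp add: compact_eq_bounded_closed)
  have inK: "mat_log (PP S) \<in> K" if S: "S \<in> SPD1" and le: "norm (mat_log (PP S)) \<le> D" for S
  proof -
    have P: "spd (PP S)" "det (PP S) = 1" "PP S ** A = B" using Phi_in_fiber[OF S] by (auto simp: fiber_def SPD1_def)
    then show ?thesis using le spd_log[OF P(1)] trace_mat_log[OF P(1)] by (simp add: K_def K0_def)
  qed
  have "K \<noteq> {}" using inK[OF one] by (auto simp: D_def)
  then have "\<exists>S\<in>K. \<forall>S'\<in>K. norm S \<le> norm S'"
    using \<open>compact K\<close> by (intro continuous_attains_inf continuous_intros)
  then obtain T where T: "T \<in> K" and min: "\<And>T'. T' \<in> K \<Longrightarrow> norm T \<le> norm T'" by blast
  have T': "transpose T = T" "trace T = 0" "norm T \<le> D" "mat_exp T ** A = B" using T K0D by (auto simp: K_def)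
  then have "mat_exp T \<in> fiber A B" by (simp add: fiber_def SPD1_def spd_exp det_mat_exp)
  then obtain S where S: "S \<in> SPD1" "mat_exp T = PP S" by (rule fiber_imp_Phi)
  have TS: "mat_log (PP S) = T" using S mat_log_exp[OF T'(1)] by simp
  have "f S \<le> f S'" if S': "S' \<in> SPD1" for S'
  proof -
    have "norm T \<le> norm (mat_log (PP S'))"
    proof (cases "norm (mat_log (PP S')) \<le> D")
      case True
      then show ?thesis by (intro min inK S')
    qed (use T' in simp)
    then show ?thesis by (simp add: fP S S' TS power_mono)
  qed
  then show ?thesis using S by blast
qed

text \<open>
  A descent step from a minimizer gains nothing, but would gain a positive multiple of the squared
  residual.
\<close>

lemma minimizer_residual:
  assumes S: "S \<in> SPD1" and min: "\<And>S'. S' \<in> SPD1 \<Longrightarrow> f S \<le> f S'" shows "res S = 0"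
proof -
  let ?c = "psi (ai_dist R (QQ S) / sqrt 2)"
  note d = cost_descent[OF S order_refl]
  have "f S \<le> f S - 1 / (2 * ?c) * (norm (res S))\<^sup>2" using min[OF d(2)] d(1) by linarith
  moreover have "1 / (2 * ?c) > 0" using psi_ge_1[of "ai_dist R (QQ S) / sqrt 2"] by simp
  ultimately have "(norm (res S))\<^sup>2 \<le> 0" by (simp add: divide_le_0_iff)
  then show ?thesis by simp
qed

lemma minimizer_growth:
  assumes S: "S \<in> SPD1" and min: "\<And>S'. S' \<in> SPD1 \<Longrightarrow> f S \<le> f S'" and S': "S' \<in> SPD1"
  shows "f S + (ai_dist S S')\<^sup>2 / 2 \<le> f S'"
proof -
  obtain X where X: "transpose X = X" "trace X = 0" "S' = mat_sqrt S ** mat_exp X ** mat_sqrt S" "norm X = ai_dist S S'"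
    by (rule SPD1_pair[OF S S'])
  show ?thesis using cost_strongly_convex[OF S X(1,2)] minimizer_residual[OF S min] X(3,4) by simp
qed

lemma canonical_controller_iff:
  assumes S: "S \<in> SPD1"
  shows "PP S = canonical_controller A B \<longleftrightarrow> (\<forall>S'\<in>SPD1. f S \<le> f S')"
proof -
  have ai_f: "ai_dist (mat 1) (PP S) \<le> ai_dist (mat 1) (PP S') \<longleftrightarrow> f S \<le> f S'" if "S \<in> SPD1" "S' \<in> SPD1" for S S'
    using that by (simp add: SPD1_def ai_dist_Phi_one cost_eq power_mono_iff ai_dist_nonneg)
  have am: "is_arg_min (ai_dist (mat 1)) (\<lambda>P. P \<in> fiber A B) (PP S) \<longleftrightarrow> (\<forall>S'\<in>SPD1. f S \<le> f S')" if "S \<in> SPD1" for S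
  proof -
    have "is_arg_min (ai_dist (mat 1)) (\<lambda>P. P \<in> fiber A B) (PP S) \<longleftrightarrow> (\<forall>P\<in>fiber A B. ai_dist (mat 1) (PP S) \<le> ai_dist (mat 1) P)"
      using Phi_in_fiber[OF that] by (auto simp: is_arg_min_def not_less)
    also have "\<dots> \<longleftrightarrow> (\<forall>S'\<in>SPD1. ai_dist (mat 1) (PP S) \<le> ai_dist (mat 1) (PP S'))"
      using Phi_in_fiber fiber_imp_Phi by metis
    also have "\<dots> \<longleftrightarrow> (\<forall>S'\<in>SPD1. f S \<le> f S')" using ai_f[OF that] by simp
    finally show ?thesis .
  qed
  obtain T where T: "T \<in> SPD1" "\<And>S'. S' \<in> SPD1 \<Longrightarrow> f T \<le> f S'" using exists_minimizer by blast
  have uniq: "S = T" if "S \<in> SPD1" "\<forall>S'\<in>SPD1. f S \<le> f S'" for S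
  proof -
    have "f T + (ai_dist T S)\<^sup>2 / 2 \<le> f S" by (rule minimizer_growth[OF T that(1)])
    moreover have "f S \<le> f T" using that(2) T(1) by blast
    ultimately have "(ai_dist T S)\<^sup>2 \<le> 0" by linarith
    then have "ai_dist T S = 0" by simp
    then show ?thesis using ai_dist_eq_0[of T S] T(1) that(1) by (simp add: SPD1_def)
  qed
  have "canonical_controller A B = PP T"
    unfolding canonical_controller_def
  proof (rule the_equality)
    show "is_arg_min (ai_dist (mat 1)) (\<lambda>P. P \<in> fiber A B) (PP T)" using am[OF T(1)] T(2) by simp
    fix P assume P: "is_arg_min (ai_dist (mat 1)) (\<lambda>P. P \<in> fiber A B) P"
    then have "P \<in> fiber A B" by (simp add: is_arg_min_def)
    then obtain S' where S': "S' \<in> SPD1" "P = PP S'" by (rule fiber_imp_Phi)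
    then show "P = PP T" using am[OF S'(1)] P uniq[OF S'(1)] by simp
  qed
  moreover have "S = T" if "PP S = PP T"
  proof -
    have sp: "spd S" "spd T" using S T(1) by (simp_all add: SPD1_def)
    have "ai_dist S T = 0" using ai_dist_Phi[OF sp] ai_dist_eq_0[OF spd_Phi spd_Phi, OF sp] that by simp
    then show ?thesis using ai_dist_eq_0[OF sp] by simp
  qed
  ultimately show ?thesis using uniq[OF S] T(2) by auto
qed

section \<open>Certificates and linear convergence\<close>

text \<open>
  Convexity along the geodesic from \<open>S\<close> to the minimizer \<open>T\<close>, with initial slope at least
  \<open>- \<bar>res S\<bar> d\<close> for the distance \<open>d\<close>, is played off against the quadratic growth at \<open>T\<close>.
\<close>

lemma certificates:
  assumes T: "T \<in> SPD1" and min: "\<And>S'. S' \<in> SPD1 \<Longrightarrow> f T \<le> f S'" and S: "S \<in> SPD1"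
  shows "ai_dist S T \<le> norm (res S)" "f S - f T \<le> 1 / 2 * (norm (res S))\<^sup>2" "(ai_dist S T)\<^sup>2 \<le> 2 * (f S - f T)"
proof -
  obtain X where X: "transpose X = X" "trace X = 0" "T = mat_sqrt S ** mat_exp X ** mat_sqrt S" "norm X = ai_dist S T"
    by (rule SPD1_pair[OF S T])
  define d where "d = ai_dist S T"
  have d: "ai_dist T S = d" using S T by (simp add: d_def SPD1_def ai_dist_commute)
  have 1: "f S - res S \<bullet> X + d\<^sup>2 / 2 \<le> f T" using cost_strongly_convex[OF S X(1,2)] X(3,4) by (simp add: d_def)
  have 2: "f T + d\<^sup>2 / 2 \<le> f S" using minimizer_growth[OF T min S] by (simp add: d)
  have 3: "res S \<bullet> X \<le> norm (res S) * d" using norm_cauchy_schwarz[of "res S" X] X(4) by (simp add: d_def)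
  have "d * d \<le> norm (res S) * d" using 1 2 3 by (simp add: power2_eq_square)
  moreover have "0 \<le> d" by (simp add: d_def ai_dist_nonneg)
  ultimately show "ai_dist S T \<le> norm (res S)" unfolding d_def[symmetric] by (cases "d = 0") auto
  have "0 \<le> (norm (res S) - d)\<^sup>2" by simp
  then show "f S - f T \<le> 1 / 2 * (norm (res S))\<^sup>2" using 1 3 by (simp add: power2_diff)
  show "(ai_dist S T)\<^sup>2 \<le> 2 * (f S - f T)" using 2 by (simp add: d_def)
qed

text \<open>
  The residual is an orthogonal projection of a logarithm whose norm is the distance. Together with
  the distance certificate this identifies the residual in the model problem.
\<close>

lemma norm_residual_le: 
  assumes "S \<in> SPD1" shows "norm (res S) \<le> ai_dist R (QQ S)"
proof -
  have S: "spd S" using assms by (simp add: SPD1_def)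
  have "norm (Rcal A C V B S) = ai_dist R (QQ S)"
    using ai_dist_commute[OF spd_R spd_Qcal[OF S]] by (simp add: Rcal_def ai_dist_def[of "QQ S"])
  moreover have "norm (res S) * norm (res S) = Rcal A C V B S \<bullet> bdiag 0 (res S)"
    unfolding residual_inner[OF residual_props(1)[OF assms]] by (simp add: norm_eq_sqrt_inner)
  moreover have "\<dots> \<le> norm (Rcal A C V B S) * norm (res S)"
    using norm_cauchy_schwarz[of "Rcal A C V B S" "bdiag 0 (res S)"] by (simp add: norm_bdiag)
  ultimately have "norm (res S) * norm (res S) \<le> ai_dist R (QQ S) * norm (res S)" by simp
  then show ?thesis by (cases "res S = 0") (simp_all add: ai_dist_nonneg)
qed

lemma iterate_step:
  assumes S0: "S0 \<in> SPD1"
  defines "D0 \<equiv> init_dist A C V B S0" and "L0 \<equiv> step_const A C V B S0" and "S \<equiv> iterate A C V B S0"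
  shows "S k \<in> SPD1" "ai_dist R (QQ (S k)) \<le> D0"
    "f (S (Suc k)) \<le> f (S k) - 1 / (2 * L0) * (norm (res (S k)))\<^sup>2"
proof -
  have L: "L0 = psi (D0 / sqrt 2)" by (simp add: L0_def step_const_def D0_def)
  have Suc: "S (Suc k) = mat_sqrt (S k) ** mat_exp ((1 / L0) *\<^sub>R res (S k)) ** mat_sqrt (S k)" for k
    by (simp add: S_def L0_def inverse_eq_divide)
  have st: "f (S (Suc k)) \<le> f (S k) - 1 / (2 * L0) * (norm (res (S k)))\<^sup>2" "S (Suc k) \<in> SPD1"
    if "S k \<in> SPD1" "ai_dist R (QQ (S k)) \<le> D0" for k
    using cost_descent[OF that] unfolding Suc L .
  have L1: "L0 \<ge> 1" by (simp add: L psi_ge_1)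
  have inv: "S k \<in> SPD1 \<and> ai_dist R (QQ (S k)) \<le> D0" for k
  proof (induction k)
    case 0
    then show ?case using S0 by (simp add: S_def D0_def init_dist_def)
  next
    case (Suc k)
    then have s: "S k \<in> SPD1" "ai_dist R (QQ (S k)) \<le> D0" by auto
    have "0 \<le> 1 / (2 * L0) * (norm (res (S k)))\<^sup>2" using L1 by simp
    then have "f (S (Suc k)) \<le> f (S k)" using st(1)[OF s] by linarith
    then have "ai_dist R (QQ (S (Suc k))) \<le> ai_dist R (QQ (S k))"
      by (simp only: cost_eq) (rule power2_le_imp_le, simp_all add: ai_dist_nonneg)
    then show ?case using st(2)[OF s] s by simp
  qed
  show "S k \<in> SPD1" "ai_dist R (QQ (S k)) \<le> D0" using inv by blast+
  then show "f (S (Suc k)) \<le> f (S k) - 1 / (2 * L0) * (norm (res (S k)))\<^sup>2" by (rule st)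
qed

lemma linear_convergence:
  assumes S0: "S0 \<in> SPD1" and T: "T \<in> SPD1" and min: "\<And>S'. S' \<in> SPD1 \<Longrightarrow> f T \<le> f S'"
  defines "D0 \<equiv> init_dist A C V B S0" and "L0 \<equiv> step_const A C V B S0" and "S \<equiv> iterate A C V B S0"
  defines "q0 \<equiv> 1 - inverse L0"
  shows "f (S k) - f T \<le> D0\<^sup>2 / 2 * q0 ^ k" "ai_dist (S k) T \<le> D0 * sqrt (q0 ^ k)"
    "norm (res (S k)) \<le> sqrt L0 * D0 * sqrt (q0 ^ k)"
proof -
  note st = iterate_step[OF S0, folded D0_def L0_def S_def]
  have L1: "L0 \<ge> 1" by (simp add: L0_def step_const_def psi_ge_1)
  have q: "0 \<le> q0" using L1 by (simp add: q0_def inverse_le_1_iff)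
  have D: "0 \<le> D0" by (simp add: D0_def init_dist_def ai_dist_nonneg)
  have rate: "f (S k) - f T \<le> D0\<^sup>2 / 2 * q0 ^ k" for k
  proof (induction k)
    case 0
    have "f (S 0) = D0\<^sup>2 / 2" by (simp add: S_def cost_eq D0_def init_dist_def)
    then show ?case using cost_nonneg[of T] by simp
  next
    case (Suc k)
    have "1 / L0 * (f (S k) - f T) \<le> 1 / L0 * (1 / 2 * (norm (res (S k)))\<^sup>2)"
      using certificates(2)[OF T min st(1)] L1 by (intro mult_left_mono) auto
    then have "f (S (Suc k)) - f T \<le> f (S k) - f T - 1 / L0 * (f (S k) - f T)"
      using st(3)[of k] by simp
    also have "\<dots> = q0 * (f (S k) - f T)" by (simp add: q0_def inverse_eq_divide algebra_simps)
    also have "\<dots> \<le> q0 * (D0\<^sup>2 / 2 * q0 ^ k)" using Suc q by (intro mult_left_mono)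
    finally show ?case by (simp add: mult_ac)
  qed
  then show "f (S k) - f T \<le> D0\<^sup>2 / 2 * q0 ^ k" .
  show "ai_dist (S k) T \<le> D0 * sqrt (q0 ^ k)"
  proof (rule power2_le_imp_le)
    show "(ai_dist (S k) T)\<^sup>2 \<le> (D0 * sqrt (q0 ^ k))\<^sup>2"
      using certificates(3)[OF T min st(1), of k] rate[of k] q by (simp add: power_mult_distrib)
  qed (use D q in simp)
  show "norm (res (S k)) \<le> sqrt L0 * D0 * sqrt (q0 ^ k)"
  proof (rule power2_le_imp_le)
    have "1 / (2 * L0) * (norm (res (S k)))\<^sup>2 \<le> D0\<^sup>2 / 2 * q0 ^ k"
      using st(3)[of k] min[OF st(1)[of "Suc k"]] rate[of k] by linarith
    then have "2 * L0 * (1 / (2 * L0) * (norm (res (S k)))\<^sup>2) \<le> 2 * L0 * (D0\<^sup>2 / 2 * q0 ^ k)"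
      using L1 by (intro mult_left_mono) auto
    then show "(norm (res (S k)))\<^sup>2 \<le> (sqrt L0 * D0 * sqrt (q0 ^ k))\<^sup>2"
      using L1 q by (simp add: power_mult_distrib mult_ac)
  qed (use D q L1 in simp)
qed

end

lemma exp_tolerance:
  fixes a e x :: real
  assumes "0 < a" "0 < e" "ln (a / e) \<le> x" shows "a * exp (- x) \<le> e"
proof -
  have "a / e = exp (ln (a / e))" using assms by simp
  also have "\<dots> \<le> exp x" using assms(3) by (simp only: exp_le_cancel_iff)
  finally have "a \<le> e * exp x" using assms by (simp add: field_simps)
  then have "a * exp (- x) \<le> e * exp x * exp (- x)" by (intro mult_right_mono) auto
  then show ?thesis by (simp add: mult.assoc flip: exp_add)
qed

text \<open>
  The cases \<open>p = 1\<close> and \<open>p = 2\<close> are those of \<open>q\<^sup>k\<close> and of its square root.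
\<close>

lemma geometric_tolerance:
  fixes a e q p :: real
  assumes q: "0 < q" "q < 1" and ae: "0 < a" "0 < e" and p: "0 < p"
    and k: "p / (- ln q) * max (ln (a / e)) 0 \<le> real k"
  shows "a * exp (ln q * real k / p) \<le> e"
proof -
  have l: "- ln q > 0" using q by simp
  have "0 \<le> p / (- ln q)" using p l by (intro divide_nonneg_pos) auto
  then have "p / (- ln q) * ln (a / e) \<le> p / (- ln q) * max (ln (a / e)) 0"
    by (intro mult_left_mono) auto
  then have "p / (- ln q) * ln (a / e) \<le> real k" using k by linarith
  then have "(- ln q / p) * (p / (- ln q) * ln (a / e)) \<le> (- ln q / p) * real k"
    using p l by (intro mult_left_mono divide_nonneg_pos) auto
  moreover have "(- ln q / p) * (p / (- ln q) * ln (a / e)) = ln (a / e)" using p l by (simp add: field_simps)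
  ultimately have "ln (a / e) \<le> - (ln q * real k / p)" by simp
  from exp_tolerance[OF ae this] show ?thesis by simp
qed

section \<open>Sharpness of the certificates\<close>

text \<open>
  The columns of a permutation matrix serve as \<open>[U, V]\<close>, and \<open>A = B = U\<close>, so that the identity is
  the canonical controller.
\<close>

lemma model_problem:
  assumes card: "CARD('d::finite) = CARD('m::finite) + CARD('n::finite)"
  obtains A U B :: "real^'m^'d" and C :: "real^'m^'m" and V :: "real^'n^'d"
  where "problem_data A U C V B" "R0 A C V B = mat 1" "Qcal A C B (mat 1 :: real^'n^'n) = mat 1"
proof -
  have "card (UNIV :: ('m + 'n) set) = card (UNIV :: 'd set)"
    using card by (simp add: card_UNIV_sum)
  then obtain h :: "'m + 'n \<Rightarrow> 'd" where h: "bij h"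
    using finite_same_card_bij[of "UNIV :: ('m + 'n) set" "UNIV :: 'd set"] by auto
  define U :: "real^'m^'d" where "U = (\<chi> i a. if i = h (Inl a) then 1 else 0)"
  define V :: "real^'n^'d" where "V = (\<chi> i a. if i = h (Inr a) then 1 else 0)"
  let ?Q = "append_cols U V"
  have Q: "?Q $ i $ j = (if i = h j then 1 else 0)" for i j
    by (cases j) (simp_all add: append_cols_def U_def V_def)
  have inj: "h i = h j \<longleftrightarrow> i = j" for i j using h by (simp add: bij_def inj_eq)
  have "transpose ?Q ** ?Q = mat 1"
    unfolding vec_eq_iff matrix_mult_nth transpose_def mat_def vec_lambda_beta Q
    by (auto simp: inj if_distrib[of "\<lambda>x. x * _"] sum.delta cong: if_cong)
  moreover have "?Q ** transpose ?Q = mat 1"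
  proof -
    have "(\<Sum>k\<in>UNIV. (if i = h k then 1 else 0) * (if j = h k then 1 else 0)) = (\<Sum>k\<in>UNIV. (if i = k then 1 else 0) * (if j = k then 1 else (0 :: real)))" for i j
      by (rule sum.reindex_bij_betw[OF h])
    then show ?thesis
      unfolding vec_eq_iff matrix_mult_nth transpose_def mat_def vec_lambda_beta Q
      by (simp add: if_distrib[of "\<lambda>x. x * _"] sum.delta cong: if_cong)
  qed
  ultimately have fr: "frame ?Q" by (simp add: frame_def)
  have "block_mat (transpose U ** U) (transpose U ** V) (transpose V ** U) (transpose V ** V) = block_mat (mat 1) 0 0 (mat 1)"
    using fr unfolding frame_def append_cols_gram block_mat_one by simp
  then have UU: "transpose U ** U = mat 1" and VU: "transpose V ** U = 0" by (simp_all add: block_mat_eq_iff)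
  have "inj ((*v) U)"
  proof (rule injI)
    fix x y assume "U *v x = U *v y"
    then have "transpose U *v (U *v x) = transpose U *v (U *v y)" by simp
    then show "x = y" unfolding matrix_vector_mul_assoc UU by simp
  qed
  then have rk: "rank U = CARD('m)" by (simp add: full_rank_injective)
  have one: "matrix_inv (mat 1 :: real^'m^'m) = mat 1" by (simp add: matrix_inv_eqI)
  have data: "problem_data U U (mat 1) V U"
    using rk fr UU by (simp add: problem_data_def frame_def admissible_def spd_mat_1 invertible_def exI[of _ "mat 1"])
  have M: "blk_M U (mat 1) U = mat 1" by (simp add: blk_M_def one UU)
  have T: "blk_T U (mat 1) V U = 0" by (simp add: blk_T_def blk_N_def one VU)
  have L: "blk_L U (mat 1) V U = mat 1" by (simp add: blk_L_def T block_mat_one)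
  have "matrix_inv (mat 1 :: real^('m + 'n)^('m + 'n)) = mat 1" by (simp add: matrix_inv_eqI)
  then have R: "R0 U (mat 1) V U = mat 1" by (simp add: R0_def L)
  have "Qcal U (mat 1) U (mat 1 :: real^'n^'n) = mat 1" by (simp add: Qcal_def Let_def M block_mat_one)
  then show ?thesis using that data R by blast
qed

lemma SPD1_nontrivial:
  assumes "2 \<le> CARD('n::finite)" obtains S :: "real^'n^'n" where "S \<in> SPD1" "S \<noteq> mat 1"
proof -
  have "\<not> (\<forall>i j :: 'n. i = j)"
  proof
    assume "\<forall>i j :: 'n. i = j"
    then have "is_singleton (UNIV :: 'n set)" by (auto simp: is_singleton_def)
    then show False using assms by (simp add: is_singleton_altdef)
  qed
  then obtain i j :: 'n where ij: "i \<noteq> j" by blast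
  define g :: "'n \<Rightarrow> real" where "g k = (if k = i then 1 else 0) - (if k = j then 1 else 0)" for k
  let ?X = "diagm g"
  have tr: "trace ?X = 0" by (simp add: trace_def diagm_def g_def sum_subtractf)
  have nz: "?X \<noteq> 0"
  proof
    assume "?X = 0"
    then have "?X $ i $ i = 0" by simp
    then show False using ij by (simp add: diagm_def g_def)
  qed
  have "mat_exp ?X \<in> SPD1" by (simp add: SPD1_def spd_exp det_mat_exp tr)
  moreover have "mat_exp ?X \<noteq> mat 1"
  proof
    assume "mat_exp ?X = mat 1"
    then have "mat_log (mat_exp ?X) = mat_log (mat_exp 0)" by simp
    then show False using nz mat_log_exp[of ?X] mat_log_exp[of "0 :: real^'n^'n"] by simp
  qed
  ultimately show ?thesis using that by blast
qed

lemma certificates_attained: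
  assumes card: "CARD('d::finite) = CARD('m::finite) + CARD('n::finite)" and n: "2 \<le> CARD('n)"
  obtains A U B :: "real^'m^'d" and C :: "real^'m^'m" and V :: "real^'n^'d" and S T :: "real^'n^'n"
  where "problem_data A U C V B" "S \<in> SPD1" "T \<in> SPD1" "Phi A U C V B T = canonical_controller A B"
    "0 < norm (residual A C V B S)"
    "ai_dist (Phi A U C V B S) (canonical_controller A B) = norm (residual A C V B S)"
    "cost A C V B S - cost A C V B T = 1 / 2 * (norm (residual A C V B S))\<^sup>2"
proof -
  obtain A U B :: "real^'m^'d" and C :: "real^'m^'m" and V :: "real^'n^'d"
    where P: "problem_data A U C V B" and R: "R0 A C V B = mat 1" and Q: "Qcal A C B (mat 1 :: real^'n^'n) = mat 1"
    by (rule model_problem[OF card])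
  obtain S :: "real^'n^'n" where S: "S \<in> SPD1" "S \<noteq> mat 1" by (rule SPD1_nontrivial[OF n])
  let ?T = "mat 1 :: real^'n^'n"
  interpret controller_problem A U B C V using P card by unfold_locales
  have T: "?T \<in> SPD1" by (simp add: SPD1_def spd_mat_1)
  have sp: "spd S" using S by (simp add: SPD1_def)
  have d: "ai_dist R (QQ S') = ai_dist ?T S'" if "spd S'" for S'
    using ai_dist_Qcal[OF spd_mat_1 that] R Q by simp
  have fT: "f ?T = 0" using ai_dist_eq_0[OF spd_mat_1 spd_mat_1] by (simp add: cost_eq d[OF spd_mat_1])
  then have min: "f ?T \<le> f S'" if "S' \<in> SPD1" for S' using cost_nonneg by simp
  have can: "PP ?T = canonical_controller A B" using canonical_controller_iff[OF T] min by blast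
  have dS: "ai_dist S ?T = ai_dist R (QQ S)" using ai_dist_commute[OF sp spd_mat_1] d[OF sp] by simp
  have eq: "norm (res S) = ai_dist S ?T"
    using norm_residual_le[OF S(1)] certificates(1)[OF T min S(1)] dS by simp
  show ?thesis
  proof (rule that[OF P S(1) T can])
    show "0 < norm (res S)" using eq ai_dist_eq_0[OF sp spd_mat_1] S(2) ai_dist_nonneg[of S ?T] by linarith
    show "ai_dist (PP S) (canonical_controller A B) = norm (res S)"
      unfolding can[symmetric] eq by (rule ai_dist_Phi[OF sp spd_mat_1])
    show "f S - f ?T = 1 / 2 * (norm (res S))\<^sup>2" unfolding fT eq dS by (simp add: cost_eq)
  qed
qed

section \<open>Gradient descent for the canonical controller\<close>

theorem theorem7:
  fixes A U B :: "real^'m^'d" and C :: "real^'m^'m" and V :: "real^'n^'d"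
    and Sstar S0 :: "real^'n^'n" and S :: "nat \<Rightarrow> real^'n^'n"
    and D0 L0 q0 :: real
  assumes "CARD('m) < CARD('d)" and "CARD('n) = CARD('d) - CARD('m)"
    and "problem_data A U C V B"
    and "Sstar \<in> SPD1" and "Phi A U C V B Sstar = canonical_controller A B"
    and "S0 \<in> SPD1"
    and "D0 = init_dist A C V B S0"
    and "L0 = step_const A C V B S0"
    and "q0 = 1 - inverse L0"
    and "S = iterate A C V B S0"
  shows
    "(D0 = 0 \<longrightarrow> Phi A U C V B S0 = canonical_controller A B) \<and>
     (\<forall>k. det (S k) = 1 \<and>
        cost A C V B (S (Suc k)) \<le>
          cost A C V B (S k) - 1 / (2 * L0) * (norm (residual A C V B (S k)))\<^sup>2 \<and>
        cost A C V B (S k) - cost A C V B Sstar \<le> D0\<^sup>2 / 2 * q0 ^ k \<and>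
        ai_dist (S k) Sstar = ai_dist (Phi A U C V B (S k)) (canonical_controller A B) \<and>
        ai_dist (Phi A U C V B (S k)) (canonical_controller A B) \<le> D0 * sqrt (q0 ^ k) \<and>
        norm (residual A C V B (S k)) \<le> sqrt L0 * D0 * sqrt (q0 ^ k) \<and>
        ai_dist (Phi A U C V B (S k)) (canonical_controller A B)
          \<le> norm (residual A C V B (S k)) \<and>
        0 \<le> cost A C V B (S k) - cost A C V B Sstar \<and>
        cost A C V B (S k) - cost A C V B Sstar
          \<le> 1 / 2 * (norm (residual A C V B (S k)))\<^sup>2) \<and>
     (2 \<le> CARD('n) \<longrightarrow>
        \<not> (\<exists>c<1. \<forall>(A'::real^'m^'d) U' C' (V'::real^'n^'d) B'. \<forall>S0'\<in>SPD1. \<forall>k.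
              problem_data A' U' C' V' B' \<longrightarrow>
              ai_dist (Phi A' U' C' V' B' (iterate A' C' V' B' S0' k))
                  (canonical_controller A' B')
                \<le> c * norm (residual A' C' V' B' (iterate A' C' V' B' S0' k))) \<and>
        \<not> (\<exists>c<1 / 2. \<forall>(A'::real^'m^'d) U' C' (V'::real^'n^'d) B'.
              \<forall>Sstar'\<in>SPD1. \<forall>S0'\<in>SPD1. \<forall>k.
              problem_data A' U' C' V' B' \<longrightarrow>
              Phi A' U' C' V' B' Sstar' = canonical_controller A' B' \<longrightarrow>
              cost A' C' V' B' (iterate A' C' V' B' S0' k) - cost A' C' V' B' Sstar'
                \<le> c * (norm (residual A' C' V' B' (iterate A' C' V' B' S0' k)))\<^sup>2)) \<and>
     (D0 > 0 \<longrightarrow> (\<forall>\<epsilon>f \<epsilon>x \<epsilon>r :: real. \<epsilon>f > 0 \<longrightarrow> \<epsilon>x > 0 \<longrightarrow> \<epsilon>r > 0 \<longrightarrow>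
        (let chi0 = - ln q0 in \<forall>k.
          (real k \<ge> 1 / chi0 * max (ln (D0\<^sup>2 / (2 * \<epsilon>f))) 0 \<longrightarrow>
             cost A C V B (S k) - cost A C V B Sstar \<le> \<epsilon>f) \<and>
          (real k \<ge> 2 / chi0 * max (ln (D0 / \<epsilon>x)) 0 \<longrightarrow>
             ai_dist (Phi A U C V B (S k)) (canonical_controller A B) \<le> \<epsilon>x) \<and>
          (real k \<ge> 2 / chi0 * max (ln (sqrt L0 * D0 / \<epsilon>r)) 0 \<longrightarrow>
             norm (residual A C V B (S k)) \<le> \<epsilon>r))))"
proof -
  have card: "CARD('d) = CARD('m) + CARD('n)" using assms(1,2) by simp
  interpret controller_problem A U B C V using assms(3) card by unfold_locales
  note T = assms(4) and S0 = assms(6)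
  have can: "canonical_controller A B = PP Sstar" using assms(5) by simp
  have min: "f Sstar \<le> f S'" if "S' \<in> SPD1" for S'
    using canonical_controller_iff[OF T] assms(5) that by blast
  note st = iterate_step[OF S0, folded assms(7,8,10)]
  note rate = linear_convergence[OF S0 T min, folded assms(7,8,10), folded assms(9)]
  have sp: "spd (S k)" for k using st(1) by (simp add: SPD1_def)
  have spT: "spd Sstar" using T by (simp add: SPD1_def)
  have iso: "ai_dist (PP (S k)) (canonical_controller A B) = ai_dist (S k) Sstar" for k
    unfolding can by (rule ai_dist_Phi[OF sp spT])
  note cert = certificates[OF T min st(1)]
  have L0: "L0 = psi (D0 / sqrt 2)" by (simp add: assms(7,8) step_const_def)
  have D0: "0 \<le> D0" by (simp add: assms(7) init_dist_def ai_dist_nonneg)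

  have zero: "PP S0 = canonical_controller A B" if "D0 = 0"
  proof -
    have "f S0 = 0" using that by (simp add: cost_eq assms(7) init_dist_def)
    then show ?thesis using canonical_controller_iff[OF S0] cost_nonneg by simp
  qed

  have each: "det (S k) = 1 \<and>
      f (S (Suc k)) \<le> f (S k) - 1 / (2 * L0) * (norm (res (S k)))\<^sup>2 \<and>
      f (S k) - f Sstar \<le> D0\<^sup>2 / 2 * q0 ^ k \<and>
      ai_dist (S k) Sstar = ai_dist (PP (S k)) (canonical_controller A B) \<and>
      ai_dist (PP (S k)) (canonical_controller A B) \<le> D0 * sqrt (q0 ^ k) \<and>
      norm (res (S k)) \<le> sqrt L0 * D0 * sqrt (q0 ^ k) \<and>
      ai_dist (PP (S k)) (canonical_controller A B) \<le> norm (res (S k)) \<and>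
      0 \<le> f (S k) - f Sstar \<and>
      f (S k) - f Sstar \<le> 1 / 2 * (norm (res (S k)))\<^sup>2" for k
    unfolding iso
  proof (intro conjI)
    show "det (S k) = 1" using st(1) by (simp add: SPD1_def)
    show "0 \<le> f (S k) - f Sstar" using min[OF st(1)] by simp
  qed (simp_all only: st(3) rate cert)

  have tol: "let chi0 = - ln q0 in \<forall>k.
      (real k \<ge> 1 / chi0 * max (ln (D0\<^sup>2 / (2 * \<epsilon>f))) 0 \<longrightarrow> f (S k) - f Sstar \<le> \<epsilon>f) \<and>
      (real k \<ge> 2 / chi0 * max (ln (D0 / \<epsilon>x)) 0 \<longrightarrow> ai_dist (PP (S k)) (canonical_controller A B) \<le> \<epsilon>x) \<and>
      (real k \<ge> 2 / chi0 * max (ln (sqrt L0 * D0 / \<epsilon>r)) 0 \<longrightarrow> norm (res (S k)) \<le> \<epsilon>r)"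
    if pos: "0 < D0" and eps: "0 < \<epsilon>f" "0 < \<epsilon>x" "0 < \<epsilon>r" for \<epsilon>f \<epsilon>x \<epsilon>r
  proof -
    have "1 < L0" unfolding L0 using pos by (intro psi_gt_1) simp
    then have q: "0 < q0" "q0 < 1" and Lpos: "0 < sqrt L0" by (simp_all add: assms(9) inverse_less_1_iff)
    have pw: "q0 ^ k = exp (ln q0 * real k / 1)" "sqrt (q0 ^ k) = exp (ln q0 * real k / 2)" for k
    proof -
      show *: "q0 ^ k = exp (ln q0 * real k / 1)" using q by (simp add: exp_of_nat2_mult)
      have "exp (ln q0 * real k / 2) * exp (ln q0 * real k / 2) = q0 ^ k" unfolding * by (simp flip: exp_add)
      then show "sqrt (q0 ^ k) = exp (ln q0 * real k / 2)"
        by (intro real_sqrt_unique) (simp_all add: power2_eq_square)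
    qed
    show ?thesis
      unfolding Let_def
    proof (intro allI conjI impI)
      fix k :: nat
      show "f (S k) - f Sstar \<le> \<epsilon>f" if k: "real k \<ge> 1 / (- ln q0) * max (ln (D0\<^sup>2 / (2 * \<epsilon>f))) 0"
      proof -
        have e: "D0\<^sup>2 / 2 / \<epsilon>f = D0\<^sup>2 / (2 * \<epsilon>f)" by simp
        have "D0\<^sup>2 / 2 * q0 ^ k \<le> \<epsilon>f"
          unfolding pw(1) using pos eps k by (intro geometric_tolerance[OF q]) (simp_all only: e, simp_all)
        then show ?thesis using rate(1)[of k] by linarith
      qed
      show "ai_dist (PP (S k)) (canonical_controller A B) \<le> \<epsilon>x"
        if k: "real k \<ge> 2 / (- ln q0) * max (ln (D0 / \<epsilon>x)) 0"
      proof -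
        have "D0 * sqrt (q0 ^ k) \<le> \<epsilon>x" unfolding pw(2) using pos eps k by (intro geometric_tolerance[OF q]) simp_all
        then show ?thesis unfolding iso using rate(2)[of k] by linarith
      qed
      show "norm (res (S k)) \<le> \<epsilon>r" if k: "real k \<ge> 2 / (- ln q0) * max (ln (sqrt L0 * D0 / \<epsilon>r)) 0"
      proof -
        have "sqrt L0 * D0 * sqrt (q0 ^ k) \<le> \<epsilon>r"
          unfolding pw(2) using pos Lpos eps k by (intro geometric_tolerance[OF q]) simp_all
        then show ?thesis using rate(3)[of k] by linarith
      qed
    qed
  qed

  have sharp: "\<not> (\<exists>c<1. \<forall>(A'::real^'m^'d) U' C' (V'::real^'n^'d) B'. \<forall>S0'\<in>SPD1. \<forall>k.
              problem_data A' U' C' V' B' \<longrightarrow>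
              ai_dist (Phi A' U' C' V' B' (iterate A' C' V' B' S0' k))
                  (canonical_controller A' B')
                \<le> c * norm (residual A' C' V' B' (iterate A' C' V' B' S0' k))) \<and>
        \<not> (\<exists>c<1 / 2. \<forall>(A'::real^'m^'d) U' C' (V'::real^'n^'d) B'.
              \<forall>Sstar'\<in>SPD1. \<forall>S0'\<in>SPD1. \<forall>k.
              problem_data A' U' C' V' B' \<longrightarrow>
              Phi A' U' C' V' B' Sstar' = canonical_controller A' B' \<longrightarrow>
              cost A' C' V' B' (iterate A' C' V' B' S0' k) - cost A' C' V' B' Sstar'
                \<le> c * (norm (residual A' C' V' B' (iterate A' C' V' B' S0' k)))\<^sup>2)"
    if n: "2 \<le> CARD('n)"
  proof -
    obtain A' U' B' :: "real^'m^'d" and C' :: "real^'m^'m" and V' :: "real^'n^'d" and S' T' :: "real^'n^'n"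
      where P: "problem_data A' U' C' V' B'" "S' \<in> SPD1" "T' \<in> SPD1" "Phi A' U' C' V' B' T' = canonical_controller A' B'"
        and r: "0 < norm (residual A' C' V' B' S')"
        and d: "ai_dist (Phi A' U' C' V' B' S') (canonical_controller A' B') = norm (residual A' C' V' B' S')"
        and c: "cost A' C' V' B' S' - cost A' C' V' B' T' = 1 / 2 * (norm (residual A' C' V' B' S'))\<^sup>2"
      by (rule certificates_attained[OF card n])
    let ?r = "norm (residual A' C' V' B' S')"
    have it: "iterate A' C' V' B' S' 0 = S'" by simp
    show ?thesis
    proof (intro conjI notI; elim exE conjE)
      fix x :: real assume "x < 1" and all: "\<forall>(A'::real^'m^'d) U' C' (V'::real^'n^'d) B'. \<forall>S0'\<in>SPD1. \<forall>k.
              problem_data A' U' C' V' B' \<longrightarrow>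
              ai_dist (Phi A' U' C' V' B' (iterate A' C' V' B' S0' k))
                  (canonical_controller A' B')
                \<le> x * norm (residual A' C' V' B' (iterate A' C' V' B' S0' k))"
      from all[rule_format, OF P(2,1), of 0] have "?r \<le> x * ?r" unfolding it d .
      moreover have "x * ?r < 1 * ?r" using \<open>x < 1\<close> r by (rule mult_strict_right_mono)
      ultimately show False by simp
    next
      fix x :: real assume "x < 1 / 2" and all: "\<forall>(A'::real^'m^'d) U' C' (V'::real^'n^'d) B'.
              \<forall>Sstar'\<in>SPD1. \<forall>S0'\<in>SPD1. \<forall>k.
              problem_data A' U' C' V' B' \<longrightarrow>
              Phi A' U' C' V' B' Sstar' = canonical_controller A' B' \<longrightarrow>
              cost A' C' V' B' (iterate A' C' V' B' S0' k) - cost A' C' V' B' Sstar'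
                \<le> x * (norm (residual A' C' V' B' (iterate A' C' V' B' S0' k)))\<^sup>2"
      from all[rule_format, OF P(3,2,1,4), of 0] have "1 / 2 * ?r\<^sup>2 \<le> x * ?r\<^sup>2" unfolding it c .
      moreover have "x * ?r\<^sup>2 < 1 / 2 * ?r\<^sup>2" using \<open>x < 1 / 2\<close> r by (intro mult_strict_right_mono) simp_all
      ultimately show False by simp
    qed
  qed

  show ?thesis using zero each sharp tol by blast
qed

end
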